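(* Let $W=W_{D_n}$ and let $M$ be a $K$-module. The action of $x_i$ on the $\ddot{\mathfrak H}^{\mathfrak c}_W$-module $\mathbb C[y_1,\dots,y_n]\otimes M$ is realized as follows. For any $f\in\mathbb C[y_1,\dots,y_n]$ and $m\in M$, $$x_i\circ(f\otimes m)=u\sum_{k\ne i}\frac{f-f^{s_{ki}}}{y_i-y_k}\otimes(1+c_kc_i)s_{ki}m+u\sum_{k\ne i}\frac{f-f^{\overline{s}_{ki}}}{y_i+y_k}\otimes(1-c_kc_i)\overline{s}_{ki}m .$$
   Context: Ground field $\mathbb C$, $u\in\mathbb C$. $W=W_{D_n}$ ($n\ge4$) is the group of signed permutations of $e_1,\dots,e_n$ with an even number of sign changes. For $i\ne j$: $s_{ij}$ swaps $e_i,e_j$; $\overline{s}_{ij}$ sends $e_i\mapsto-e_j$, $e_j\mapsto-e_i$ (other basis vectors fixed). $\mathcal C_n$ is generated by $c_1,\dots,c_n$ with $c_i^2=1$, $c_ic_j=-c_jc_i$ ($i\ne j$); $W$ acts on the $c_i$ (by algebra automorphisms), on $\mathfrak h^*=\bigoplus\mathbb Cx_i$ and on $\mathfrak h=\bigoplus\mathbb Cy_i$ by the same signed permutations as on the $e_i$. $K=\mathcal C_n\rtimes\mathbb CW$. The rational double affine Hecke-Clifford algebra $\ddot{\mathfrak H}^{\mathfrak c}_W$ of type $D_n$ is generated by $x_i,y_i,c_i$ ($1\le i\le n$) and $W$, subject to the relations of $K$ and: $x_ix_j=x_jx_i$, $y_iy_j=y_jy_i$, $y_ic_j=c_jy_i$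 (all $i,j$); $x_ic_i=-c_ix_i$, $x_ic_j=c_jx_i$ ($i\ne j$); $wxw^{-1}=w(x)$, $wyw^{-1}=w(y)$ ($w\in W$, $x\in\mathfrak h^*$, $y\in\mathfrak h$); $[y_j,x_i]=u\big((1+c_jc_i)s_{ij}-(1-c_jc_i)\overline{s}_{ij}\big)$ ($i\ne j$); $[y_i,x_i]=-u\sum_{k\ne i}\big((1+c_kc_i)s_{ki}+(1-c_kc_i)\overline{s}_{ki}\big)$. It has the triangular decomposition $\mathbb C[x_1,\dots,x_n]\otimes K\otimes\mathbb C[y_1,\dots,y_n]$. Let $\mathfrak H_x$ be the subalgebra generated by $K$ and $x_1,\dots,x_n$. A $K$-module $M$ is extended to an $\mathfrak H_x$-module by letting all $x_i$ act by $0$, and $M_x=\mathrm{Ind}_{\mathfrak H_x}^{\ddot{\mathfrak H}^{\mathfrak c}_W}M$ is identified as a vector space with $\mathbb C[y_1,\dots,y_n]\otimes M$; this is the module structure in question ($\circ$ denotes the action; $y_i$ acts by left multiplication). $f^\sigma$ denotes the action of $\sigma\in W$ on a polynomial $f$. *)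

theory Defs
  imports "HOL-Algebra.Algebra" "HOL-Algebra.Algebraic_Closure_Type"
    "HOL-Library.Poly_Mapping" "HOL-Library.Cardinality"
begin

section \<open>Left modules, tensor products and induction over non-commutative rings\<close>

text \<open>
  The library locale \<open>module\<close> requires a commutative ring of scalars. Here the ring is arbitrary;
  the record type is reused and its fields \<open>mult\<close> and \<open>one\<close> play no role.
\<close>

locale left_module = R?: ring R + M?: abelian_group M
    for R :: "('r, 'x) ring_scheme" (structure) and M :: "('r, 'm, 'y) module_scheme" (structure) +
  assumes smult_closed: "a \<in> carrier R \<Longrightarrow> m \<in> carrier M \<Longrightarrow> a \<odot>\<^bsub>M\<^esub> m \<in> carrier M"
    and smult_l_distr: "a \<in> carrier R \<Longrightarrow> b \<in> carrier R \<Longrightarrow> m \<in> carrier M \<Longrightarrow>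
      (a \<oplus>\<^bsub>R\<^esub> b) \<odot>\<^bsub>M\<^esub> m = a \<odot>\<^bsub>M\<^esub> m \<oplus>\<^bsub>M\<^esub> b \<odot>\<^bsub>M\<^esub> m"
    and smult_r_distr: "a \<in> carrier R \<Longrightarrow> m \<in> carrier M \<Longrightarrow> m' \<in> carrier M \<Longrightarrow>
      a \<odot>\<^bsub>M\<^esub> (m \<oplus>\<^bsub>M\<^esub> m') = a \<odot>\<^bsub>M\<^esub> m \<oplus>\<^bsub>M\<^esub> a \<odot>\<^bsub>M\<^esub> m'"
    and smult_assoc: "a \<in> carrier R \<Longrightarrow> b \<in> carrier R \<Longrightarrow> m \<in> carrier M \<Longrightarrow>
      (a \<otimes>\<^bsub>R\<^esub> b) \<odot>\<^bsub>M\<^esub> m = a \<odot>\<^bsub>M\<^esub> (b \<odot>\<^bsub>M\<^esub> m)"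
    and smult_one: "m \<in> carrier M \<Longrightarrow> \<one>\<^bsub>R\<^esub> \<odot>\<^bsub>M\<^esub> m = m"

definition with_action :: "('b, 'x) ring_scheme \<Rightarrow> ('r \<Rightarrow> 'b \<Rightarrow> 'b) \<Rightarrow> ('r, 'b) module" where
  "with_action A act = \<lparr>carrier = carrier A, monoid.mult = monoid.mult A, one = one A, ring.zero = ring.zero A,
     ring.add = ring.add A, module.smult = act\<rparr>"

text \<open>
  \<open>A \<otimes>\<^sub>S B\<close> for a right \<open>S\<close>-module \<open>A\<close> (right action \<open>ract\<close>, commuting with a left action of another
  ring given by \<open>module.smult A\<close>) and a left \<open>S\<close>-module \<open>B\<close>: the free abelian group on \<open>A \<times> B\<close> modulo the
  subgroup generated by the usual balanced-biadditivity relators.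
\<close>

definition tensor_relators ::
  "('s, 'x) ring_scheme \<Rightarrow> ('r, 'a) module \<Rightarrow> ('a \<Rightarrow> 's \<Rightarrow> 'a) \<Rightarrow> ('s, 'b) module \<Rightarrow> ('a \<times> 'b \<Rightarrow>\<^sub>0 int) set"
  where
  "tensor_relators S A ract B =
     {frag_of (a \<oplus>\<^bsub>A\<^esub> a', b) - frag_of (a, b) - frag_of (a', b) | a a' b.
        a \<in> carrier A \<and> a' \<in> carrier A \<and> b \<in> carrier B} \<union>
     {frag_of (a, b \<oplus>\<^bsub>B\<^esub> b') - frag_of (a, b) - frag_of (a, b') | a b b'.
        a \<in> carrier A \<and> b \<in> carrier B \<and> b' \<in> carrier B} \<union>
     {frag_of (ract a s, b) - frag_of (a, s \<odot>\<^bsub>B\<^esub> b) | a s b.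
        a \<in> carrier A \<and> s \<in> carrier S \<and> b \<in> carrier B}"

definition tensor_kernel ::
  "('s, 'x) ring_scheme \<Rightarrow> ('r, 'a) module \<Rightarrow> ('a \<Rightarrow> 's \<Rightarrow> 'a) \<Rightarrow> ('s, 'b) module \<Rightarrow> ('a \<times> 'b \<Rightarrow>\<^sub>0 int) set"
  where
  "tensor_kernel S A ract B =
     generate (free_Abelian_group (carrier A \<times> carrier B)) (tensor_relators S A ract B)"

definition tensor_class ::
  "('s, 'x) ring_scheme \<Rightarrow> ('r, 'a) module \<Rightarrow> ('a \<Rightarrow> 's \<Rightarrow> 'a) \<Rightarrow> ('s, 'b) module \<Rightarrow>
     ('a \<times> 'b \<Rightarrow>\<^sub>0 int) \<Rightarrow> ('a \<times> 'b \<Rightarrow>\<^sub>0 int) set"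
  where
  "tensor_class S A ract B p =
     tensor_kernel S A ract B #>\<^bsub>free_Abelian_group (carrier A \<times> carrier B)\<^esub> p"

definition pure_tensor ::
  "('s, 'x) ring_scheme \<Rightarrow> ('r, 'a) module \<Rightarrow> ('a \<Rightarrow> 's \<Rightarrow> 'a) \<Rightarrow> ('s, 'b) module \<Rightarrow>
     'a \<Rightarrow> 'b \<Rightarrow> ('a \<times> 'b \<Rightarrow>\<^sub>0 int) set"
  where
  "pure_tensor S A ract B a b = tensor_class S A ract B (frag_of (a, b))"

text \<open>
  The additive map into \<open>A \<otimes>\<^sub>S B\<close> sending a pure tensor \<open>c \<otimes> d\<close> of some other tensor product to
  \<open>a \<otimes> b\<close>, where \<open>(a, b) = h (c, d)\<close>. If this is well defined then all the cosets in the union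
  coincide.
\<close>

definition tensor_hom ::
  "('s, 'x) ring_scheme \<Rightarrow> ('r, 'a) module \<Rightarrow> ('a \<Rightarrow> 's \<Rightarrow> 'a) \<Rightarrow> ('s, 'b) module \<Rightarrow>
     ('c \<times> 'd \<Rightarrow> 'a \<times> 'b) \<Rightarrow> ('c \<times> 'd \<Rightarrow>\<^sub>0 int) set \<Rightarrow> ('a \<times> 'b \<Rightarrow>\<^sub>0 int) set"
  where
  "tensor_hom S A ract B h T = (\<Union>p\<in>T. tensor_class S A ract B (frag_extend (\<lambda>c. frag_of (h c)) p))"

definition tensor_product ::
  "('s, 'x) ring_scheme \<Rightarrow> ('r, 'a) module \<Rightarrow> ('a \<Rightarrow> 's \<Rightarrow> 'a) \<Rightarrow> ('s, 'b) module \<Rightarrow>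
     ('r, ('a \<times> 'b \<Rightarrow>\<^sub>0 int) set) module"
  where
  "tensor_product S A ract B =
     (let Q = free_Abelian_group (carrier A \<times> carrier B) Mod tensor_kernel S A ract B
      in \<lparr>carrier = carrier Q, monoid.mult = undefined, one = undefined, ring.zero = one Q, ring.add = monoid.mult Q,
          module.smult = (\<lambda>r. tensor_hom S A ract B (\<lambda>(a, b). (r \<odot>\<^bsub>A\<^esub> a, b)))\<rparr>)"

text \<open>\<open>Ind M = R \<otimes>\<^sub>S M\<close> for a subring \<open>S\<close> of \<open>R\<close>.\<close>

definition induced_module ::
  "('r, 'x) ring_scheme \<Rightarrow> 'r set \<Rightarrow> ('r, 'b) module \<Rightarrow> ('r, ('r \<times> 'b \<Rightarrow>\<^sub>0 int) set) module" where
  "induced_module R S M =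
     tensor_product (R\<lparr>carrier := S\<rparr>) (with_action R (monoid.mult R)) (monoid.mult R) M"

section \<open>Algebras presented by generators and relations\<close>

text \<open>The free monoid, written additively so that \<open>'g word \<Rightarrow>\<^sub>0 complex\<close> is the free algebra.\<close>

datatype 'g word = Word (letters: "'g list")

instantiation word :: (type) monoid_add
begin

definition zero_word :: "'a word" where "0 = Word []"

definition plus_word :: "'a word \<Rightarrow> 'a word \<Rightarrow> 'a word" where
  "v + w = Word (letters v @ letters w)"

instance
  by standard (auto simp: zero_word_def plus_word_def)

end

type_synonym 'g free_alg = "'g word \<Rightarrow>\<^sub>0 complex"

definition scal :: "complex \<Rightarrow> 'g free_alg" where
  "scal z = Poly_Mapping.single 0 z"

definition gen :: "'g \<Rightarrow> 'g free_alg" where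
  "gen g = Poly_Mapping.single (Word [g]) 1"

definition presented_alg :: "'g free_alg set \<Rightarrow> 'g free_alg set ring" where
  "presented_alg rels =
     ring_of_type_algebra Quot (genideal ring_of_type_algebra rels)"

definition presented_class :: "'g free_alg set \<Rightarrow> 'g free_alg \<Rightarrow> 'g free_alg set" where
  "presented_class rels p = genideal ring_of_type_algebra rels +>\<^bsub>ring_of_type_algebra\<^esub> p"

section \<open>The Weyl group of type D\<close>

text \<open>
  The indices \<open>1, \<dots>, n\<close> are the elements of a finite type \<open>'n\<close>. A pair \<open>(p, s)\<close> stands for the
  signed permutation \<open>e\<^sub>i \<mapsto> s i e\<^bsub>p i\<^esub>\<close>.
\<close>

typedef (overloaded) ('n :: finite) weyl_D =
  "{(p, s). bij p \<and> (\<forall>i. s i \<in> {1, -1}) \<and> even (card {i. s i = -1})} :: (('n \<Rightarrow> 'n) \<times> ('n \<Rightarrow> int)) set"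
  by (rule exI[of _ "(id, \<lambda>_. 1)"]) auto

setup_lifting type_definition_weyl_D

lift_definition perm :: "'n::finite weyl_D \<Rightarrow> 'n \<Rightarrow> 'n" is fst .

lift_definition sgn_at :: "'n::finite weyl_D \<Rightarrow> 'n \<Rightarrow> int" is snd .

lemma even_card_neg_iff_prod:
  fixes s :: "'n::finite \<Rightarrow> int"
  assumes "\<forall>i. s i \<in> {1, -1}"
  shows "even (card {i. s i = -1}) \<longleftrightarrow> (\<Prod>i\<in>UNIV. s i) = 1"
proof -
  have "(\<Prod>i\<in>UNIV. s i) = (\<Prod>i\<in>UNIV. if i \<in> {i. s i = -1} then -1 else 1)"
    using assms by (intro prod.cong) auto
  also have "\<dots> = (\<Prod>i\<in>{i. s i = -1}. -1)"
    by (subst prod.inter_restrict[symmetric]) auto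
  also have "\<dots> = (-1) ^ card {i. s i = -1}"
    by simp
  finally show ?thesis
    by (cases "even (card {i. s i = -1})") auto
qed

instantiation weyl_D :: (finite) "{monoid_mult, inverse}"
begin

lift_definition one_weyl_D :: "'a weyl_D" is "(id, \<lambda>_. 1)"
  by auto

lift_definition times_weyl_D :: "'a weyl_D \<Rightarrow> 'a weyl_D \<Rightarrow> 'a weyl_D"
  is "\<lambda>(p, s) (p', s'). (p \<circ> p', \<lambda>i. s' i * s (p' i))"
proof (clarsimp, intro conjI allI)
  fix p p' :: "'a \<Rightarrow> 'a" and s s' :: "'a \<Rightarrow> int"
  assume p: "bij p" and p': "bij p'"
    and s: "\<forall>i. s i = 1 \<or> s i = -1" and s': "\<forall>i. s' i = 1 \<or> s' i = -1"
    and e: "even (card {i. s i = -1})" and e': "even (card {i. s' i = -1})"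
  show "bij (p \<circ> p')" using p p' by (rule bij_comp[rotated])
  show pm: "s' i * s (p' i) = 1 \<or> s' i * s (p' i) = -1" for i
    using s s' by (metis mult.left_neutral mult.right_neutral mult_minus1_right minus_minus)
  have "(\<Prod>i\<in>UNIV. s (p' i)) = (\<Prod>i\<in>UNIV. s i)"
    using p' by (rule prod.reindex_bij_betw)
  also have "\<dots> = 1"
    using e s by (simp add: even_card_neg_iff_prod)
  finally have "(\<Prod>i\<in>UNIV. s' i * s (p' i)) = (\<Prod>i\<in>UNIV. s' i)"
    by (simp add: prod.distrib)
  also have "\<dots> = 1"
    using e' s' by (simp add: even_card_neg_iff_prod)
  finally show "even (card {i. s' i * s (p' i) = -1})"
    using pm by (subst even_card_neg_iff_prod) auto
qed

lift_definition inverse_weyl_D :: "'a weyl_D \<Rightarrow> 'a weyl_D"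
  is "\<lambda>(p, s). (inv_into UNIV p, s \<circ> inv_into UNIV p)"
proof (clarsimp, intro conjI)
  fix p :: "'a \<Rightarrow> 'a" and s :: "'a \<Rightarrow> int"
  assume p: "bij p" and s: "\<forall>i. s i = 1 \<or> s i = -1" and e: "even (card {i. s i = -1})"
  show "bij (inv_into UNIV p)" using p by (rule bij_imp_bij_inv)
  then have "(\<Prod>i\<in>UNIV. s (inv_into UNIV p i)) = (\<Prod>i\<in>UNIV. s i)"
    by (rule prod.reindex_bij_betw)
  also have "\<dots> = 1"
    using e s by (simp add: even_card_neg_iff_prod)
  finally show "even (card {i. s (inv_into UNIV p i) = -1})"
    using s by (subst even_card_neg_iff_prod) auto
qed

definition divide_weyl_D :: "'a weyl_D \<Rightarrow> 'a weyl_D \<Rightarrow> 'a weyl_D" where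
  "divide_weyl_D v w = v * inverse w"

instance
  by standard (transfer; auto simp: fun_eq_iff mult_ac)+

end

lemma weyl_D_inverse:
  fixes w :: "'n::finite weyl_D"
  shows "inverse w * w = 1" "w * inverse w = 1"
proof -
  have sq: "x * x = 1" if "x = 1 \<or> x = -1" for x :: int
    using that by auto
  show "inverse w * w = 1"
    by transfer (auto simp: fun_eq_iff bij_is_inj sq)
  show "w * inverse w = 1"
    by transfer (auto simp: fun_eq_iff bij_is_surj surj_f_inv_f sq)
qed

lift_definition refl_s :: "'n::finite \<Rightarrow> 'n \<Rightarrow> 'n weyl_D" is
  "\<lambda>i j. (transpose i j, \<lambda>_. 1)"
  by auto

text \<open>Only the case \<open>i \<noteq> j\<close> is meaningful.\<close>

lift_definition refl_sbar :: "'n::finite \<Rightarrow> 'n \<Rightarrow> 'n weyl_D" is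
  "\<lambda>i j. if i = j then (id, \<lambda>_. 1) else (transpose i j, \<lambda>k. if k = i \<or> k = j then -1 else 1)"
proof -
  fix i j :: 'n
  have "{k. (if k = i \<or> k = j then -1 else 1 :: int) = -1} = {i, j}"
    by auto
  then show "(if i = j then (id, \<lambda>_. 1)
      else (transpose i j, \<lambda>k. if k = i \<or> k = j then -1 else 1))
    \<in> {(p, s). bij p \<and> (\<forall>k. s k \<in> {1, -1 :: int}) \<and> even (card {k. s k = -1})}"
    by (auto simp: card_insert_if)
qed

text \<open>\<open>w (v\<^sub>i)\<close> for a family \<open>v\<close> that is permuted in the same way as the \<open>e\<^sub>i\<close>.\<close>

definition signed :: "'n::finite weyl_D \<Rightarrow> ('n \<Rightarrow> 'r::ring_1) \<Rightarrow> 'n \<Rightarrow> 'r" where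
  "signed w v i = of_int (sgn_at w i) * v (perm w i)"

section \<open>The algebra K and the double affine Hecke-Clifford algebra\<close>

definition clifford_weyl_relators ::
  "('n::finite \<Rightarrow> 'r::ring_1) \<Rightarrow> ('n weyl_D \<Rightarrow> 'r) \<Rightarrow> 'r set" where
  "clifford_weyl_relators c g =
     {c i * c i - 1 | i. True} \<union>
     {c i * c j + c j * c i | i j. i \<noteq> j} \<union>
     {g 1 - 1} \<union>
     {g v * g w - g (v * w) | v w. True} \<union>
     {g w * c i * g (inverse w) - signed w c i | w i. True}"

datatype ('n :: finite) K_gen = Kc 'n | Kw "'n weyl_D"

definition K_relators :: "'n::finite K_gen free_alg set" where
  "K_relators = clifford_weyl_relators (\<lambda>i. gen (Kc i)) (\<lambda>w. gen (Kw w))"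

definition K_alg :: "'n::finite K_gen free_alg set ring" where
  "K_alg = presented_alg K_relators"

definition in_K :: "'n::finite K_gen free_alg \<Rightarrow> 'n K_gen free_alg set" where
  "in_K p = presented_class K_relators p"

datatype ('n :: finite) H_gen = Hx 'n | Hy 'n | Hc 'n | Hw "'n weyl_D"

definition H_relators :: "complex \<Rightarrow> 'n::finite H_gen free_alg set" where
  "H_relators u =
     (let x = (\<lambda>i. gen (Hx i)); y = (\<lambda>i. gen (Hy i)); c = (\<lambda>i. gen (Hc i)); g = (\<lambda>w. gen (Hw w)) in
      clifford_weyl_relators c g \<union>
      {x i * x j - x j * x i | i j. True} \<union>
      {y i * y j - y j * y i | i j. True} \<union>
      {y i * c j - c j * y i | i j. True} \<union>
      {x i * c i + c i * x i | i. True} \<union>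
      {x i * c j - c j * x i | i j. i \<noteq> j} \<union>
      {g w * x i * g (inverse w) - signed w x i | w i. True} \<union>
      {g w * y i * g (inverse w) - signed w y i | w i. True} \<union>
      {(y j * x i - x i * y j)
         - scal u * ((1 + c j * c i) * g (refl_s i j) - (1 - c j * c i) * g (refl_sbar i j))
         | i j. i \<noteq> j} \<union>
      {(y i * x i - x i * y i)
         - (- scal u * (\<Sum>k\<in>UNIV - {i}. (1 + c k * c i) * g (refl_s k i) + (1 - c k * c i) * g (refl_sbar k i)))
         | i. True})"

definition H_alg :: "complex \<Rightarrow> 'n::finite H_gen free_alg set ring" where
  "H_alg u = presented_alg (H_relators u)"

definition in_H :: "complex \<Rightarrow> 'n::finite H_gen free_alg \<Rightarrow> 'n H_gen free_alg set" where
  "in_H u p = presented_class (H_relators u) p"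

text \<open>The complex subalgebra generated by \<open>K\<close> and the \<open>x\<^sub>i\<close>.\<close>

definition Hx_sub :: "complex \<Rightarrow> 'n::finite H_gen free_alg set set" where
  "Hx_sub u = generate_ring (H_alg u)
     (in_H u ` (range scal \<union> range (\<lambda>i. gen (Hc i)) \<union> range (\<lambda>w. gen (Hw w)) \<union> range (\<lambda>i. gen (Hx i))))"

section \<open>The module induced from a K-module\<close>

text \<open>
  \<open>act\<close> is an action of the subalgebra on the abelian group \<open>M\<close> that extends the given \<open>K\<close>-module
  structure and for which all \<open>x\<^sub>i\<close> act by \<open>0\<close>. Agreement with the \<open>K\<close>-action is required on the
  scalars and the generators of \<open>K\<close>, hence holds on all of \<open>K\<close>.
\<close>

definition extends_by_zero ::
  "complex \<Rightarrow> ('n::finite K_gen free_alg set, 'm) module \<Rightarrow> ('n H_gen free_alg set \<Rightarrow> 'm \<Rightarrow> 'm) \<Rightarrow> bool"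
  where
  "extends_by_zero u M act \<longleftrightarrow>
     left_module (H_alg u\<lparr>carrier := Hx_sub u\<rparr>) (with_action M act) \<and>
     (\<forall>m\<in>carrier M.
        (\<forall>z. act (in_H u (scal z)) m = in_K (scal z) \<odot>\<^bsub>M\<^esub> m) \<and>
        (\<forall>i. act (in_H u (gen (Hc i))) m = in_K (gen (Kc i)) \<odot>\<^bsub>M\<^esub> m) \<and>
        (\<forall>w. act (in_H u (gen (Hw w))) m = in_K (gen (Kw w)) \<odot>\<^bsub>M\<^esub> m) \<and>
        (\<forall>i. act (in_H u (gen (Hx i))) m = \<zero>\<^bsub>M\<^esub>))"

definition Ind ::
  "complex \<Rightarrow> ('n::finite K_gen free_alg set, 'm) module \<Rightarrow> ('n H_gen free_alg set \<Rightarrow> 'm \<Rightarrow> 'm) \<Rightarrow>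
     ('n H_gen free_alg set, ('n H_gen free_alg set \<times> 'm \<Rightarrow>\<^sub>0 int) set) module"
  where
  "Ind u M act = induced_module (H_alg u) (Hx_sub u) (with_action M act)"

text \<open>\<open>\<complex>[y\<^sub>1, \<dots>, y\<^sub>n]\<close>, the action of the Weyl group on it, and exact division.\<close>

type_synonym 'n cpoly = "('n \<Rightarrow>\<^sub>0 nat) \<Rightarrow>\<^sub>0 complex"

definition pconst :: "complex \<Rightarrow> 'n cpoly" where
  "pconst z = Poly_Mapping.single 0 z"

definition pvar :: "'n \<Rightarrow> 'n cpoly" where
  "pvar i = Poly_Mapping.single (Poly_Mapping.single i 1) 1"

definition poly_act :: "'n::finite weyl_D \<Rightarrow> 'n cpoly \<Rightarrow> 'n cpoly" where
  "poly_act w f = (\<Sum>e\<in>Poly_Mapping.keys f.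
     pconst (Poly_Mapping.lookup f e) * (\<Prod>i\<in>UNIV. signed w pvar i ^ Poly_Mapping.lookup e i))"

definition exact_quot :: "'n cpoly \<Rightarrow> 'n cpoly \<Rightarrow> 'n cpoly" where
  "exact_quot p q = (THE h. h * q = p)"

text \<open>The algebra homomorphism \<open>\<complex>[y\<^sub>1, \<dots>, y\<^sub>n] \<rightarrow> H\<close> with \<open>y\<^sub>i \<mapsto> y\<^sub>i\<close>.\<close>

definition y_embed :: "complex \<Rightarrow> 'n::finite cpoly \<Rightarrow> 'n H_gen free_alg set" where
  "y_embed u = (THE \<psi>. \<psi> \<in> ring_hom ring_of_type_algebra (H_alg u) \<and>
     (\<forall>z. \<psi> (pconst z) = in_H u (scal z)) \<and> (\<forall>i. \<psi> (pvar i) = in_H u (gen (Hy i))))"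

definition cpoly_module :: "(complex, 'n::finite cpoly) module" where
  "cpoly_module = with_action ring_of_type_algebra (\<lambda>z f. pconst z * f)"

definition complex_module ::
  "('n::finite K_gen free_alg set, 'm) module \<Rightarrow> (complex, 'm) module" where
  "complex_module M = with_action M (\<lambda>z m. in_K (scal z) \<odot>\<^bsub>M\<^esub> m)"

text \<open>The complex vector space \<open>\<complex>[y\<^sub>1, \<dots>, y\<^sub>n] \<otimes> M\<close>.\<close>

definition poly_tensor ::
  "('n::finite K_gen free_alg set, 'm) module \<Rightarrow> (complex, ('n cpoly \<times> 'm \<Rightarrow>\<^sub>0 int) set) module" where
  "poly_tensor M =
     tensor_product ring_of_type_algebra cpoly_module (\<lambda>f z. f * pconst z) (complex_module M)"

definition ptens ::
  "('n::finite K_gen free_alg set, 'm) module \<Rightarrow> 'n cpoly \<Rightarrow> 'm \<Rightarrow> ('n cpoly \<times> 'm \<Rightarrow>\<^sub>0 int) set" where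
  "ptens M f m =
     pure_tensor ring_of_type_algebra cpoly_module (\<lambda>f z. f * pconst z) (complex_module M) f m"

text \<open>The identification \<open>f \<otimes> m \<mapsto> f \<otimes> m\<close> of \<open>\<complex>[y\<^sub>1, \<dots>, y\<^sub>n] \<otimes> M\<close> with the induced module.\<close>

definition identification ::
  "complex \<Rightarrow> ('n::finite K_gen free_alg set, 'm) module \<Rightarrow> ('n H_gen free_alg set \<Rightarrow> 'm \<Rightarrow> 'm) \<Rightarrow>
     ('n cpoly \<times> 'm \<Rightarrow>\<^sub>0 int) set \<Rightarrow> ('n H_gen free_alg set \<times> 'm \<Rightarrow>\<^sub>0 int) set"
  where
  "identification u M act =
     tensor_hom (H_alg u\<lparr>carrier := Hx_sub u\<rparr>) (with_action (H_alg u) (monoid.mult (H_alg u)))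
       (monoid.mult (H_alg u)) (with_action M act) (\<lambda>(f, m). (y_embed u f, m))"

text \<open>The action on \<open>\<complex>[y\<^sub>1, \<dots>, y\<^sub>n] \<otimes> M\<close> obtained from the induced module by transport of structure.\<close>

definition poly_module_act ::
  "complex \<Rightarrow> ('n::finite K_gen free_alg set, 'm) module \<Rightarrow> ('n H_gen free_alg set \<Rightarrow> 'm \<Rightarrow> 'm) \<Rightarrow>
     'n H_gen free_alg set \<Rightarrow> ('n cpoly \<times> 'm \<Rightarrow>\<^sub>0 int) set \<Rightarrow> ('n cpoly \<times> 'm \<Rightarrow>\<^sub>0 int) set"
  where
  "poly_module_act u M act h v =
     inv_into (carrier (poly_tensor M)) (identification u M act)
       (h \<odot>\<^bsub>Ind u M act\<^esub> identification u M act v)"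

end

theory Submission
  imports Defs
begin

text \<open>
  In the algebra one has
  \<open>x\<^sub>i f = f x\<^sub>i + u \<Sum>\<^sub>k (\<Delta>\<^sub>k f (1 + c\<^sub>k c\<^sub>i) s\<^sub>k\<^sub>i + \<Delta>'\<^sub>k f (1 - c\<^sub>k c\<^sub>i) s'\<^sub>k\<^sub>i)\<close>
  for every polynomial \<open>f\<close> in the \<open>y\<^sub>j\<close>, where \<open>\<Delta>\<^sub>k\<close>, \<open>\<Delta>'\<^sub>k\<close> are the divided differences and
  \<open>s'\<close> the reflections with signs: both sides are twisted derivations in \<open>f\<close>, so it suffices to
  compare them on the \<open>y\<^sub>j\<close>. Applied to \<open>m \<in> M\<close>, which the \<open>x\<^sub>i\<close> kill, this is the asserted formula,
  and it shows that \<open>\<complex>[y] \<otimes> M\<close> spans the induced module.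

  That no collapse occurs is seen by letting the algebra act on \<open>\<complex>[y] \<otimes> K\<close> by the asserted
  formulas. All relations are verified directly on \<open>f \<otimes> k\<close> except \<open>x\<^sub>i x\<^sub>j = x\<^sub>j x\<^sub>i\<close>: by the
  Jacobi identity \<open>[x\<^sub>i, x\<^sub>j]\<close> commutes with all \<open>y\<^sub>k\<close>, and it kills \<open>1 \<otimes> K\<close>, hence vanishes.
  The subalgebra generated by \<open>K\<close> and the \<open>x\<^sub>i\<close> preserves \<open>1 \<otimes> K\<close>, which gives its action on every
  \<open>K\<close>-module, and applying \<open>h\<close> to \<open>1 \<otimes> 1\<close> gives the inverse of the identification.
\<close>

section \<open>Free algebras and polynomial algebras\<close>

text \<open>The triangular decomposition is not presupposed; only as much of it as the bijectivity
  of the identification requires is proved. The representation space is \<complex>[y] \<otimes> K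
  and not \<complex>[y] \<otimes> M for two reasons. Before anything can be induced, M must be a
  module over \<open>Hx_sub\<close>, and this takes a ring homomorphism from \<open>Hx_sub\<close>
  to K that kills the x's and respects all relations of the ambient algebra; so a representation
  must exist before there is an induced module. And all operators commute with right multiplication
  by K, so they are determined on \<complex>[y] \<otimes> 1 and one representation serves every M.
  The two families of reflections are treated together by a sign \<epsilon>: the reflection
  \<open>e_i \<mapsto> \<epsilon> e_k\<close> belongs to the root
  \<open>y_i - \<epsilon> y_k\<close> and comes with the factor
  \<open>1 + \<epsilon> c_k c_i\<close>. A direct check that the x's commute would compare
  composites of two divided differences; the detour through commutators with the y's involves only
  commutators of one x with one reflection term.\<close>

lemma poly_mapping_sum_single:
  "p = (\<Sum>w\<in>Poly_Mapping.keys p. Poly_Mapping.single w (Poly_Mapping.lookup p w))"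
  by (rule poly_mapping_eqI)
    (simp add: lookup_sum lookup_single when_def in_keys_iff)

lemma poly_mapping_add_induct [case_names single add]:
  fixes p :: "'a \<Rightarrow>\<^sub>0 'b::comm_monoid_add"
  assumes "\<And>w z. P (Poly_Mapping.single w z)" and "\<And>p q. P p \<Longrightarrow> P q \<Longrightarrow> P (p + q)"
  shows "P p"
proof -
  have "P (\<Sum>w\<in>A. Poly_Mapping.single w (Poly_Mapping.lookup p w))" if "finite A" for A
    using that
  proof induction
    case empty
    then show ?case using assms(1)[of undefined 0] by simp
  qed (simp add: assms)
  from this[OF finite_keys, of p] show ?thesis
    by (subst poly_mapping_sum_single)
qed

text \<open>The coefficient is handed to \<open>B\<close> instead of multiplying its value, so that
  one construction serves the evaluations \<open>free_eval\<close> and \<open>poly_eval\<close>, the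
  change of coefficients \<open>kembed\<close> and the right-linear extension
  \<open>rext\<close>.\<close>

definition lin_ext :: "('a \<Rightarrow> 'b \<Rightarrow> 'c) \<Rightarrow> ('a \<Rightarrow>\<^sub>0 'b::zero) \<Rightarrow> 'c::comm_monoid_add" where
  "lin_ext B p = (\<Sum>w\<in>Poly_Mapping.keys p. B w (Poly_Mapping.lookup p w))"

lemma lin_ext_add:
  fixes p q :: "'a \<Rightarrow>\<^sub>0 'b::comm_monoid_add"
  assumes "\<And>w. B w 0 = 0" "\<And>w a b. B w (a + b) = B w a + B w b"
  shows "lin_ext B (p + q) = lin_ext B p + lin_ext B q"
  unfolding lin_ext_def by (rule setsum_keys_plus_distrib) (use assms in auto)

lemma lin_ext_single: "B w 0 = 0 \<Longrightarrow> lin_ext B (Poly_Mapping.single w z) = B w z"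
  by (simp add: lin_ext_def)

text \<open>The sort leaves out 0 \<noteq> 1 because the targets include quotients of free algebras
  whose nontriviality is not established.\<close>

locale scalars =
  fixes sc :: "complex \<Rightarrow> 'r::{ring,monoid_mult}"
  assumes sc_add: "sc (a + b) = sc a + sc b"
    and sc_mult: "sc (a * b) = sc a * sc b"
    and sc_one [simp]: "sc 1 = 1"
begin

lemma sc_zero [simp]: "sc 0 = 0"
  using sc_add[of 0 0] by simp

end

definition free_eval :: "(complex \<Rightarrow> 'r::{ring,monoid_mult}) \<Rightarrow> ('g \<Rightarrow> 'r) \<Rightarrow> 'g free_alg \<Rightarrow> 'r" where
  "free_eval sc a = lin_ext (\<lambda>w z. sc z * prod_list (map a (letters w)))"

locale free_evaluation = scalars sc for sc :: "complex \<Rightarrow> 'r::{ring,monoid_mult}" +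
  fixes a :: "'g \<Rightarrow> 'r"
  assumes sc_central: "sc z * a x = a x * sc z"
begin

lemma free_eval_add [simp]: "free_eval sc a (p + q) = free_eval sc a p + free_eval sc a q"
  unfolding free_eval_def by (rule lin_ext_add) (simp_all add: sc_add algebra_simps)

lemma free_eval_single:
  "free_eval sc a (Poly_Mapping.single w z) = sc z * prod_list (map a (letters w))"
  by (simp add: free_eval_def lin_ext_single)

lemma free_eval_scal [simp]: "free_eval sc a (scal z) = sc z"
  by (simp add: scal_def free_eval_single zero_word_def)

lemma free_eval_gen [simp]: "free_eval sc a (gen x) = a x"
  by (simp add: gen_def free_eval_single)

lemma free_eval_zero [simp]: "free_eval sc a 0 = 0"
  by (simp add: free_eval_def lin_ext_def)

lemma free_eval_one [simp]: "free_eval sc a 1 = 1"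
  using free_eval_scal[of 1] by (simp add: scal_def)

lemma free_eval_minus [simp]: "free_eval sc a (- p) = - free_eval sc a p"
  using free_eval_add[of p "- p"] by (simp add: eq_neg_iff_add_eq_0 add.commute)

lemma free_eval_diff [simp]: "free_eval sc a (p - q) = free_eval sc a p - free_eval sc a q"
  using free_eval_add[of p "- q"] by simp

text \<open>Biadditivity reduces this to two monomials, where the only work is to move the second
  coefficient past the first word.\<close>

lemma free_eval_mult [simp]: "free_eval sc a (p * q) = free_eval sc a p * free_eval sc a q"
proof -
  have central: "prod_list (map a xs) * sc z = sc z * prod_list (map a xs)" for xs z
    by (induction xs) (simp_all add: mult.assoc, simp add: sc_central flip: mult.assoc)
  have "free_eval sc a (Poly_Mapping.single v y * Poly_Mapping.single w z) =
      free_eval sc a (Poly_Mapping.single v y) * free_eval sc a (Poly_Mapping.single w z)" for v y w z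
    by (simp add: mult_single free_eval_single plus_word_def sc_mult mult.assoc)
      (simp add: central flip: mult.assoc)
  then have "free_eval sc a (Poly_Mapping.single v y * q) = free_eval sc a (Poly_Mapping.single v y) * free_eval sc a q" for v y q
    by (induction q rule: poly_mapping_add_induct) (simp_all add: algebra_simps)
  then show ?thesis
    by (induction p rule: poly_mapping_add_induct) (simp_all add: algebra_simps)
qed

lemma free_eval_sum [simp]: "free_eval sc a (sum f A) = (\<Sum>x\<in>A. free_eval sc a (f x))"
  by (induction A rule: infinite_finite_induct) simp_all

end

lemma free_alg_induct [case_names scal gen add mult]:
  assumes "\<And>z. P (scal z)" "\<And>x. P (gen x)" "\<And>p q. P p \<Longrightarrow> P q \<Longrightarrow> P (p + q)"
    "\<And>p q. P p \<Longrightarrow> P q \<Longrightarrow> P (p * q)"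
  shows "P p"
proof (induction p rule: poly_mapping_add_induct)
  case (single w z)
  have "P (Poly_Mapping.single (Word xs) z)" for xs
  proof (induction xs)
    case Nil
    then show ?case using assms(1)[of z] by (simp add: scal_def zero_word_def)
  next
    case (Cons x xs)
    have "gen x * Poly_Mapping.single (Word xs) z = Poly_Mapping.single (Word (x # xs)) z"
      by (simp add: gen_def mult_single plus_word_def)
    then show ?case using assms(4)[OF assms(2)[of x] Cons] by simp
  qed
  then show ?case by (metis word.exhaust)
qed (rule assms(3))

lemma scalars_scal: "scalars (scal :: complex \<Rightarrow> 'g free_alg)"
  by unfold_locales (simp_all add: scal_def single_add mult_single)

lemma scal_central: "scal z * p = p * scal z"
  by (induction p rule: poly_mapping_add_induct)
    (simp_all add: scal_def mult_single algebra_simps)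

lemma scal_of_int: "scal (of_int k) = of_int k"
  by (simp add: scal_def)

lemma pconst_add: "pconst (a + b) = pconst a + pconst b"
  and pconst_mult: "pconst (a * b) = pconst a * pconst b"
  and pconst_one [simp]: "pconst 1 = 1"
  and pconst_zero [simp]: "pconst 0 = 0"
  by (simp_all add: pconst_def single_add mult_single)

lemma pconst_of_int: "pconst (of_int k) = of_int k"
  by (simp add: pconst_def)

lemma pvar_power: "pvar i ^ k = Poly_Mapping.single (Poly_Mapping.single i k) 1"
  by (induction k) (simp_all add: pvar_def mult_single flip: single_add)

lemma single_eq_prod_pvar:
  fixes e :: "'n::finite \<Rightarrow>\<^sub>0 nat"
  shows "Poly_Mapping.single e z = pconst z * (\<Prod>i\<in>UNIV. pvar i ^ Poly_Mapping.lookup e i)"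
proof -
  have *: "(\<Prod>i\<in>A. pvar i ^ Poly_Mapping.lookup e i) =
      Poly_Mapping.single (\<Sum>i\<in>A. Poly_Mapping.single i (Poly_Mapping.lookup e i)) 1"
    if "finite A" for A
    using that by induction (simp_all add: pvar_power mult_single)
  have "(\<Sum>i\<in>UNIV. Poly_Mapping.single i (Poly_Mapping.lookup e i)) = e"
    by (rule poly_mapping_eqI) (simp add: lookup_sum lookup_single when_def)
  then show ?thesis
    by (simp add: * pconst_def mult_single)
qed

lemma cpoly_induct [case_names const var add mult]:
  fixes f :: "'n::finite cpoly"
  assumes "\<And>z. P (pconst z)" "\<And>i. P (pvar i)" "\<And>f g. P f \<Longrightarrow> P g \<Longrightarrow> P (f + g)"
    "\<And>f g. P f \<Longrightarrow> P g \<Longrightarrow> P (f * g)"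
  shows "P f"
proof (induction f rule: poly_mapping_add_induct)
  case (single e z)
  have pow: "P (pvar i ^ k)" for i k
    using assms(1)[of 1] by (induction k) (simp_all add: assms)
  have "P (\<Prod>i\<in>A. pvar i ^ Poly_Mapping.lookup e i)" if "finite A" for A
    using that assms(1)[of 1] by induction (simp_all add: assms pow)
  then show ?case
    by (simp add: single_eq_prod_pvar assms)
qed (rule assms)

section \<open>Evaluation of commutative polynomials at commuting elements\<close>

definition enumeration :: "'n::finite list" where
  "enumeration = (SOME xs. set xs = UNIV \<and> distinct xs)"

lemma enumeration: "set enumeration = UNIV" "distinct enumeration"
  using someI_ex[OF finite_distinct_list[OF finite[of UNIV]]]
  unfolding enumeration_def by blast+

text \<open>The target need not be commutative, so the product over the indices is taken in a fixed order.\<close>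

definition monomial_eval :: "('n::finite \<Rightarrow> 'r::monoid_mult) \<Rightarrow> ('n \<Rightarrow>\<^sub>0 nat) \<Rightarrow> 'r" where
  "monomial_eval a e = prod_list (map (\<lambda>i. a i ^ Poly_Mapping.lookup e i) enumeration)"

definition poly_eval :: "(complex \<Rightarrow> 'r::{ring,monoid_mult}) \<Rightarrow> ('n::finite \<Rightarrow> 'r) \<Rightarrow> 'n cpoly \<Rightarrow> 'r" where
  "poly_eval sc a = lin_ext (\<lambda>e z. sc z * monomial_eval a e)"

lemma monomial_eval_comm:
  fixes a :: "'n::finite \<Rightarrow> 'r::comm_monoid_mult"
  shows "monomial_eval a e = (\<Prod>i\<in>UNIV. a i ^ Poly_Mapping.lookup e i)"
  by (simp add: monomial_eval_def prod.distinct_set_conv_list[OF enumeration(2), symmetric] enumeration(1))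

locale poly_evaluation = scalars sc for sc :: "complex \<Rightarrow> 'r::{ring,monoid_mult}" +
  fixes a :: "'n::finite \<Rightarrow> 'r"
  assumes sc_central: "sc z * a i = a i * sc z"
    and commute: "a i * a j = a j * a i"
begin

lemma poly_eval_add [simp]: "poly_eval sc a (f + g) = poly_eval sc a f + poly_eval sc a g"
  unfolding poly_eval_def by (rule lin_ext_add) (simp_all add: sc_add algebra_simps)

lemma poly_eval_single: "poly_eval sc a (Poly_Mapping.single e z) = sc z * monomial_eval a e"
  by (simp add: poly_eval_def lin_ext_single)

lemma monomial_eval_zero [simp]: "monomial_eval a 0 = 1"
  by (simp add: monomial_eval_def map_replicate_const)

lemma commute_prod_list:
  assumes "\<And>i. r * b i = b i * r"
  shows "r * prod_list (map b xs) = prod_list (map b xs) * (r :: 'r)"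
  by (induction xs) (simp_all add: mult.assoc, metis assms mult.assoc)

text \<open>This is where the \<open>a i\<close> have to commute: in the fixed order of factors, a
  power of one of them is moved past the product over the rest of the list.\<close>

lemma monomial_eval_add: "monomial_eval a (d + e) = monomial_eval a d * monomial_eval a e"
proof -
  have c: "a i ^ k * a j ^ l = a j ^ l * a i ^ k" for i j k l
    by (metis commute power_commuting_commutes)
  have "prod_list (map (\<lambda>i. a i ^ k i * a i ^ l i) xs) =
      prod_list (map (\<lambda>i. a i ^ k i) xs) * prod_list (map (\<lambda>i. a i ^ l i) xs)" for k l and xs :: "'n list"
  proof (induction xs)
    case (Cons x xs)
    have "a x ^ l x * prod_list (map (\<lambda>i. a i ^ k i) xs) = prod_list (map (\<lambda>i. a i ^ k i) xs) * a x ^ l x"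
      by (rule commute_prod_list) (rule c)
    then have "a x ^ k x * (a x ^ l x * prod_list (map (\<lambda>i. a i ^ k i) xs)) * prod_list (map (\<lambda>i. a i ^ l i) xs) =
        a x ^ k x * (prod_list (map (\<lambda>i. a i ^ k i) xs) * a x ^ l x) * prod_list (map (\<lambda>i. a i ^ l i) xs)"
      by simp
    then show ?case
      by (simp add: Cons mult.assoc)
  qed simp
  then show ?thesis
    by (simp add: monomial_eval_def lookup_add power_add)
qed

lemma monomial_eval_var: "monomial_eval a (Poly_Mapping.single i 1) = a i"
proof -
  have "prod_list (map (\<lambda>j. a j ^ Poly_Mapping.lookup (Poly_Mapping.single i 1) j) xs) =
      (if i \<in> set xs then a i else 1)" if "distinct xs" for xs
    using that by (induction xs) (auto simp: lookup_single when_def)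
  then show ?thesis
    by (simp add: monomial_eval_def enumeration)
qed

lemma poly_eval_const [simp]: "poly_eval sc a (pconst z) = sc z"
  by (simp add: pconst_def poly_eval_single)

lemma poly_eval_var [simp]: "poly_eval sc a (pvar i) = a i"
  by (simp add: pvar_def poly_eval_single monomial_eval_var[simplified])

lemma poly_eval_zero [simp]: "poly_eval sc a 0 = 0"
  by (simp add: poly_eval_def lin_ext_def)

lemma poly_eval_one [simp]: "poly_eval sc a 1 = 1"
  using poly_eval_const[of 1] by simp

lemma poly_eval_minus [simp]: "poly_eval sc a (- p) = - poly_eval sc a p"
  using poly_eval_add[of p "- p"] by (simp add: eq_neg_iff_add_eq_0 add.commute)

lemma poly_eval_diff [simp]: "poly_eval sc a (p - q) = poly_eval sc a p - poly_eval sc a q"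
  using poly_eval_add[of p "- q"] by simp

lemma poly_eval_mult [simp]: "poly_eval sc a (f * g) = poly_eval sc a f * poly_eval sc a g"
proof -
  have "sc z * a i ^ k = a i ^ k * sc z" for z i k
    by (metis sc_central power_commuting_commutes)
  then have central: "monomial_eval a e * sc z = sc z * monomial_eval a e" for e z
    unfolding monomial_eval_def by (intro commute_prod_list[symmetric])
  have "poly_eval sc a (Poly_Mapping.single d y * Poly_Mapping.single e z) =
      poly_eval sc a (Poly_Mapping.single d y) * poly_eval sc a (Poly_Mapping.single e z)" for d y e z
    by (simp add: mult_single poly_eval_single sc_mult monomial_eval_add mult.assoc)
      (simp add: central flip: mult.assoc)
  then have "poly_eval sc a (Poly_Mapping.single v y * q) = poly_eval sc a (Poly_Mapping.single v y) * poly_eval sc a q" for v y q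
    by (induction q rule: poly_mapping_add_induct) (simp_all only: distrib_left poly_eval_add)
  then show ?thesis
    by (induction f rule: poly_mapping_add_induct) (simp_all only: distrib_right poly_eval_add)
qed

end

section \<open>The Weyl group acting on polynomials\<close>

lemma scalars_pconst: "scalars pconst"
  by unfold_locales (simp_all add: pconst_add pconst_mult)

text \<open>Recognizing the Weyl group action as an evaluation makes it an algebra homomorphism at
  once.\<close>

lemma poly_act_eq_eval: "poly_act w = poly_eval pconst (signed w pvar)"
  by (simp add: fun_eq_iff poly_act_def poly_eval_def lin_ext_def monomial_eval_comm)

interpretation poly_act: poly_evaluation pconst "signed w pvar"
  rewrites "poly_eval pconst (signed w pvar) = poly_act w" for w :: "'n::finite weyl_D"
proof -
  show "poly_evaluation pconst (signed w pvar)"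
    by (intro poly_evaluation.intro scalars_pconst) (unfold_locales, simp_all add: mult.commute)
qed (simp add: poly_act_eq_eval)

lemma poly_act_of_int [simp]: "poly_act w (of_int k) = of_int k"
  using poly_act.poly_eval_const[of w "of_int k"] by (simp add: pconst_of_int)

lemma sgn_at_cases: "sgn_at w i = 1 \<or> sgn_at w i = -1"
  by transfer auto

lemma sgn_at_sq [simp]: "sgn_at w i * sgn_at w i = 1"
  using sgn_at_cases[of w i] by auto

lemma bij_perm: "bij (perm w)"
  by transfer auto

lemma perm_eq_iff [simp]: "perm w i = perm w j \<longleftrightarrow> i = j"
  using bij_perm[of w] by (meson bij_is_inj inj_eq)

lemma perm_mult [simp]: "perm (v * w) i = perm v (perm w i)"
  by transfer auto

lemma sgn_at_mult [simp]: "sgn_at (v * w) i = sgn_at w i * sgn_at v (perm w i)"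
  by transfer auto

lemma perm_one [simp]: "perm 1 i = i" and sgn_at_one [simp]: "sgn_at 1 i = 1"
  by (transfer, simp)+

lemma weyl_D_eqI:
  assumes "\<And>i. perm v i = perm w i" "\<And>i. sgn_at v i = sgn_at w i"
  shows "v = w"
  using assms by transfer (auto simp: fun_eq_iff)

lemma signed_one [simp]: "signed 1 v = v"
  by (simp add: signed_def fun_eq_iff)

lemma poly_act_one [simp]: "poly_act 1 f = f"
  by (induction f rule: cpoly_induct) simp_all

lemma poly_act_act: "poly_act v (poly_act w f) = poly_act (v * w) f"
  by (induction f rule: cpoly_induct) (simp_all add: signed_def)

text \<open>Both kinds of reflection in one family: for \<epsilon> = 1, -1 and k \<noteq> i this is
  the reflection in the root \<open>e_i - \<epsilon> e_k\<close>, so that every sum over reflections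
  becomes a sum over k and \<epsilon>.\<close>

definition wrefl :: "int \<Rightarrow> 'n::finite \<Rightarrow> 'n \<Rightarrow> 'n weyl_D" where
  "wrefl \<epsilon> k i = (if \<epsilon> = 1 then refl_s k i else refl_sbar k i)"

lemma perm_wrefl: "k \<noteq> i \<Longrightarrow> perm (wrefl \<epsilon> k i) = transpose k i"
  unfolding wrefl_def by (cases "\<epsilon> = 1"; simp; transfer; simp)

lemma sgn_at_wrefl:
  "k \<noteq> i \<Longrightarrow> \<epsilon> \<in> {1, -1} \<Longrightarrow> sgn_at (wrefl \<epsilon> k i) j = (if j = k \<or> j = i then \<epsilon> else 1)"
  unfolding wrefl_def by (cases "\<epsilon> = 1"; simp; transfer; auto)

lemma wrefl_commute: "wrefl \<epsilon> k i = wrefl \<epsilon> i k"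
proof (cases "k = i")
  case False
  then show ?thesis
    unfolding wrefl_def by (cases "\<epsilon> = 1"; simp; transfer) (auto simp: transpose_commute fun_eq_iff)
qed simp

text \<open>Conjugation by w carries the reflection in a root to the reflection in its image. Here w
  sends \<open>e_i - \<epsilon> e_k\<close> to \<open>sgn_at w i\<close> times the root with indices
  \<open>perm w k\<close>, \<open>perm w i\<close> and sign
  \<open>\<epsilon> * sgn_at w k * sgn_at w i\<close>.\<close>

lemma wrefl_conj:
  assumes "k \<noteq> i" "\<epsilon> \<in> {1, -1}"
  shows "w * wrefl \<epsilon> k i = wrefl (\<epsilon> * sgn_at w k * sgn_at w i) (perm w k) (perm w i) * w"
proof -
  define e where "e = \<epsilon> * sgn_at w k * sgn_at w i"
  have e: "e \<in> {1, -1}" "e * sgn_at w k = \<epsilon> * sgn_at w i" "e * sgn_at w i = \<epsilon> * sgn_at w k"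
    using assms sgn_at_cases[of w k] sgn_at_cases[of w i] by (auto simp: e_def)
  have p: "perm w k \<noteq> perm w i" using assms by simp
  show ?thesis
    unfolding e_def[symmetric]
  proof (rule weyl_D_eqI)
    fix j
    consider "j = k" | "j = i" | "j \<noteq> k" "j \<noteq> i" by blast
    then show "perm (w * wrefl \<epsilon> k i) j = perm (wrefl e (perm w k) (perm w i) * w) j"
      using assms(1) p by cases (simp_all add: perm_wrefl)
    consider "j = k" | "j = i" | "j \<noteq> k" "j \<noteq> i" by blast
    then show "sgn_at (w * wrefl \<epsilon> k i) j = sgn_at (wrefl e (perm w k) (perm w i) * w) j"
      using assms(1) p e(2,3)
      by cases (simp_all add: perm_wrefl sgn_at_wrefl[OF p e(1)] sgn_at_wrefl[OF assms] mult.commute)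
  qed
qed

section \<open>Divided differences\<close>

definition proot :: "int \<Rightarrow> 'n \<Rightarrow> 'n \<Rightarrow> 'n cpoly" where
  "proot \<epsilon> k i = pvar i - of_int \<epsilon> * pvar k"

lemma lookup_pconst_mult: "Poly_Mapping.lookup (pconst z * f) e = z * Poly_Mapping.lookup f e"
  unfolding pconst_def mult_map_scale_conv_mult[symmetric]
  by (simp add: Poly_Mapping.map.rep_eq when_def)

text \<open>Leading terms: among the monomials of g - h take one of maximal degree in
  \<open>y_i\<close>. Multiplied by \<open>y_i\<close> it cannot be cancelled by a term containing
  the factor \<open>y_k\<close>, whose degree in \<open>y_i\<close> is too small. This makes
  \<open>exact_quot\<close> by a root meaningful.\<close>

lemma proot_mult_cancel:
  fixes g h :: "'n::finite cpoly"
  assumes "k \<noteq> i" "g * proot \<epsilon> k i = h * proot \<epsilon> k i"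
  shows "g = h"
proof (rule ccontr)
  define d where "d = g - h"
  assume "g \<noteq> h"
  then have "(\<lambda>e. Poly_Mapping.lookup e i) ` Poly_Mapping.keys d \<noteq> {}" (is "?L \<noteq> {}")
    by (simp add: d_def)
  then have "Max ?L \<in> ?L"
    by (intro Max_in) simp_all
  then obtain e where e: "e \<in> Poly_Mapping.keys d" and "Poly_Mapping.lookup e i = Max ?L"
    by auto
  then have max: "Poly_Mapping.lookup e' i \<le> Poly_Mapping.lookup e i" if "e' \<in> Poly_Mapping.keys d" for e'
    using that by (simp add: Max_ge)
  have lookup_var: "Poly_Mapping.lookup (d * pvar j) b =
      (\<Sum>a\<in>Poly_Mapping.keys d. Poly_Mapping.lookup d a when b = a + Poly_Mapping.single j 1)" for j b
  proof -
    have "d * pvar j = (\<Sum>a\<in>Poly_Mapping.keys d. Poly_Mapping.single (a + Poly_Mapping.single j 1) (Poly_Mapping.lookup d a))"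
      by (subst poly_mapping_sum_single[of d]) (simp add: sum_distrib_right pvar_def mult_single)
    then show ?thesis
      by (simp add: lookup_sum lookup_single eq_commute)
  qed
  have zero: "d * pvar i - of_int \<epsilon> * (d * pvar k) = 0"
    using assms(2) by (simp add: d_def proot_def algebra_simps)
  define b where "b = e + Poly_Mapping.single i 1"
  have "Poly_Mapping.lookup (d * pvar i) b = Poly_Mapping.lookup d e"
    using e by (simp add: lookup_var b_def when_def)
  moreover have "Poly_Mapping.lookup (d * pvar k) b = 0"
  proof -
    have "b \<noteq> a + Poly_Mapping.single k 1" if "a \<in> Poly_Mapping.keys d" for a
    proof
      assume "b = a + Poly_Mapping.single k 1"
      then have "Poly_Mapping.lookup e i + 1 = Poly_Mapping.lookup a i"
        using assms(1) unfolding b_def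
        by (metis lookup_add lookup_single_eq lookup_single_not_eq add.right_neutral)
      with max[OF that] show False by simp
    qed
    then show ?thesis by (simp add: lookup_var)
  qed
  ultimately have "Poly_Mapping.lookup d e = 0"
    using arg_cong[OF zero, of "\<lambda>p. Poly_Mapping.lookup p b"]
    by (simp add: lookup_minus lookup_pconst_mult flip: pconst_of_int)
  with e show False by (simp add: in_keys_iff)
qed

definition ddiff :: "int \<Rightarrow> 'n::finite \<Rightarrow> 'n \<Rightarrow> 'n cpoly \<Rightarrow> 'n cpoly" where
  "ddiff \<epsilon> k i f = exact_quot (f - poly_act (wrefl \<epsilon> k i) f) (proot \<epsilon> k i)"

lemma poly_act_wrefl_var:
  assumes "k \<noteq> i" "\<epsilon> \<in> {1, -1}"
  shows "poly_act (wrefl \<epsilon> k i) (pvar j) =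
    (if j = i then of_int \<epsilon> * pvar k else if j = k then of_int \<epsilon> * pvar i else pvar j)"
  using assms by (auto simp: signed_def perm_wrefl sgn_at_wrefl transpose_def)

text \<open>Every identity about \<open>ddiff\<close> below is obtained from this by multiplying
  with the root and comparing.\<close>

lemma ddiff_unique:
  assumes "k \<noteq> i" "h * proot \<epsilon> k i = f - poly_act (wrefl \<epsilon> k i) f"
  shows "ddiff \<epsilon> k i f = h"
  unfolding ddiff_def exact_quot_def
  by (rule the_equality) (use assms proot_mult_cancel in metis)+

lemma minus_mult_proot:
  "\<epsilon> \<in> {1, -1} \<Longrightarrow> - of_int \<epsilon> * proot \<epsilon> k i = pvar k - of_int \<epsilon> * pvar i"
  by (auto simp: proot_def)

text \<open>Divisibility by the root is checked on constants and variables. It passes to products by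
  \<open>f g - s(f) s(g) = (f - s(f)) g + s(f) (g - s(g))\<close>, where s is the
  reflection.\<close>

lemma ddiff_mult_proot:
  assumes "k \<noteq> i" "\<epsilon> \<in> {1, -1}"
  shows "ddiff \<epsilon> k i f * proot \<epsilon> k i = f - poly_act (wrefl \<epsilon> k i) f"
proof -
  let ?r = "proot \<epsilon> k i" and ?w = "poly_act (wrefl \<epsilon> k i)"
  have "\<exists>h. h * ?r = f - ?w f"
  proof (induction f rule: cpoly_induct)
    case (const z)
    show ?case by (rule exI[of _ 0]) simp
  next
    case (var j)
    have "1 * ?r = pvar i - ?w (pvar i)"
      by (simp only: poly_act_wrefl_var[OF assms]) (simp add: proot_def)
    moreover have "- of_int \<epsilon> * ?r = pvar k - ?w (pvar k)"
      using assms(1) by (simp only: poly_act_wrefl_var[OF assms] minus_mult_proot[OF assms(2)]) simp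
    moreover have "0 * ?r = pvar j - ?w (pvar j)" if "j \<noteq> i" "j \<noteq> k"
      using that by (simp only: poly_act_wrefl_var[OF assms]) simp
    ultimately show ?case by blast
  next
    case (add f g)
    then obtain a b where "a * ?r = f - ?w f" "b * ?r = g - ?w g" by auto
    then have "(a + b) * ?r = f + g - ?w (f + g)" by (simp add: algebra_simps)
    then show ?case ..
  next
    case (mult f g)
    then obtain a b where ab: "a * ?r = f - ?w f" "b * ?r = g - ?w g" by auto
    then have "(a * g + ?w f * b) * ?r = (f - ?w f) * g + ?w f * (g - ?w g)"
      by (simp add: algebra_simps flip: ab)
    also have "\<dots> = f * g - ?w (f * g)" by (simp add: algebra_simps)
    finally show ?case ..
  qed
  then obtain h where "h * ?r = f - ?w f" ..
  with ddiff_unique[OF assms(1) this] show ?thesis by simp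
qed

context
  fixes \<epsilon> :: int and k i :: "'n::finite"
  assumes ki: "k \<noteq> i" "\<epsilon> \<in> {1, -1}"
begin

lemma ddiff_const [simp]: "ddiff \<epsilon> k i (pconst z) = 0"
  by (rule ddiff_unique[OF ki(1)]) simp

lemma ddiff_add: "ddiff \<epsilon> k i (f + g) = ddiff \<epsilon> k i f + ddiff \<epsilon> k i g"
  by (rule ddiff_unique[OF ki(1)]) (simp add: distrib_right ddiff_mult_proot[OF ki])

text \<open>The twist by the reflection matches the one that appears when \<open>kr\<close> passes a
  polynomial; this match drives the induction for commuting an x past a polynomial.\<close>

lemma ddiff_mult:
  "ddiff \<epsilon> k i (f * g) = ddiff \<epsilon> k i f * g + poly_act (wrefl \<epsilon> k i) f * ddiff \<epsilon> k i g"
proof (rule ddiff_unique[OF ki(1)])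
  have "(ddiff \<epsilon> k i f * g + poly_act (wrefl \<epsilon> k i) f * ddiff \<epsilon> k i g) * proot \<epsilon> k i =
      (ddiff \<epsilon> k i f * proot \<epsilon> k i) * g + poly_act (wrefl \<epsilon> k i) f * (ddiff \<epsilon> k i g * proot \<epsilon> k i)"
    by (simp add: algebra_simps)
  also have "\<dots> = f * g - poly_act (wrefl \<epsilon> k i) (f * g)"
    unfolding ddiff_mult_proot[OF ki] by (simp add: algebra_simps)
  finally show "(ddiff \<epsilon> k i f * g + poly_act (wrefl \<epsilon> k i) f * ddiff \<epsilon> k i g) * proot \<epsilon> k i =
      f * g - poly_act (wrefl \<epsilon> k i) (f * g)" .
qed

lemma ddiff_const_mult: "ddiff \<epsilon> k i (pconst z * f) = pconst z * ddiff \<epsilon> k i f"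
  by (simp add: ddiff_mult)

lemma ddiff_var:
  "ddiff \<epsilon> k i (pvar j) = (if j = i then 1 else if j = k then - of_int \<epsilon> else 0)"
proof (rule ddiff_unique[OF ki(1)])
  show "(if j = i then 1 else if j = k then - of_int \<epsilon> else 0) * proot \<epsilon> k i =
      pvar j - poly_act (wrefl \<epsilon> k i) (pvar j)"
    using ki(1) minus_mult_proot[OF ki(2), of k i]
    by (simp only: poly_act_wrefl_var[OF ki]) (auto simp: proot_def)
qed

text \<open>By \<open>wrefl_conj\<close>, w maps numerator to numerator; it maps the root to a root
  only up to the sign \<open>sgn_at w i\<close>, which reappears as the factor on the right.\<close>

lemma poly_act_ddiff:
  "poly_act w (ddiff \<epsilon> k i f) =
    of_int (sgn_at w i) * ddiff (\<epsilon> * sgn_at w k * sgn_at w i) (perm w k) (perm w i) (poly_act w f)"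
proof -
  let ?e = "\<epsilon> * sgn_at w k * sgn_at w i"
  have e: "?e \<in> {1, -1}"
    using ki sgn_at_cases[of w k] sgn_at_cases[of w i] by auto
  have p: "perm w k \<noteq> perm w i" using ki by simp
  have sq: "of_int (sgn_at w i) * of_int (sgn_at w i) = (1 :: 'n cpoly)"
    by (simp flip: of_int_mult)
  have proot: "poly_act w (proot \<epsilon> k i) = of_int (sgn_at w i) * proot ?e (perm w k) (perm w i)"
    using sgn_at_cases[of w i] by (auto simp: proot_def signed_def algebra_simps)
  have "ddiff ?e (perm w k) (perm w i) (poly_act w f) = of_int (sgn_at w i) * poly_act w (ddiff \<epsilon> k i f)"
  proof (rule ddiff_unique[OF p])
    have "of_int (sgn_at w i) * poly_act w (ddiff \<epsilon> k i f) * proot ?e (perm w k) (perm w i) =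
        poly_act w (ddiff \<epsilon> k i f * proot \<epsilon> k i)"
      by (simp add: proot mult_ac)
    also have "\<dots> = poly_act w f - poly_act (wrefl ?e (perm w k) (perm w i)) (poly_act w f)"
      by (simp add: ddiff_mult_proot[OF ki] poly_act_act wrefl_conj[OF ki])
    finally show "of_int (sgn_at w i) * poly_act w (ddiff \<epsilon> k i f) * proot ?e (perm w k) (perm w i) =
        poly_act w f - poly_act (wrefl ?e (perm w k) (perm w i)) (poly_act w f)" .
  qed
  then show ?thesis
    by (simp add: sq flip: mult.assoc)
qed

end

section \<open>Tensor products\<close>

locale tensor_data =
  fixes S :: "('s, 'x) ring_scheme" and A :: "('r, 'a) module" and ract :: "'a \<Rightarrow> 's \<Rightarrow> 'a"
    and B :: "('s, 'b) module"
  assumes abelian_A: "abelian_group A" and abelian_B: "abelian_group B"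
    and ract_closed: "a \<in> carrier A \<Longrightarrow> s \<in> carrier S \<Longrightarrow> ract a s \<in> carrier A"
    and smult_closed: "s \<in> carrier S \<Longrightarrow> b \<in> carrier B \<Longrightarrow> s \<odot>\<^bsub>B\<^esub> b \<in> carrier B"
begin

interpretation A: abelian_group A by (rule abelian_A)
interpretation B: abelian_group B by (rule abelian_B)

abbreviation ker where "ker \<equiv> tensor_kernel S A ract B"
abbreviation cls where "cls \<equiv> tensor_class S A ract B"
abbreviation T where "T \<equiv> tensor_product S A ract B"
abbreviation pure where "pure \<equiv> pure_tensor S A ract B"

definition frags :: "('a \<times> 'b \<Rightarrow>\<^sub>0 int) set" where
  "frags = {p. Poly_Mapping.keys p \<subseteq> carrier A \<times> carrier B}"

lemma frags_zero [simp]: "0 \<in> frags"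
  and frags_add [simp]: "p \<in> frags \<Longrightarrow> q \<in> frags \<Longrightarrow> p + q \<in> frags"
  and frags_minus [simp]: "p \<in> frags \<Longrightarrow> - p \<in> frags"
  and frags_diff [simp]: "p \<in> frags \<Longrightarrow> q \<in> frags \<Longrightarrow> p - q \<in> frags"
  and frags_of [simp]: "frag_of (a, b) \<in> frags \<longleftrightarrow> a \<in> carrier A \<and> b \<in> carrier B"
  using keys_add[of p q] keys_diff[of p q] by (auto simp: frags_def)

lemma frags_sum [simp]: "(\<And>i. i \<in> I \<Longrightarrow> f i \<in> frags) \<Longrightarrow> sum f I \<in> frags"
  by (induction I rule: infinite_finite_induct) auto

lemma frags_induct [consumes 1, case_names zero of diff]:
  assumes "p \<in> frags" "P 0" "\<And>a b. a \<in> carrier A \<Longrightarrow> b \<in> carrier B \<Longrightarrow> P (frag_of (a, b))"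
    "\<And>p q. p \<in> frags \<Longrightarrow> q \<in> frags \<Longrightarrow> P p \<Longrightarrow> P q \<Longrightarrow> P (p - q)"
  shows "P p"
proof -
  have "Poly_Mapping.keys p \<subseteq> carrier A \<times> carrier B"
    using assms(1) by (simp add: frags_def)
  then show ?thesis
    by (rule free_Abelian_group_induct) (use assms(2-4) in \<open>auto simp: frags_def\<close>)
qed

lemma relators_frags: "tensor_relators S A ract B \<subseteq> frags"
  unfolding tensor_relators_def by (auto simp: ract_closed smult_closed)

lemma ker_frags: "p \<in> ker \<Longrightarrow> p \<in> frags"
  unfolding tensor_kernel_def
proof (induction rule: generate.induct)
  case (inv h)
  then have "Poly_Mapping.keys h \<subseteq> carrier A \<times> carrier B"
    using relators_frags by (auto simp: frags_def)
  then show ?case by (simp add: frags_def)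
qed (use relators_frags in auto)

lemma ker_zero [simp]: "0 \<in> ker"
  unfolding tensor_kernel_def by (metis generate.one one_free_Abelian_group)

lemma ker_add [simp]: "p \<in> ker \<Longrightarrow> q \<in> ker \<Longrightarrow> p + q \<in> ker"
  unfolding tensor_kernel_def by (metis generate.eng mult_free_Abelian_group)

lemma ker_minus [simp]:
  assumes "p \<in> ker" shows "- p \<in> ker"
proof -
  let ?G = "free_Abelian_group (carrier A \<times> carrier B)"
  interpret G: group ?G by simp
  have "tensor_relators S A ract B \<subseteq> carrier ?G"
    using relators_frags by (auto simp: frags_def)
  then have "inv\<^bsub>?G\<^esub> p \<in> ker"
    using assms unfolding tensor_kernel_def by (rule G.generate_m_inv_closed)
  with ker_frags[OF assms] show ?thesis by (simp add: frags_def)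
qed

lemma ker_diff [simp]: "p \<in> ker \<Longrightarrow> q \<in> ker \<Longrightarrow> p - q \<in> ker"
  using ker_add[of p "- q"] by simp

lemma ker_relator: "p \<in> tensor_relators S A ract B \<Longrightarrow> p \<in> ker"
  unfolding tensor_kernel_def by (rule generate.incl)

lemma ker_induct [consumes 1, case_names zero relator add minus]:
  assumes "p \<in> ker" "P 0" "\<And>p. p \<in> tensor_relators S A ract B \<Longrightarrow> P p"
    "\<And>p q. p \<in> ker \<Longrightarrow> q \<in> ker \<Longrightarrow> P p \<Longrightarrow> P q \<Longrightarrow> P (p + q)"
    "\<And>p. p \<in> ker \<Longrightarrow> P p \<Longrightarrow> P (- p)"
  shows "P p"
  using assms(1) unfolding tensor_kernel_def
proof (induction rule: generate.induct)
  case (inv h)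
  then have "Poly_Mapping.keys h \<subseteq> carrier A \<times> carrier B"
    using relators_frags by (auto simp: frags_def)
  then show ?case using inv assms(3,5) by (simp add: ker_relator)
qed (use assms in \<open>auto simp: tensor_kernel_def\<close>)

lemma cls_def: "cls p = {h + p | h. h \<in> ker}"
  by (auto simp: tensor_class_def r_coset_def)

text \<open>Holds for arbitrary p and q, since \<open>cls p\<close> is simply the translate of
  \<open>ker\<close> by p; hence equations in the tensor product are computed with
  representatives.\<close>

lemma cls_eq_iff: "cls p = cls q \<longleftrightarrow> p - q \<in> ker"
proof
  assume "cls p = cls q"
  moreover have "p \<in> cls p" by (auto simp: cls_def intro: exI[of _ 0])
  ultimately show "p - q \<in> ker" by (auto simp: cls_def)
next
  have sub: "cls p \<subseteq> cls q" if "p - q \<in> ker" for p q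
  proof
    fix x assume "x \<in> cls p"
    then obtain h where "h \<in> ker" "x = h + p" by (auto simp: cls_def)
    then show "x \<in> cls q" using that unfolding cls_def
      by (intro CollectI exI[of _ "h + (p - q)"]) simp
  qed
  assume "p - q \<in> ker"
  then show "cls p = cls q" using sub[of p q] sub[of q p] ker_minus[of "p - q"] by auto
qed

lemma cls_add_cong:
  assumes "cls p = cls p'" "cls q = cls q'"
  shows "cls (p + q) = cls (p' + q')"
proof -
  have "(p - p') + (q - q') \<in> ker"
    by (rule ker_add) (use assms in \<open>simp_all add: cls_eq_iff\<close>)
  also have "(p - p') + (q - q') = (p + q) - (p' + q')"
    by simp
  finally show ?thesis by (simp add: cls_eq_iff)
qed

lemma cls_diff_cong:
  assumes "cls p = cls p'" "cls q = cls q'"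
  shows "cls (p - q) = cls (p' - q')"
proof -
  have "(p - p') - (q - q') \<in> ker"
    by (rule ker_diff) (use assms in \<open>simp_all add: cls_eq_iff\<close>)
  also have "(p - p') - (q - q') = (p - q) - (p' - q')"
    by simp
  finally show ?thesis by (simp add: cls_eq_iff)
qed

lemma cls_sum_cong:
  assumes "\<And>i. i \<in> I \<Longrightarrow> cls (f i) = cls (g i)"
  shows "cls (sum f I) = cls (sum g I)"
proof -
  have "(\<Sum>i\<in>I. f i - g i) \<in> ker"
    using assms by (induction I rule: infinite_finite_induct) (simp_all add: cls_eq_iff)
  then show ?thesis by (simp add: cls_eq_iff sum_subtractf)
qed

lemma carrier_T: "carrier T = cls ` frags"
  by (auto simp: tensor_product_def FactGroup_def RCOSETS_def tensor_class_def frags_def)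

lemma cls_closed [simp]: "p \<in> frags \<Longrightarrow> cls p \<in> carrier T"
  by (simp add: carrier_T)

lemma add_T [simp]: "cls p \<oplus>\<^bsub>T\<^esub> cls q = cls (p + q)"
proof -
  have "cls p \<oplus>\<^bsub>T\<^esub> cls q = {x + y | x y. x \<in> cls p \<and> y \<in> cls q}"
    by (auto simp: tensor_product_def FactGroup_def set_mult_def)
  also have "\<dots> = cls (p + q)"
  proof (intro equalityI subsetI)
    fix x assume "x \<in> {x + y | x y. x \<in> cls p \<and> y \<in> cls q}"
    then obtain h k where "h \<in> ker" "k \<in> ker" "x = (h + p) + (k + q)"
      by (auto simp: cls_def)
    then show "x \<in> cls (p + q)"
      unfolding cls_def by (intro CollectI exI[of _ "h + k"]) (simp add: algebra_simps)
  next
    fix x assume "x \<in> cls (p + q)"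
    then obtain h where "h \<in> ker" "x = (h + p) + (0 + q)"
      by (auto simp: cls_def algebra_simps)
    then show "x \<in> {x + y | x y. x \<in> cls p \<and> y \<in> cls q}"
      unfolding cls_def using ker_zero by blast
  qed
  finally show ?thesis .
qed

lemma zero_T: "\<zero>\<^bsub>T\<^esub> = cls 0"
  by (simp add: tensor_product_def FactGroup_def cls_def)

lemma abelian_group_T: "abelian_group T"
proof (rule abelian_groupI)
  fix x assume "x \<in> carrier T"
  then obtain p where "p \<in> frags" "x = cls p" by (auto simp: carrier_T)
  then show "\<exists>y\<in>carrier T. y \<oplus>\<^bsub>T\<^esub> x = \<zero>\<^bsub>T\<^esub>"
    by (intro bexI[of _ "cls (- p)"]) (auto simp: zero_T)
qed (auto simp: carrier_T zero_T algebra_simps)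

lemma finsum_T:
  assumes "finite I" "\<And>i. i \<in> I \<Longrightarrow> f i \<in> frags"
  shows "(\<Oplus>\<^bsub>T\<^esub> i\<in>I. cls (f i)) = cls (sum f I)"
proof -
  interpret T: abelian_group T by (rule abelian_group_T)
  show ?thesis
    using assms by (induction I rule: finite_induct) (simp_all add: zero_T)
qed

lemma pure_eq: "pure a b = cls (frag_of (a, b))"
  by (simp add: pure_tensor_def)

lemma pure_add_left:
  assumes "a \<in> carrier A" "a' \<in> carrier A" "b \<in> carrier B"
  shows "frag_of (a \<oplus>\<^bsub>A\<^esub> a', b) - (frag_of (a, b) + frag_of (a', b)) \<in> ker"
  using assms by (intro ker_relator) (auto simp: tensor_relators_def algebra_simps)

lemma pure_add_right:
  assumes "a \<in> carrier A" "b \<in> carrier B" "b' \<in> carrier B"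
  shows "frag_of (a, b \<oplus>\<^bsub>B\<^esub> b') - (frag_of (a, b) + frag_of (a, b')) \<in> ker"
  using assms by (intro ker_relator) (auto simp: tensor_relators_def algebra_simps)

lemma pure_balanced:
  assumes "a \<in> carrier A" "s \<in> carrier S" "b \<in> carrier B"
  shows "frag_of (ract a s, b) - frag_of (a, s \<odot>\<^bsub>B\<^esub> b) \<in> ker"
  using assms by (intro ker_relator) (auto simp: tensor_relators_def)

lemma pure_zero_left:
  assumes "b \<in> carrier B" shows "frag_of (\<zero>\<^bsub>A\<^esub>, b) \<in> ker"
proof -
  have "- (frag_of (\<zero>\<^bsub>A\<^esub> \<oplus>\<^bsub>A\<^esub> \<zero>\<^bsub>A\<^esub>, b) - (frag_of (\<zero>\<^bsub>A\<^esub>, b) + frag_of (\<zero>\<^bsub>A\<^esub>, b))) \<in> ker"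
    using assms by (intro ker_minus pure_add_left) auto
  then show ?thesis by simp
qed

lemma pure_zero_right:
  assumes "a \<in> carrier A" shows "frag_of (a, \<zero>\<^bsub>B\<^esub>) \<in> ker"
proof -
  have "- (frag_of (a, \<zero>\<^bsub>B\<^esub> \<oplus>\<^bsub>B\<^esub> \<zero>\<^bsub>B\<^esub>) - (frag_of (a, \<zero>\<^bsub>B\<^esub>) + frag_of (a, \<zero>\<^bsub>B\<^esub>))) \<in> ker"
    using assms by (intro ker_minus pure_add_right) auto
  then show ?thesis by simp
qed

end

text \<open>A balanced biadditive map given on representatives: \<beta> takes values in the free
  abelian group, and the laws hold only modulo the target kernel. Values may be sums of pure
  tensors, which the map inverting the identification needs.\<close>

locale tensor_map =
  source: tensor_data S A ract B + target: tensor_data S' A' ract' B'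
  for S :: "('s, 'x) ring_scheme" and A :: "('r, 'a) module" and ract B
    and S' :: "('t, 'y) ring_scheme" and A' :: "('q, 'c) module" and ract'
    and B' :: "('t, 'd) module" +
  fixes \<beta> :: "'a \<times> 'b \<Rightarrow> ('c \<times> 'd \<Rightarrow>\<^sub>0 int)"
  assumes closed: "a \<in> carrier A \<Longrightarrow> b \<in> carrier B \<Longrightarrow> \<beta> (a, b) \<in> target.frags"
    and add_left: "a \<in> carrier A \<Longrightarrow> a' \<in> carrier A \<Longrightarrow> b \<in> carrier B \<Longrightarrow>
      \<beta> (a \<oplus>\<^bsub>A\<^esub> a', b) - (\<beta> (a, b) + \<beta> (a', b)) \<in> target.ker"
    and add_right: "a \<in> carrier A \<Longrightarrow> b \<in> carrier B \<Longrightarrow> b' \<in> carrier B \<Longrightarrow>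
      \<beta> (a, b \<oplus>\<^bsub>B\<^esub> b') - (\<beta> (a, b) + \<beta> (a, b')) \<in> target.ker"
    and balanced: "a \<in> carrier A \<Longrightarrow> s \<in> carrier S \<Longrightarrow> b \<in> carrier B \<Longrightarrow>
      \<beta> (ract a s, b) - \<beta> (a, s \<odot>\<^bsub>B\<^esub> b) \<in> target.ker"
begin

lemma extend_frags: "p \<in> source.frags \<Longrightarrow> frag_extend \<beta> p \<in> target.frags"
  by (induction rule: source.frags_induct) (simp_all add: closed frag_extend_diff)

lemma extend_ker: "p \<in> source.ker \<Longrightarrow> frag_extend \<beta> p \<in> target.ker"
proof (induction rule: source.ker_induct)
  case (relator p)
  then show ?case
    unfolding tensor_relators_def
    using add_left add_right balanced by (auto simp: frag_extend_diff frag_extend_add diff_diff_eq)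
qed (simp_all add: frag_extend_add frag_extend_minus)

lemma extend_cong:
  assumes "source.cls p = source.cls q"
  shows "target.cls (frag_extend \<beta> p) = target.cls (frag_extend \<beta> q)"
  using extend_ker[of "p - q"] assms
  by (simp add: source.cls_eq_iff target.cls_eq_iff frag_extend_diff)

end

locale tensor_pure_map = tensor_map S A ract B S' A' ract' B' "\<lambda>c. frag_of (h c)"
  for S :: "('s, 'x) ring_scheme" and A :: "('r, 'a) module" and ract and B :: "('s, 'b) module"
    and S' :: "('t, 'y) ring_scheme" and A' :: "('q, 'c) module" and ract'
    and B' :: "('t, 'd) module" and h :: "'a \<times> 'b \<Rightarrow> 'c \<times> 'd"
begin

text \<open>By \<open>extend_cong\<close> all cosets in the union defining \<open>tensor_hom\<close>
  coincide, so any representative computes it.\<close>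

lemma tensor_hom_cls:
  "tensor_hom S' A' ract' B' h (source.cls p) = target.cls (frag_extend (\<lambda>c. frag_of (h c)) p)"
proof -
  have "source.cls q = source.cls p" if "q \<in> source.cls p" for q
    using that unfolding source.cls_eq_iff by (auto simp: source.cls_def)
  moreover have "p \<in> source.cls p"
    by (auto simp: source.cls_def intro: exI[of _ 0])
  ultimately show ?thesis
    unfolding tensor_hom_def using extend_cong by blast
qed

end

text \<open>Scaling, left multiplication and the identification all change only the left factor, so
  additivity is inherited and just the balancing condition remains to be checked in each
  case.\<close>

lemma tensor_pure_mapI:
  fixes S :: "('s, 'x) ring_scheme" and A :: "('r, 'a) module" and B :: "('s, 'b) module"
    and S' :: "('t, 'y) ring_scheme" and A' :: "('q, 'c) module" and B' :: "('t, 'b) module"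
  assumes source: "tensor_data S A ract B" and target: "tensor_data S' A' ract' B'"
    and B: "carrier B = carrier B'" "\<And>b b'. b \<oplus>\<^bsub>B\<^esub> b' = b \<oplus>\<^bsub>B'\<^esub> b'"
    and closed: "\<And>a. a \<in> carrier A \<Longrightarrow> \<phi> a \<in> carrier A'"
    and add: "\<And>a a'. a \<in> carrier A \<Longrightarrow> a' \<in> carrier A \<Longrightarrow> \<phi> (a \<oplus>\<^bsub>A\<^esub> a') = \<phi> a \<oplus>\<^bsub>A'\<^esub> \<phi> a'"
    and balanced: "\<And>a s b. a \<in> carrier A \<Longrightarrow> s \<in> carrier S \<Longrightarrow> b \<in> carrier B \<Longrightarrow>
      frag_of (\<phi> (ract a s), b) - frag_of (\<phi> a, s \<odot>\<^bsub>B\<^esub> b) \<in> tensor_kernel S' A' ract' B'"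
  shows "tensor_pure_map S A ract B S' A' ract' B' (\<lambda>(a, b). (\<phi> a, b))"
proof -
  interpret target: tensor_data S' A' ract' B' by (rule target)
  show ?thesis
    by (intro tensor_pure_map.intro tensor_map.intro tensor_map_axioms.intro source target)
      (auto simp: B closed add intro!: target.pure_add_left target.pure_add_right
        balanced[unfolded B])
qed

section \<open>Presented algebras\<close>

lemma ring_of_type_algebra_simps [simp]:
  "carrier ring_of_type_algebra = UNIV"
  "x \<otimes>\<^bsub>ring_of_type_algebra\<^esub> y = x * y"
  "x \<oplus>\<^bsub>ring_of_type_algebra\<^esub> y = x + y"
  "\<one>\<^bsub>ring_of_type_algebra\<^esub> = 1"
  "\<zero>\<^bsub>ring_of_type_algebra\<^esub> = 0"
  by (simp_all add: ring_of_type_algebra_def)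

lemma abelian_group_of_type_algebra: "abelian_group (ring_of_type_algebra :: 'r::ring_1 ring)"
  by (rule abelian_groupI) (auto simp: algebra_simps intro: exI[of _ "- x" for x])

lemma ring_of_type_algebra: "ring (ring_of_type_algebra :: 'r::ring_1 ring)"
  by (rule ringI[OF abelian_group_of_type_algebra])
    (auto intro!: monoidI simp: algebra_simps)

lemma a_minus_of_type_algebra [simp]:
  "\<ominus>\<^bsub>ring_of_type_algebra\<^esub> x = - (x :: 'r::ring_1)"
proof -
  interpret ring "ring_of_type_algebra :: 'r ring" by (rule ring_of_type_algebra)
  show ?thesis by (rule minus_equality) simp_all
qed

definition relations :: "'g free_alg set \<Rightarrow> 'g free_alg set" where
  "relations rels = genideal ring_of_type_algebra rels"

lemma ideal_relations: "ideal (relations rels) (ring_of_type_algebra :: 'g free_alg ring)"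
  unfolding relations_def by (rule ring.genideal_ideal[OF ring_of_type_algebra]) simp

lemma relationsI: "r \<in> rels \<Longrightarrow> r \<in> relations rels"
  unfolding relations_def using ring.genideal_self[OF ring_of_type_algebra, of rels] by auto

lemma relations_zero [simp]: "0 \<in> relations rels"
  and relations_add: "p \<in> relations rels \<Longrightarrow> q \<in> relations rels \<Longrightarrow> p + q \<in> relations rels"
  and relations_mult_left: "p \<in> relations rels \<Longrightarrow> q * p \<in> relations rels"
  and relations_mult_right: "p \<in> relations rels \<Longrightarrow> p * q \<in> relations rels"
  and relations_minus: "p \<in> relations rels \<Longrightarrow> - p \<in> relations rels"
proof -
  interpret ideal "relations rels" "ring_of_type_algebra :: 'a free_alg ring"
    by (rule ideal_relations)
  show "0 \<in> relations rels" using additive_subgroup.zero_closed[OF additive_subgroup_axioms] by simp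
  show "p + q \<in> relations rels" if "p \<in> relations rels" "q \<in> relations rels"
    using additive_subgroup.a_closed[OF additive_subgroup_axioms that] by simp
  show "q * p \<in> relations rels" "p * q \<in> relations rels" if "p \<in> relations rels"
    using I_l_closed[OF that, of q] I_r_closed[OF that, of q] by simp_all
  show "- p \<in> relations rels" if "p \<in> relations rels"
    using additive_subgroup.a_inv_closed[OF additive_subgroup_axioms that] by simp
qed

lemma presented_class_def': "presented_class rels p = {h + p | h. h \<in> relations rels}"
  by (auto simp: presented_class_def relations_def a_r_coset_def r_coset_def)

lemma presented_class_eq_iff:
  "presented_class rels p = presented_class rels q \<longleftrightarrow> p - q \<in> relations rels"
proof
  assume "presented_class rels p = presented_class rels q"
  moreover have "p \<in> presented_class rels p"
    by (auto simp: presented_class_def' intro: exI[of _ 0])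
  ultimately show "p - q \<in> relations rels" by (auto simp: presented_class_def')
next
  have sub: "presented_class rels p \<subseteq> presented_class rels q" if "p - q \<in> relations rels" for p q
  proof
    fix x assume "x \<in> presented_class rels p"
    then obtain h where "h \<in> relations rels" "x = h + p" by (auto simp: presented_class_def')
    then show "x \<in> presented_class rels q" using that unfolding presented_class_def'
      by (intro CollectI exI[of _ "h + (p - q)"]) (simp add: relations_add)
  qed
  assume "p - q \<in> relations rels"
  then show "presented_class rels p = presented_class rels q"
    using sub[of p q] sub[of q p] relations_minus[of "p - q" rels] by auto
qed

lemma ring_presented_alg: "ring (presented_alg rels)"
  using ideal.quotient_is_ring[OF ideal_relations[of rels]]
  by (simp add: presented_alg_def relations_def)

lemma presented_class_hom: "presented_class rels \<in> ring_hom ring_of_type_algebra (presented_alg rels)"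
proof -
  have "presented_class rels = (+>\<^bsub>ring_of_type_algebra\<^esub>) (relations rels)"
    by (simp add: fun_eq_iff presented_class_def relations_def)
  with ideal.rcos_ring_hom[OF ideal_relations[of rels]] show ?thesis
    by (simp add: presented_alg_def relations_def)
qed

lemma presented_class_closed [simp]: "presented_class rels p \<in> carrier (presented_alg rels)"
  using ring_hom_closed[OF presented_class_hom] by simp

lemma presented_class_add:
  "presented_class rels (p + q) = presented_class rels p \<oplus>\<^bsub>presented_alg rels\<^esub> presented_class rels q"
  using ring_hom_add[OF presented_class_hom, of p q] by simp

lemma presented_class_mult:
  "presented_class rels (p * q) = presented_class rels p \<otimes>\<^bsub>presented_alg rels\<^esub> presented_class rels q"
  using ring_hom_mult[OF presented_class_hom, of p q] by simp

lemma presented_class_one: "presented_class rels 1 = \<one>\<^bsub>presented_alg rels\<^esub>"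
  using ring_hom_one[OF presented_class_hom] by simp

lemma presented_class_zero: "presented_class rels 0 = \<zero>\<^bsub>presented_alg rels\<^esub>"
  using ring_hom_zero[OF presented_class_hom ring_of_type_algebra ring_presented_alg] by simp

lemma presented_class_minus:
  "presented_class rels (- p) = \<ominus>\<^bsub>presented_alg rels\<^esub> presented_class rels p"
proof -
  interpret ring "presented_alg rels" by (rule ring_presented_alg)
  have "presented_class rels (- p) \<oplus>\<^bsub>presented_alg rels\<^esub> presented_class rels p = \<zero>\<^bsub>presented_alg rels\<^esub>"
    by (simp flip: presented_class_add presented_class_zero)
  then show ?thesis by (simp add: minus_equality)
qed

lemma carrier_presented_alg: "carrier (presented_alg rels) = range (presented_class rels)"
  by (auto simp: presented_alg_def presented_class_def FactRing_def A_RCOSETS_def' a_r_coset_def)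

text \<open>The universal property of a presented algebra: the kernel of the evaluation is an ideal
  containing the relators.\<close>

lemma (in free_evaluation) free_eval_relations:
  assumes "\<And>r. r \<in> rels \<Longrightarrow> free_eval sc a r = 0" and "p \<in> relations rels"
  shows "free_eval sc a p = 0"
proof -
  let ?K = "{p. free_eval sc a p = 0}"
  have "ideal ?K ring_of_type_algebra"
  proof (rule idealI[OF ring_of_type_algebra])
    interpret ring "ring_of_type_algebra :: 'g free_alg ring"
      by (rule ring_of_type_algebra)
    show "subgroup ?K (add_monoid ring_of_type_algebra)"
    proof (rule add.subgroupI)
      show "?K \<noteq> {}" using free_eval_zero by blast
    qed auto
  qed auto
  then have "relations rels \<subseteq> ?K"
    unfolding relations_def using assms(1)
    by (intro ring.genideal_minimal[OF ring_of_type_algebra]) auto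
  with assms(2) show ?thesis by auto
qed

text \<open>
  The relators of \<open>H_alg u\<close> depend on the value \<open>u\<close>, which a type cannot. The type \<open>'g palg\<close> is the
  product over all \<open>u\<close> of the presented algebras; computing there gives the relations for
  every \<open>u\<close> at once. Its sort does not include \<open>0 \<noteq> 1\<close>, which would have to be proved first.
\<close>

class presentation =
  fixes relators :: "complex \<Rightarrow> 'a free_alg set"

instantiation K_gen :: (finite) presentation
begin
definition relators_K_gen :: "complex \<Rightarrow> 'a K_gen free_alg set" where
  "relators_K_gen u = K_relators"
instance ..
end

instantiation H_gen :: (finite) presentation
begin
definition relators_H_gen :: "complex \<Rightarrow> 'a H_gen free_alg set" where
  "relators_H_gen u = H_relators u"
instance ..
end

quotient_type (overloaded) 'g palg = "complex \<Rightarrow> ('g::presentation) free_alg" /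
  "\<lambda>p q. \<forall>u. p u - q u \<in> relations (relators u)"
proof (intro equivpI reflpI sympI transpI allI)
  fix p q r :: "complex \<Rightarrow> 'g free_alg" and u
  show "p u - p u \<in> relations (relators u)" by simp
  show "q u - p u \<in> relations (relators u)" if "\<forall>u. p u - q u \<in> relations (relators u)"
    using that relations_minus[of "p u - q u"] by simp
  show "p u - r u \<in> relations (relators u)"
    if "\<forall>u. p u - q u \<in> relations (relators u)" "\<forall>u. q u - r u \<in> relations (relators u)"
    using that relations_add[of "p u - q u" _ "q u - r u"] by simp
qed

instantiation palg :: (presentation) "{ring, monoid_mult}"
begin

lift_definition zero_palg :: "'a palg" is "\<lambda>_. 0" .
lift_definition one_palg :: "'a palg" is "\<lambda>_. 1" .

lift_definition plus_palg :: "'a palg \<Rightarrow> 'a palg \<Rightarrow> 'a palg" is "\<lambda>p q u. p u + q u"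
  subgoal for p p' q q' u
    using relations_add[of "p u - p' u" _ "q u - q' u"] by (simp add: algebra_simps)
  done

lift_definition uminus_palg :: "'a palg \<Rightarrow> 'a palg" is "\<lambda>p u. - p u"
  subgoal for p p' u
    using relations_minus[of "p u - p' u"] by (simp add: algebra_simps)
  done

lift_definition times_palg :: "'a palg \<Rightarrow> 'a palg \<Rightarrow> 'a palg" is "\<lambda>p q u. p u * q u"
  subgoal for p p' q q' u
    using relations_add[OF relations_mult_right[of "p u - p' u" _ "q u"]
        relations_mult_left[of "q u - q' u" _ "p' u"]]
    by (simp add: algebra_simps)
  done

definition minus_palg :: "'a palg \<Rightarrow> 'a palg \<Rightarrow> 'a palg" where
  "p - q = p + - (q :: 'a palg)"

instance
proof
  fix a b c :: "'a palg"
  show "a + b + c = a + (b + c)" "a + b = b + a" "0 + a = a" "- a + a = 0"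
    "a * b * c = a * (b * c)" "1 * a = a" "a * 1 = a"
    "(a + b) * c = a * c + b * c" "a * (b + c) = a * b + a * c"
    by (transfer; simp add: algebra_simps)+
  show "a - b = a + - b" by (rule minus_palg_def)
qed

end

definition family :: "(complex \<Rightarrow> 'g::presentation free_alg) \<Rightarrow> 'g palg" where
  "family = abs_palg"

text \<open>The component at u. It is a ring homomorphism, so identities computed by class-based
  simplification in \<open>'g palg\<close> are transported to
  \<open>presented_alg (relators u)\<close>.\<close>

definition proj :: "complex \<Rightarrow> 'g::presentation palg \<Rightarrow> 'g free_alg set" where
  "proj u a = presented_class (relators u) (rep_palg a u)"

definition pgen :: "'g::presentation \<Rightarrow> 'g palg" where
  "pgen x = family (\<lambda>_. gen x)"

definition pscal :: "complex \<Rightarrow> 'g::presentation palg" where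
  "pscal z = family (\<lambda>_. scal z)"

text \<open>The parameter as an element of the product algebra: its component at u is the scalar
  u.\<close>

definition param :: "'g::presentation palg" where
  "param = family scal"

lemma family_add: "family (\<lambda>u. p u + q u) = family p + family q"
  and family_mult: "family (\<lambda>u. p u * q u) = family p * family q"
  and family_minus: "family (\<lambda>u. - p u) = - family p"
  and family_zero: "family (\<lambda>u. 0) = 0"
  and family_one: "family (\<lambda>u. 1) = 1"
  by (simp_all add: family_def plus_palg.abs_eq times_palg.abs_eq uminus_palg.abs_eq
      zero_palg.abs_eq one_palg.abs_eq)

lemma family_diff: "family (\<lambda>u. p u - q u) = family p - family q"
  using family_add[of p "\<lambda>u. - q u"] by (simp add: family_minus)

lemma family_sum: "family (\<lambda>u. \<Sum>k\<in>A. p k u) = (\<Sum>k\<in>A. family (p k))"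
  by (induction A rule: infinite_finite_induct) (simp_all add: family_zero family_add)

lemmas family_simps =
  family_add family_mult family_minus family_zero family_one family_diff family_sum

lemma family_eq_iff: "family p = family q \<longleftrightarrow> (\<forall>u. p u - q u \<in> relations (relators u))"
  by (simp add: family_def palg.abs_eq_iff)

lemma family_relator: "(\<And>u. r u \<in> relators u) \<Longrightarrow> family r = 0"
  using family_eq_iff[of r "\<lambda>_. 0"] by (simp add: family_zero relationsI)

lemma family_rep: "family (rep_palg a) = a"
  unfolding family_def by (rule Quotient3_abs_rep[OF Quotient3_palg])

lemma family_exhaust: obtains p where "a = family p"
  using family_rep by metis

lemma proj_family: "proj u (family p) = presented_class (relators u) (p u)"
  using family_rep[of "family p"] by (simp add: proj_def presented_class_eq_iff family_eq_iff)

lemma proj_closed [simp]: "proj u a \<in> carrier (presented_alg (relators u))"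
  by (simp add: proj_def)

lemma proj_add: "proj u (a + b) = proj u a \<oplus>\<^bsub>presented_alg (relators u)\<^esub> proj u b"
  by (cases a rule: family_exhaust; cases b rule: family_exhaust)
    (simp add: proj_family presented_class_add flip: family_add)

lemma proj_mult: "proj u (a * b) = proj u a \<otimes>\<^bsub>presented_alg (relators u)\<^esub> proj u b"
  by (cases a rule: family_exhaust; cases b rule: family_exhaust)
    (simp add: proj_family presented_class_mult flip: family_mult)

lemma proj_minus: "proj u (- a) = \<ominus>\<^bsub>presented_alg (relators u)\<^esub> proj u a"
  by (cases a rule: family_exhaust)
    (simp add: proj_family presented_class_minus flip: family_minus)

lemma proj_one: "proj u 1 = \<one>\<^bsub>presented_alg (relators u)\<^esub>"
  and proj_zero: "proj u 0 = \<zero>\<^bsub>presented_alg (relators u)\<^esub>"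
  by (simp_all add: proj_family presented_class_one presented_class_zero
      flip: family_one family_zero)

lemma scalars_pscal: "scalars (pscal :: complex \<Rightarrow> 'g::presentation palg)"
  by unfold_locales
    (simp_all add: pscal_def scalars.sc_add[OF scalars_scal] scalars.sc_mult[OF scalars_scal]
      scalars.sc_one[OF scalars_scal] family_simps)

lemma pscal_central: "pscal z * a = a * pscal z"
  unfolding pscal_def
  by (cases a rule: family_exhaust) (simp add: scal_central[of z] flip: family_mult)

lemma param_central: "param * a = a * param"
  unfolding param_def
  by (cases a rule: family_exhaust)
    (simp add: family_eq_iff scal_central[of u p for u p] flip: family_mult)

section \<open>Clifford-Weyl relations\<close>

text \<open>Signs act by negation because \<open>of_int\<close> would require the sort
  \<open>ring_1\<close>, which includes 0 \<noteq> 1.\<close>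

definition pm :: "int \<Rightarrow> 'a::uminus \<Rightarrow> 'a" where
  "pm \<epsilon> a = (if \<epsilon> = 1 then a else - a)"

lemma pm_one [simp]: "pm 1 a = a" and pm_minus_one [simp]: "pm (-1) a = - a"
  by (simp_all add: pm_def)

text \<open>Interpreted three times: in the algebra K, in the full algebra, and in the operators on
  \<complex>[y] \<otimes> K. The inverse is moved to the other side in \<open>g_c\<close>, so that
  it serves as a commutation rule.\<close>

locale clifford_weyl =
  fixes c :: "'n::finite \<Rightarrow> 'r::{ring,monoid_mult}" and g :: "'n weyl_D \<Rightarrow> 'r"
  assumes c_sq: "c i * c i = 1"
    and c_anti: "i \<noteq> j \<Longrightarrow> c i * c j = - (c j * c i)"
    and g_one: "g 1 = 1"
    and g_mult: "g v * g w = g (v * w)"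
    and g_c: "g w * c i = pm (sgn_at w i) (c (perm w i)) * g w"
begin

text \<open>The reflection term common to the commutators of the y's with the x's and to the
  asserted formula: \<open>(1 + c_k c_i) s_ki\<close> for \<epsilon> = 1 and its barred counterpart
  for \<epsilon> = -1.\<close>

definition kr :: "int \<Rightarrow> 'n \<Rightarrow> 'n \<Rightarrow> 'r" where
  "kr \<epsilon> k i = (1 + pm \<epsilon> (c k * c i)) * g (wrefl \<epsilon> k i)"

lemma wrefl_c:
  assumes "k \<noteq> i" "\<epsilon> \<in> {1, -1}"
  shows "g (wrefl \<epsilon> k i) * c i = pm \<epsilon> (c k) * g (wrefl \<epsilon> k i)"
    and "g (wrefl \<epsilon> k i) * c k = pm \<epsilon> (c i) * g (wrefl \<epsilon> k i)"
    and "j \<noteq> i \<Longrightarrow> j \<noteq> k \<Longrightarrow> g (wrefl \<epsilon> k i) * c j = c j * g (wrefl \<epsilon> k i)"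
  using assms by (simp_all add: g_c sgn_at_wrefl perm_wrefl pm_def transpose_apply_other)

lemma c_cancel: "c i * (c i * a) = a"
  by (simp add: c_sq flip: mult.assoc)

lemma c_swap: "i \<noteq> j \<Longrightarrow> c i * (c j * a) = - (c j * (c i * a))"
  by (simp add: c_anti[of i j] flip: mult.assoc)

text \<open>Both sides equal \<open>(\<epsilon> c_k - c_i)\<close> times the reflection. Together
  with \<open>kr_c_other\<close> this says that \<open>kr \<epsilon> k i\<close> passes the c's with
  the same signs as \<open>x_i\<close>, so a sum of such terms can imitate
  \<open>x_i\<close>.\<close>

lemma kr_c_right:
  assumes "k \<noteq> i" "\<epsilon> \<in> {1, -1}"
  shows "kr \<epsilon> k i * c i = - (c i * kr \<epsilon> k i)"
proof -
  let ?r = "g (wrefl \<epsilon> k i)"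
  have "kr \<epsilon> k i * c i = (1 + pm \<epsilon> (c k * c i)) * (?r * c i)"
    by (simp add: kr_def mult.assoc)
  also have "\<dots> = (pm \<epsilon> (c k) - c i) * ?r"
    unfolding wrefl_c(1)[OF assms]
    using assms by (auto simp: algebra_simps c_swap[of i k] c_cancel)
  also have "\<dots> = - (c i * kr \<epsilon> k i)"
    using assms by (auto simp: kr_def algebra_simps c_swap[of i k] c_cancel)
  finally show ?thesis .
qed

lemma kr_c_other:
  assumes "k \<noteq> i" "\<epsilon> \<in> {1, -1}" "j \<noteq> i"
  shows "kr \<epsilon> k i * c j = c j * kr \<epsilon> k i"
proof (cases "j = k")
  case True
  let ?r = "g (wrefl \<epsilon> k i)"
  have "kr \<epsilon> k i * c k = (1 + pm \<epsilon> (c k * c i)) * (?r * c k)"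
    by (simp add: kr_def mult.assoc)
  also have "\<dots> = (c k + pm \<epsilon> (c i)) * ?r"
    unfolding wrefl_c(2)[OF assms(1,2)]
    using assms by (auto simp: algebra_simps c_swap[of i k] c_cancel)
  also have "\<dots> = c k * kr \<epsilon> k i"
    using assms by (auto simp: kr_def algebra_simps c_swap[of i k] c_cancel)
  finally show ?thesis using True by simp
next
  case False
  have cc: "c k * (c i * (c j * a)) = c j * (c k * (c i * a))" for a
    using assms False by (simp add: c_swap[of i j] c_swap[of k j])
  have "kr \<epsilon> k i * c j = (1 + pm \<epsilon> (c k * c i)) * (c j * g (wrefl \<epsilon> k i))"
    by (simp add: kr_def mult.assoc wrefl_c(3)[OF assms(1,2) assms(3) False])
  also have "\<dots> = c j * kr \<epsilon> k i"
    using assms(2) by (auto simp: kr_def algebra_simps cc)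
  finally show ?thesis .
qed

text \<open>The two Clifford factors contribute the sign \<open>sgn_at w k * sgn_at w i\<close>,
  which is exactly the change of \<epsilon> in \<open>wrefl_conj\<close>.\<close>

lemma g_kr:
  assumes "k \<noteq> i" "\<epsilon> \<in> {1, -1}"
  shows "g w * kr \<epsilon> k i = kr (\<epsilon> * sgn_at w k * sgn_at w i) (perm w k) (perm w i) * g w"
proof -
  have "g w * (c k * (c i * a)) = pm (sgn_at w k * sgn_at w i) (c (perm w k) * (c (perm w i) * (g w * a)))" for a
  proof -
    have "g w * (c k * (c i * a)) = (g w * c k) * (c i * a)"
      by (simp only: mult.assoc)
    also have "\<dots> = pm (sgn_at w k) (c (perm w k)) * ((g w * c i) * a)"
      by (simp only: g_c[of w k] mult.assoc)
    also have "\<dots> = pm (sgn_at w k * sgn_at w i) (c (perm w k) * (c (perm w i) * (g w * a)))"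
      unfolding g_c using sgn_at_cases[of w k] sgn_at_cases[of w i] by (auto simp: mult.assoc)
    finally show ?thesis .
  qed
  moreover have "g w * g (wrefl \<epsilon> k i) =
      g (wrefl (\<epsilon> * sgn_at w k * sgn_at w i) (perm w k) (perm w i)) * g w"
    by (simp add: g_mult wrefl_conj[OF assms])
  ultimately show ?thesis
    using assms(2) sgn_at_cases[of w k] sgn_at_cases[of w i]
    by (auto simp: kr_def algebra_simps)
qed

end

lemma clifford_weylI:
  fixes \<phi> :: "'g free_alg \<Rightarrow> 'r::{ring,monoid_mult}" and C :: "'n::finite \<Rightarrow> 'g"
  assumes \<phi>: "\<And>p q. \<phi> (p + q) = \<phi> p + \<phi> q" "\<And>p q. \<phi> (p * q) = \<phi> p * \<phi> q" "\<phi> 1 = 1"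
    and rel: "\<And>r. r \<in> clifford_weyl_relators (\<lambda>i. gen (C i)) (\<lambda>w. gen (G w)) \<Longrightarrow> \<phi> r = 0"
  shows "clifford_weyl (\<lambda>i. \<phi> (gen (C i))) (\<lambda>w. \<phi> (gen (G w)))"
proof -
  have zero: "\<phi> 0 = 0" using \<phi>(1)[of 0 0] by simp
  have minus: "\<phi> (- p) = - \<phi> p" for p
    using \<phi>(1)[of p "- p"] by (simp add: zero eq_neg_iff_add_eq_0 add.commute)
  have diff: "\<phi> (p - q) = \<phi> p - \<phi> q" for p q
    using \<phi>(1)[of p "- q"] by (simp add: minus)
  have one: "\<phi> (gen (G 1)) = 1"
    using rel[of "gen (G 1) - 1"] by (auto simp: clifford_weyl_relators_def diff \<phi>)
  have mult: "\<phi> (gen (G v)) * \<phi> (gen (G w)) = \<phi> (gen (G (v * w)))" for v w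
    using rel[of "gen (G v) * gen (G w) - gen (G (v * w))"]
    by (auto simp: clifford_weyl_relators_def diff \<phi>)
  have signed: "\<phi> (signed w (\<lambda>i. gen (C i)) i) = pm (sgn_at w i) (\<phi> (gen (C (perm w i))))" for w i
    using sgn_at_cases[of w i] by (auto simp: signed_def minus)
  have conj: "\<phi> (gen (G w)) * \<phi> (gen (C i)) * \<phi> (gen (G (inverse w))) = pm (sgn_at w i) (\<phi> (gen (C (perm w i))))" for w i
  proof -
    have "\<phi> (gen (G w) * gen (C i) * gen (G (inverse w)) - signed w (\<lambda>i. gen (C i)) i) = 0"
      by (rule rel) (auto simp: clifford_weyl_relators_def)
    then show ?thesis by (simp add: diff \<phi> signed)
  qed
  show ?thesis
  proof
    fix i j :: 'n and v w :: "'n weyl_D"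
    have "\<phi> (gen (C i) * gen (C i) - 1) = 0"
      by (rule rel) (auto simp: clifford_weyl_relators_def)
    then show "\<phi> (gen (C i)) * \<phi> (gen (C i)) = 1"
      by (simp add: diff \<phi>)
    show "\<phi> (gen (C i)) * \<phi> (gen (C j)) = - (\<phi> (gen (C j)) * \<phi> (gen (C i)))" if "i \<noteq> j"
    proof -
      have "\<phi> (gen (C i) * gen (C j) + gen (C j) * gen (C i)) = 0"
        using that by (intro rel) (unfold clifford_weyl_relators_def, blast)
      then show ?thesis by (simp add: \<phi> eq_neg_iff_add_eq_0)
    qed
    show "\<phi> (gen (G w)) * \<phi> (gen (C i)) = pm (sgn_at w i) (\<phi> (gen (C (perm w i)))) * \<phi> (gen (G w))"
      unfolding conj[symmetric] by (simp add: mult.assoc mult weyl_D_inverse one)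
  qed (simp_all add: one mult)
qed

section \<open>Commuting \<open>x\<^sub>i\<close> past polynomials in the \<open>y\<^sub>j\<close>\<close>

interpretation K: clifford_weyl "\<lambda>i. pgen (Kc i)" "\<lambda>w. pgen (Kw w)"
  unfolding pgen_def
  by (rule clifford_weylI)
    (auto simp: family_simps relators_K_gen_def K_relators_def intro!: family_relator)

interpretation H: clifford_weyl "\<lambda>i. pgen (Hc i)" "\<lambda>w. pgen (Hw w)"
  unfolding pgen_def
  by (rule clifford_weylI)
    (auto simp: family_simps relators_H_gen_def H_relators_def Let_def intro!: family_relator)

lemma H_relation:
  assumes "\<And>u. p u - q u \<in> H_relators u"
  shows "family p = family q"
  using family_relator[of "\<lambda>u. p u - q u"] assms
  by (simp add: relators_H_gen_def family_diff)

lemma Hy_commute: "pgen (Hy i) * pgen (Hy j) = pgen (Hy j) * pgen (Hy i)"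
proof -
  have "family (\<lambda>u. gen (Hy i) * gen (Hy j)) = family (\<lambda>u. gen (Hy j) * gen (Hy i))"
    by (rule H_relation) (unfold H_relators_def Let_def, blast)
  then show ?thesis by (simp add: family_simps flip: pgen_def)
qed

lemma Hy_Hc: "pgen (Hy i) * pgen (Hc j) = pgen (Hc j) * pgen (Hy i)"
proof -
  have "family (\<lambda>u. gen (Hy i) * gen (Hc j)) = family (\<lambda>u. gen (Hc j) * gen (Hy i))"
    by (rule H_relation) (unfold H_relators_def Let_def, blast)
  then show ?thesis by (simp add: family_simps flip: pgen_def)
qed

lemma Hw_Hy: "pgen (Hw w) * pgen (Hy i) = pm (sgn_at w i) (pgen (Hy (perm w i))) * pgen (Hw w)"
proof -
  have "family (\<lambda>u. gen (Hw w) * gen (Hy i) * gen (Hw (inverse w))) =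
      family (\<lambda>u. signed w (\<lambda>i. gen (Hy i)) i)"
    by (rule H_relation) (unfold H_relators_def Let_def, blast)
  moreover have "family (\<lambda>u. signed w (\<lambda>i. gen (Hy i)) i) = pm (sgn_at w i) (pgen (Hy (perm w i)))"
    using sgn_at_cases[of w i] by (auto simp: signed_def family_simps pgen_def)
  ultimately have conj: "pgen (Hw w) * pgen (Hy i) * pgen (Hw (inverse w)) =
      pm (sgn_at w i) (pgen (Hy (perm w i)))"
    by (simp add: family_simps flip: pgen_def)
  show ?thesis
    unfolding conj[symmetric] by (simp add: mult.assoc H.g_mult weyl_D_inverse H.g_one)
qed

lemma Hy_Hx_neq:
  assumes "i \<noteq> j"
  shows "pgen (Hy j) * pgen (Hx i) - pgen (Hx i) * pgen (Hy j) =
    param * (H.kr 1 j i - H.kr (-1) j i)"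
proof -
  have "family (\<lambda>u. gen (Hy j) * gen (Hx i) - gen (Hx i) * gen (Hy j)) =
      family (\<lambda>u. scal u * ((1 + gen (Hc j) * gen (Hc i)) * gen (Hw (refl_s i j)) -
        (1 - gen (Hc j) * gen (Hc i)) * gen (Hw (refl_sbar i j))))"
    by (rule H_relation) (use assms in \<open>unfold H_relators_def Let_def, blast\<close>)
  then show ?thesis
    by (simp add: family_simps H.kr_def wrefl_commute[of _ j i] flip: pgen_def param_def)
      (simp add: wrefl_def)
qed

lemma Hy_Hx_eq:
  "pgen (Hy i) * pgen (Hx i) - pgen (Hx i) * pgen (Hy i) =
    - (param * (\<Sum>k\<in>UNIV - {i}. \<Sum>\<epsilon>\<in>{1, -1}. H.kr \<epsilon> k i))"
proof -
  have "family (\<lambda>u. gen (Hy i) * gen (Hx i) - gen (Hx i) * gen (Hy i)) =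
      family (\<lambda>u. - scal u * (\<Sum>k\<in>UNIV - {i}. (1 + gen (Hc k) * gen (Hc i)) * gen (Hw (refl_s k i)) +
        (1 - gen (Hc k) * gen (Hc i)) * gen (Hw (refl_sbar k i))))"
    by (rule H_relation) (unfold H_relators_def Let_def, blast)
  then show ?thesis
    by (simp add: family_simps H.kr_def flip: pgen_def param_def) (simp add: wrefl_def)
qed

lemma param_left_commute: "param * (a * b) = a * (param * b)"
  by (simp only: mult.assoc[symmetric] param_central[of a])

definition y_poly :: "'n::finite cpoly \<Rightarrow> 'n H_gen palg" where
  "y_poly = poly_eval pscal (\<lambda>i. pgen (Hy i))"

interpretation y_poly: poly_evaluation pscal "\<lambda>i. pgen (Hy i)"
  rewrites "poly_eval pscal (\<lambda>i. pgen (Hy i)) = y_poly"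
  by (intro poly_evaluation.intro scalars_pscal, unfold_locales)
    (simp_all add: pscal_central[of _ "pgen (Hy i)" for i] Hy_commute y_poly_def)

lemma Hc_y_poly: "pgen (Hc j) * y_poly f = y_poly f * pgen (Hc j)"
proof (induction f rule: cpoly_induct)
  case (mult f g)
  then show ?case by simp (metis mult.assoc)
qed (simp_all add: pscal_central Hy_Hc algebra_simps)

lemma Hw_y_poly: "pgen (Hw w) * y_poly f = y_poly (poly_act w f) * pgen (Hw w)"
proof (induction f rule: cpoly_induct)
  case (var i)
  show ?case using sgn_at_cases[of w i] by (auto simp: Hw_Hy signed_def)
next
  case (mult f g)
  then show ?case by simp (metis mult.assoc)
qed (simp_all add: pscal_central algebra_simps)

text \<open>The Clifford factors commute with the y's, so only the group element twists the
  polynomial.\<close>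

lemma kr_y_poly: "H.kr \<epsilon> k i * y_poly f = y_poly (poly_act (wrefl \<epsilon> k i) f) * H.kr \<epsilon> k i"
proof -
  have "pm \<epsilon> (pgen (Hc k) * pgen (Hc i)) * y_poly f = y_poly f * pm \<epsilon> (pgen (Hc k) * pgen (Hc i))" for f
    by (simp add: pm_def mult.assoc Hc_y_poly) (simp add: Hc_y_poly flip: mult.assoc)
  then show ?thesis
    by (simp add: H.kr_def mult.assoc Hw_y_poly) (simp add: algebra_simps flip: mult.assoc)
qed

lemma Hx_y_poly:
  "pgen (Hx i) * y_poly f = y_poly f * pgen (Hx i) +
    (\<Sum>k\<in>UNIV - {i}. \<Sum>\<epsilon>\<in>{1, -1}. y_poly (ddiff \<epsilon> k i f) * (param * H.kr \<epsilon> k i))"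
proof (induction f rule: cpoly_induct)
  case (const z)
  show ?case by (simp add: pscal_central)
next
  case (var j)
  show ?case
  proof (cases "j = i")
    case True
    have "pgen (Hx i) * pgen (Hy i) = pgen (Hy i) * pgen (Hx i) +
        param * (\<Sum>k\<in>UNIV - {i}. \<Sum>\<epsilon>\<in>{1, -1}. H.kr \<epsilon> k i)"
      using Hy_Hx_eq[of i] by (simp only: diff_eq_eq) simp
    then show ?thesis using True by (simp add: ddiff_var sum_distrib_left distrib_left)
  next
    case False
    \<comment> \<open>Only k = j survives; there the divided difference of \<open>y_j\<close> is
      -\<epsilon>, which produces the difference of the two reflection terms.\<close>
    then have "(\<Sum>k\<in>UNIV - {i}. \<Sum>\<epsilon>\<in>{1, -1}. y_poly (ddiff \<epsilon> k i (pvar j)) * (param * H.kr \<epsilon> k i)) =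
        (\<Sum>k\<in>UNIV - {i}. if k = j then - (param * (H.kr 1 j i - H.kr (-1) j i)) else 0)"
      by (intro sum.cong) (auto simp: ddiff_var algebra_simps)
    also have "\<dots> = - (param * (H.kr 1 j i - H.kr (-1) j i))"
      using False by simp
    finally show ?thesis
      using Hy_Hx_neq[of i j] False by (simp add: diff_eq_eq)
  qed
next
  case (add f g)
  then show ?case
    by (simp add: ddiff_add distrib_left distrib_right sum.distrib)
next
  case (mult f g)
  let ?A = "UNIV - {i}" and ?E = "{1, -1 :: int}"
  have "pgen (Hx i) * y_poly (f * g) = (pgen (Hx i) * y_poly f) * y_poly g"
    by (simp add: mult.assoc)
  also have "\<dots> = y_poly f * (pgen (Hx i) * y_poly g) +
      (\<Sum>k\<in>?A. \<Sum>\<epsilon>\<in>?E. y_poly (ddiff \<epsilon> k i f) * (param * H.kr \<epsilon> k i)) * y_poly g"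
    by (simp only: mult.IH(1) distrib_right mult.assoc)
  also have "\<dots> = y_poly (f * g) * pgen (Hx i) +
      (\<Sum>k\<in>?A. \<Sum>\<epsilon>\<in>?E. y_poly f * (y_poly (ddiff \<epsilon> k i g) * (param * H.kr \<epsilon> k i)) +
        y_poly (ddiff \<epsilon> k i f) * (param * H.kr \<epsilon> k i) * y_poly g)"
    by (simp only: mult.IH(2) distrib_left mult.assoc sum_distrib_left sum_distrib_right
        sum.distrib y_poly.poly_eval_mult add.assoc)
  also have "\<dots> = y_poly (f * g) * pgen (Hx i) +
      (\<Sum>k\<in>?A. \<Sum>\<epsilon>\<in>?E. y_poly (ddiff \<epsilon> k i (f * g)) * (param * H.kr \<epsilon> k i))"
  proof (intro arg_cong2[where f = "(+)"] sum.cong refl)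
    fix k and \<epsilon> :: int assume "k \<in> ?A" "\<epsilon> \<in> ?E"
    \<comment> \<open>The Leibniz rule is used with f and g exchanged, so that the twist falls on g,
      the factor that \<open>kr\<close> has to pass.\<close>
    then have "ddiff \<epsilon> k i (f * g) = f * ddiff \<epsilon> k i g + ddiff \<epsilon> k i f * poly_act (wrefl \<epsilon> k i) g"
      using ddiff_mult[of k i \<epsilon> g f] by (simp add: mult.commute)
    moreover have "param * H.kr \<epsilon> k i * y_poly g =
        y_poly (poly_act (wrefl \<epsilon> k i) g) * (param * H.kr \<epsilon> k i)"
      by (simp only: mult.assoc kr_y_poly param_left_commute)
    ultimately show "y_poly f * (y_poly (ddiff \<epsilon> k i g) * (param * H.kr \<epsilon> k i)) +
        y_poly (ddiff \<epsilon> k i f) * (param * H.kr \<epsilon> k i) * y_poly g =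
        y_poly (ddiff \<epsilon> k i (f * g)) * (param * H.kr \<epsilon> k i)"
      by (simp add: mult.assoc distrib_right)
  qed
  finally show ?case .
qed

section \<open>The representation on \<open>\<complex>[y] \<otimes> K\<close>\<close>

text \<open>Additive endomorphisms that are linear for right multiplication by the coefficient ring.
  A type of its own makes them a ring in the sense of type classes, so that
  \<open>clifford_weyl\<close> and \<open>free_evaluation\<close> apply to operators.\<close>

typedef (overloaded) ('a, 'r) rlin =
  "{T :: ('a::monoid_add \<Rightarrow>\<^sub>0 'r::{ring,monoid_mult}) \<Rightarrow> ('a \<Rightarrow>\<^sub>0 'r).
     (\<forall>p q. T (p + q) = T p + T q) \<and>
     (\<forall>p k. T (p * Poly_Mapping.single 0 k) = T p * Poly_Mapping.single 0 k)}"
  morphisms app Abs_rlin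
  by (rule exI[of _ "\<lambda>p. p"]) simp

instantiation rlin :: (monoid_add, "{ring, monoid_mult}") "{ring, monoid_mult}"
begin

definition zero_rlin :: "('a, 'b) rlin" where "zero_rlin = Abs_rlin (\<lambda>_. 0)"
definition one_rlin :: "('a, 'b) rlin" where "one_rlin = Abs_rlin (\<lambda>p. p)"
definition plus_rlin :: "('a, 'b) rlin \<Rightarrow> ('a, 'b) rlin \<Rightarrow> ('a, 'b) rlin" where
  "plus_rlin S T = Abs_rlin (\<lambda>p. app S p + app T p)"
definition uminus_rlin :: "('a, 'b) rlin \<Rightarrow> ('a, 'b) rlin" where
  "uminus_rlin S = Abs_rlin (\<lambda>p. - app S p)"
definition minus_rlin :: "('a, 'b) rlin \<Rightarrow> ('a, 'b) rlin \<Rightarrow> ('a, 'b) rlin" where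
  "minus_rlin S T = S + - T"
definition times_rlin :: "('a, 'b) rlin \<Rightarrow> ('a, 'b) rlin \<Rightarrow> ('a, 'b) rlin" where
  "times_rlin S T = Abs_rlin (\<lambda>p. app S (app T p))"

lemma app_add_right [simp]: "app T (p + q) = app T p + app T q"
  and app_scalar_right: "app T (p * Poly_Mapping.single 0 k) = app T p * Poly_Mapping.single 0 k"
  using app[of T] by auto

lemma app_rlin_simps [simp]:
  "app 0 p = 0" "app 1 p = p" "app (S + T) p = app S p + app T p"
  "app (- S) p = - app S p" "app (S * T) p = app S (app T p)"
  "app (S - T) p = app S p - app T p"
  by (simp_all add: zero_rlin_def one_rlin_def plus_rlin_def uminus_rlin_def minus_rlin_def
      times_rlin_def Abs_rlin_inverse app_scalar_right algebra_simps)

lemma app_eqI: "(\<And>p. app S p = app T p) \<Longrightarrow> S = T"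
  by (simp add: app_inject[symmetric] fun_eq_iff)

instance
  by standard (rule app_eqI; simp add: algebra_simps)+

end

lemma app_zero [simp]: "app T 0 = 0"
  using app_add_right[of T 0 0] by simp

lemma app_minus [simp]: "app T (- p) = - app T p"
  using app_add_right[of T p "- p"] by (simp add: eq_neg_iff_add_eq_0 add.commute)

lemma app_sum_right: "app T (sum f A) = (\<Sum>x\<in>A. app T (f x))"
  by (induction A rule: infinite_finite_induct) simp_all

lemma app_sum_left: "app (sum S A) p = (\<Sum>x\<in>A. app (S x) p)"
  by (induction A rule: infinite_finite_induct) simp_all

definition lmul :: "('a::monoid_add \<Rightarrow>\<^sub>0 'r::{ring,monoid_mult}) \<Rightarrow> ('a, 'r) rlin" where
  "lmul p = Abs_rlin (\<lambda>q. p * q)"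

lemma app_lmul [simp]: "app (lmul p) q = p * q"
  by (simp add: lmul_def Abs_rlin_inverse algebra_simps)

definition rext :: "('a \<Rightarrow> ('a::monoid_add \<Rightarrow>\<^sub>0 'r::{ring,monoid_mult})) \<Rightarrow> ('a, 'r) rlin" where
  "rext L = Abs_rlin (lin_ext (\<lambda>e k. L e * Poly_Mapping.single 0 k))"

lemma app_rext: "app (rext L) = lin_ext (\<lambda>e k. L e * Poly_Mapping.single 0 k)"
proof -
  let ?T = "lin_ext (\<lambda>e k. L e * Poly_Mapping.single 0 k)"
  have add: "?T (p + q) = ?T p + ?T q" for p q
    by (rule lin_ext_add) (simp_all add: single_add algebra_simps)
  have "?T (p * Poly_Mapping.single 0 k) = ?T p * Poly_Mapping.single 0 k" for p k
  proof (induction p rule: poly_mapping_add_induct)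
    case (single w z)
    show ?case by (simp add: mult_single lin_ext_single mult.assoc)
  qed (simp only: distrib_right add)
  with add show ?thesis by (simp add: rext_def Abs_rlin_inverse)
qed

lemma app_rext_single:
  "app (rext L) (Poly_Mapping.single e k) = L e * Poly_Mapping.single 0 k"
  by (simp add: app_rext lin_ext_single)

text \<open>\<complex>[y] \<otimes> K is encoded as polynomials with coefficients in K; the y's
  commute with the coefficients, and right multiplication by constants is the right action of
  K.\<close>

type_synonym 'n kalg = "'n K_gen palg"
type_synonym 'n kpoly = "('n \<Rightarrow>\<^sub>0 nat) \<Rightarrow>\<^sub>0 'n kalg"
type_synonym 'n kend = "('n \<Rightarrow>\<^sub>0 nat, 'n kalg) rlin"

interpretation pscal: scalars "pscal :: complex \<Rightarrow> 'g::presentation palg"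
  by (rule scalars_pscal)

definition kembed :: "'n::finite cpoly \<Rightarrow> 'n kpoly" where
  "kembed = lin_ext (\<lambda>e z. Poly_Mapping.single e (pscal z))"

lemma kembed_single: "kembed (Poly_Mapping.single e z) = Poly_Mapping.single e (pscal z)"
  by (simp add: kembed_def lin_ext_single)

lemma kembed_add [simp]: "kembed (f + g) = kembed f + kembed g"
  unfolding kembed_def by (rule lin_ext_add) (simp_all add: pscal.sc_add single_add)

lemma kembed_central: "kembed f * p = p * kembed f"
proof (induction f rule: poly_mapping_add_induct)
  case (single e z)
  show ?case
    by (induction p rule: poly_mapping_add_induct)
      (simp_all add: kembed_single mult_single pscal_central[of z] algebra_simps)
qed (simp add: algebra_simps)

lemma kembed_mult [simp]: "kembed (f * g) = kembed f * kembed g"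
proof (induction f rule: poly_mapping_add_induct)
  case (single e z)
  show ?case
    by (induction g rule: poly_mapping_add_induct)
      (simp_all only: mult_single distrib_left kembed_add kembed_single pscal.sc_mult)
qed (simp only: distrib_right kembed_add)

lemma kembed_pconst: "kembed (pconst z) = Poly_Mapping.single 0 (pscal z)"
  by (simp add: pconst_def kembed_single)

lemma kembed_zero [simp]: "kembed 0 = 0"
  using kembed_pconst[of 0] by simp

lemma kembed_minus [simp]: "kembed (- f) = - kembed f"
  using kembed_add[of f "- f"] by (simp add: eq_neg_iff_add_eq_0 add.commute)

definition tens :: "'n::finite cpoly \<Rightarrow> 'n kalg \<Rightarrow> 'n kpoly" where
  "tens f k = kembed f * Poly_Mapping.single 0 k"

lemma tens_add_left: "tens (f + g) k = tens f k + tens g k"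
  and tens_add_right: "tens f (k + l) = tens f k + tens f l"
  and tens_minus_left [simp]: "tens (- f) k = - tens f k"
  and tens_minus_right [simp]: "tens f (- k) = - tens f k"
  and tens_zero [simp]: "tens 0 k = 0"
  by (simp_all add: tens_def single_add single_uminus algebra_simps)

lemma tens_pconst: "tens (pconst z * f) k = tens f (pscal z * k)"
  unfolding tens_def kembed_mult kembed_pconst kembed_central[of f, symmetric]
  by (simp add: mult.assoc mult_single)

lemma tens_scalar_right: "tens f k * Poly_Mapping.single 0 l = tens f (k * l)"
  by (simp add: tens_def mult.assoc mult_single)

lemma kembed_tens: "kembed f * tens g k = tens (f * g) k"
  by (simp add: tens_def mult.assoc)

lemma single_tens: "Poly_Mapping.single 0 l * tens g k = tens g (l * k)"
  by (simp add: tens_def mult_single flip: mult.assoc kembed_central)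
    (simp add: mult.assoc mult_single)

lemma single_eq_tens: "Poly_Mapping.single e k = tens (Poly_Mapping.single e 1) k"
  by (simp add: tens_def kembed_single mult_single)

lemma rlin_eqI:
  assumes "\<And>f k. app S (tens f k) = app T (tens f k)"
  shows "S = T"
proof (rule app_eqI)
  show "app S p = app T p" for p
    by (induction p rule: poly_mapping_add_induct) (simp_all add: single_eq_tens assms)
qed

text \<open>\<open>rext\<close> prescribes values on monomials only; \<complex>-linearity of L
  extends the formula to every polynomial.\<close>

lemma app_rext_tens:
  assumes "\<And>f g. L (f + g) = L f + L g"
    and "\<And>z f. L (pconst z * f) = kembed (pconst z) * L f"
  shows "app (rext (\<lambda>e. L (Poly_Mapping.single e 1))) (tens f k) = L f * Poly_Mapping.single 0 k"
proof (induction f rule: poly_mapping_add_induct)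
  case (single e z)
  have "pconst z * Poly_Mapping.single e 1 = Poly_Mapping.single e z"
    by (simp add: pconst_def mult_single)
  then have "L (Poly_Mapping.single e z) = L (Poly_Mapping.single e 1) * Poly_Mapping.single 0 (pscal z)"
    using assms(2)[of z "Poly_Mapping.single e 1"] by (simp add: kembed_central[of "pconst z", unfolded kembed_pconst] kembed_pconst)
  then show ?case
    by (simp add: tens_def kembed_single mult_single app_rext_single mult.assoc)
qed (simp add: tens_add_left assms(1) distrib_right)

section \<open>Operators representing the generators\<close>

definition Cop :: "'n::finite \<Rightarrow> 'n kend" where
  "Cop i = lmul (Poly_Mapping.single 0 (pgen (Kc i)))"

definition Yop :: "'n::finite \<Rightarrow> 'n kend" where
  "Yop i = lmul (kembed (pvar i))"

definition Sop :: "complex \<Rightarrow> 'n::finite kend" where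
  "Sop z = lmul (Poly_Mapping.single 0 (pscal z))"

definition Wop :: "'n::finite weyl_D \<Rightarrow> 'n kend" where
  "Wop w = rext (\<lambda>e. tens (poly_act w (Poly_Mapping.single e 1)) (pgen (Kw w)))"

text \<open>The right-hand side of the asserted formula for the module K, applied to f \<otimes> 1
  with f a monomial.\<close>

definition Xop :: "complex \<Rightarrow> 'n::finite \<Rightarrow> 'n kend" where
  "Xop u i = rext (\<lambda>e. \<Sum>k\<in>UNIV - {i}. \<Sum>\<epsilon>\<in>{1, -1}.
     tens (pconst u * ddiff \<epsilon> k i (Poly_Mapping.single e 1)) (K.kr \<epsilon> k i))"

lemma Cop_tens: "app (Cop i) (tens f k) = tens f (pgen (Kc i) * k)"
  by (simp add: Cop_def single_tens)

lemma Yop_tens: "app (Yop i) (tens f k) = tens (pvar i * f) k"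
  by (simp add: Yop_def kembed_tens)

lemma Sop_tens: "app (Sop z) (tens f k) = tens (pconst z * f) k"
  by (simp add: Sop_def single_tens tens_pconst)

lemma Wop_tens: "app (Wop w) (tens f k) = tens (poly_act w f) (pgen (Kw w) * k)"
proof -
  have "app (Wop w) (tens f k) = tens (poly_act w f) (pgen (Kw w)) * Poly_Mapping.single 0 k"
    unfolding Wop_def by (rule app_rext_tens) (simp_all add: tens_add_left flip: kembed_tens)
  then show ?thesis by (simp add: tens_scalar_right)
qed

lemma Xop_tens: "app (Xop u i) (tens f m) =
  (\<Sum>k\<in>UNIV - {i}. \<Sum>\<epsilon>\<in>{1, -1}. tens (pconst u * ddiff \<epsilon> k i f) (K.kr \<epsilon> k i * m))"
proof -
  let ?L = "\<lambda>f. \<Sum>k\<in>UNIV - {i}. \<Sum>\<epsilon>\<in>{1, -1}. tens (pconst u * ddiff \<epsilon> k i f) (K.kr \<epsilon> k i)"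
  have "app (Xop u i) (tens f m) = ?L f * Poly_Mapping.single 0 m"
    unfolding Xop_def
  proof (rule app_rext_tens)
    show "?L (f + g) = ?L f + ?L g" for f g
      by (simp add: ddiff_add distrib_left tens_add_left flip: sum.distrib)
         (rule sum.cong; simp add: ddiff_add distrib_left tens_add_left algebra_simps)
    show "?L (pconst z * f) = kembed (pconst z) * ?L f" for z f
      by (simp only: sum_distrib_left kembed_tens)
        (intro sum.cong refl, simp add: ddiff_const_mult mult.left_commute)
  qed
  then show ?thesis
    by (simp only: sum_distrib_right tens_scalar_right)
qed

lemmas op_tens = Cop_tens Yop_tens Sop_tens Wop_tens

section \<open>The defining relations for the operators\<close>

interpretation E: clifford_weyl Cop Wop
proof
  fix i j :: "'n::finite" and v w :: "'n weyl_D"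
  show "Cop i * Cop i = 1"
    by (rule rlin_eqI) (simp add: op_tens K.c_cancel)
  show "Cop i * Cop j = - (Cop j * Cop i)" if "i \<noteq> j"
    by (rule rlin_eqI) (simp add: op_tens K.c_swap[OF that])
  show "Wop (1 :: 'n weyl_D) = 1"
    by (rule rlin_eqI) (simp add: op_tens K.g_one)
  show "Wop v * Wop w = Wop (v * w)"
    by (rule rlin_eqI) (simp add: op_tens poly_act_act K.g_mult flip: mult.assoc)
  show "Wop w * Cop i = pm (sgn_at w i) (Cop (perm w i)) * Wop w"
    by (rule rlin_eqI)
      (use sgn_at_cases[of w i] in \<open>auto simp: op_tens K.g_c simp flip: mult.assoc\<close>)
qed

lemma Sop_scalars: "scalars (Sop :: complex \<Rightarrow> 'n::finite kend)"
  by unfold_locales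
    (rule rlin_eqI; simp add: op_tens pconst_add pconst_mult tens_add_left distrib_right mult.assoc)+

text \<open>A scalar may be moved into the K-factor and then, being central there, to its right,
  where every right-linear operator commutes with it.\<close>

lemma Sop_central: "Sop z * T = T * Sop z"
proof (rule rlin_eqI)
  fix f k
  have "app T (tens (pconst z * f) k) = app T (tens f k * Poly_Mapping.single 0 (pscal z))"
    by (simp add: tens_scalar_right tens_pconst pscal_central)
  also have "\<dots> = Poly_Mapping.single 0 (pscal z) * app T (tens f k)"
    unfolding app_scalar_right by (rule kembed_central[of "pconst z", unfolded kembed_pconst, symmetric])
  finally show "app (Sop z * T) (tens f k) = app (T * Sop z) (tens f k)"
    by (simp add: op_tens) (simp add: Sop_def)
qed

lemma Yop_commute: "Yop i * Yop j = Yop j * Yop i"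
  by (rule rlin_eqI) (simp add: op_tens mult.left_commute)

lemma Yop_Cop: "Yop i * Cop j = Cop j * Yop i"
  by (rule rlin_eqI) (simp add: op_tens)

lemma Wop_Yop: "Wop w * Yop i = pm (sgn_at w i) (Yop (perm w i)) * Wop w"
  by (rule rlin_eqI) (use sgn_at_cases[of w i] in \<open>auto simp: op_tens signed_def\<close>)

lemma kr_tens:
  assumes "\<epsilon> \<in> {1, -1}"
  shows "app (E.kr \<epsilon> k i) (tens f m) = tens (poly_act (wrefl \<epsilon> k i) f) (K.kr \<epsilon> k i * m)"
  using assms
  by (auto simp: E.kr_def K.kr_def op_tens tens_add_right distrib_right mult.assoc
      left_diff_distrib simp flip: diff_conv_add_uminus)

lemma Xop_Cop: "Xop u i * Cop i = - (Cop i * Xop u i)"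
proof (rule rlin_eqI)
  fix f m
  have "K.kr \<epsilon> k i * (pgen (Kc i) * m) = - (pgen (Kc i) * (K.kr \<epsilon> k i * m))"
    if "k \<noteq> i" "\<epsilon> \<in> {1, -1}" for k \<epsilon>
    using K.kr_c_right[OF that] by (simp flip: mult.assoc)
  then show "app (Xop u i * Cop i) (tens f m) = app (- (Cop i * Xop u i)) (tens f m)"
    by (simp add: op_tens Xop_tens app_sum_right sum_negf[symmetric] del: sum.insert)
qed

lemma Xop_Cop_other:
  assumes "i \<noteq> j"
  shows "Xop u i * Cop j = Cop j * Xop u i"
proof (rule rlin_eqI)
  fix f m
  have "K.kr \<epsilon> k i * (pgen (Kc j) * m) = pgen (Kc j) * (K.kr \<epsilon> k i * m)"
    if "k \<noteq> i" "\<epsilon> \<in> {1, -1}" for k \<epsilon>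
    using K.kr_c_other[OF that assms[symmetric]] by (simp flip: mult.assoc)
  then show "app (Xop u i * Cop j) (tens f m) = app (Cop j * Xop u i) (tens f m)"
    by (simp add: op_tens Xop_tens app_sum_right)
qed

text \<open>Each summand is transported by \<open>poly_act_ddiff\<close> and \<open>g_kr\<close>.
  The resulting index changes, \<epsilon> to \<open>\<epsilon> * sgn_at w k * sgn_at w i\<close> for
  fixed k and k to \<open>perm w k\<close>, only permute the double sum.\<close>

lemma Wop_Xop: "Wop w * Xop u i = pm (sgn_at w i) (Xop u (perm w i)) * Wop w"
proof (rule rlin_eqI)
  fix f m
  let ?p = "perm w" and ?s = "sgn_at w"
  define F where "F \<epsilon> k = tens (pconst u * ddiff \<epsilon> k (?p i) (poly_act w f))
    (K.kr \<epsilon> k (?p i) * (pgen (Kw w) * m))" for \<epsilon> k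
  have tens_pm: "tens (of_int (?s i) * h) k = pm (?s i) (tens h k)" for h k
    using sgn_at_cases[of w i] by auto
  have "app (Wop w) (tens (pconst u * ddiff \<epsilon> k i f) (K.kr \<epsilon> k i * m)) =
      pm (?s i) (F (\<epsilon> * ?s k * ?s i) (?p k))" if "k \<noteq> i" "\<epsilon> \<in> {1, -1}" for k \<epsilon>
    by (simp add: op_tens F_def poly_act_ddiff[OF that] mult.left_commute[of "pconst u"] tens_pm)
      (simp add: K.g_kr[OF that] flip: mult.assoc)
  then have "app (Wop w * Xop u i) (tens f m) =
      (\<Sum>k\<in>UNIV - {i}. \<Sum>\<epsilon>\<in>{1, -1}. pm (?s i) (F (\<epsilon> * ?s k * ?s i) (?p k)))"
    by (simp add: Xop_tens app_sum_right)
  also have "\<dots> = (\<Sum>k\<in>UNIV - {i}. \<Sum>\<epsilon>\<in>{1, -1}. pm (?s i) (F \<epsilon> (?p k)))"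
  proof (rule sum.cong[OF refl])
    show "(\<Sum>\<epsilon>\<in>{1, -1}. pm (?s i) (F (\<epsilon> * ?s k * ?s i) (?p k))) =
        (\<Sum>\<epsilon>\<in>{1, -1}. pm (?s i) (F \<epsilon> (?p k)))" for k
      using sgn_at_cases[of w i] sgn_at_cases[of w k] by (auto simp: add.commute)
  qed
  also have "\<dots> = (\<Sum>k\<in>UNIV - {?p i}. \<Sum>\<epsilon>\<in>{1, -1}. pm (?s i) (F \<epsilon> k))"
  proof (rule sum.reindex_bij_betw)
    have "bij_betw ?p (UNIV - {i}) (?p ` (UNIV - {i}))"
      using bij_perm[of w] by (simp add: inj_on_imp_bij_betw bij_is_inj inj_on_subset[of _ UNIV])
    then show "bij_betw ?p (UNIV - {i}) (UNIV - {?p i})"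
      using bij_perm[of w] by (simp add: image_set_diff bij_is_inj bij_is_surj)
  qed
  also have "\<dots> = app (pm (?s i) (Xop u (?p i)) * Wop w) (tens f m)"
    using sgn_at_cases[of w i] by (auto simp: op_tens Xop_tens F_def sum_negf sum.distrib sum_subtractf)
  finally show "app (Wop w * Xop u i) (tens f m) = app (pm (?s i) (Xop u (?p i)) * Wop w) (tens f m)" .
qed

text \<open>In the Leibniz rule for \<open>f * y_j\<close> the extra term is the reflected f times
  the divided difference of \<open>y_j\<close>, that is, \<open>E.kr\<close> applied to f \<otimes>
  m with coefficient 1, -\<epsilon> or 0 according to j = i, j = k or neither. One formula thus
  covers both commutator relations.\<close>

lemma Yop_Xop:
  "Yop j * Xop u i - Xop u i * Yop j =
    - (Sop u * (\<Sum>k\<in>UNIV - {i}. \<Sum>\<epsilon>\<in>{1, -1}.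
        if j = i then E.kr \<epsilon> k i else if j = k then - pm \<epsilon> (E.kr \<epsilon> k i) else 0))"
proof (rule rlin_eqI)
  fix f m
  have "tens (pvar j * (pconst u * ddiff \<epsilon> k i f)) (K.kr \<epsilon> k i * m) -
      tens (pconst u * ddiff \<epsilon> k i (pvar j * f)) (K.kr \<epsilon> k i * m) =
      - app (Sop u) (app (if j = i then E.kr \<epsilon> k i else if j = k then - pm \<epsilon> (E.kr \<epsilon> k i) else 0) (tens f m))"
    if "k \<noteq> i" "\<epsilon> \<in> {1, -1}" for k \<epsilon>
  proof -
    have "ddiff \<epsilon> k i (pvar j * f) =
        pvar j * ddiff \<epsilon> k i f + poly_act (wrefl \<epsilon> k i) f * ddiff \<epsilon> k i (pvar j)"
      using ddiff_mult[OF that, of f "pvar j"] by (simp add: mult.commute)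
    then have "pvar j * (pconst u * ddiff \<epsilon> k i f) - pconst u * ddiff \<epsilon> k i (pvar j * f) =
        - (pconst u * (poly_act (wrefl \<epsilon> k i) f * ddiff \<epsilon> k i (pvar j)))"
      by (simp add: algebra_simps)
    then have "tens (pvar j * (pconst u * ddiff \<epsilon> k i f)) (K.kr \<epsilon> k i * m) -
      tens (pconst u * ddiff \<epsilon> k i (pvar j * f)) (K.kr \<epsilon> k i * m) =
      - tens (pconst u * (poly_act (wrefl \<epsilon> k i) f * ddiff \<epsilon> k i (pvar j))) (K.kr \<epsilon> k i * m)"
      by (metis tens_minus_left tens_add_left diff_conv_add_uminus)
    also have "\<dots> = - app (Sop u) (app (if j = i then E.kr \<epsilon> k i else if j = k then - pm \<epsilon> (E.kr \<epsilon> k i) else 0) (tens f m))"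
      using that by (auto simp: ddiff_var[OF that] kr_tens op_tens)
    finally show ?thesis .
  qed
  then have "(\<Sum>k\<in>UNIV - {i}. \<Sum>\<epsilon>\<in>{1, -1}. tens (pvar j * (pconst u * ddiff \<epsilon> k i f)) (K.kr \<epsilon> k i * m) -
      tens (pconst u * ddiff \<epsilon> k i (pvar j * f)) (K.kr \<epsilon> k i * m)) =
      (\<Sum>k\<in>UNIV - {i}. \<Sum>\<epsilon>\<in>{1, -1}. - app (Sop u) (app (if j = i then E.kr \<epsilon> k i else if j = k then - pm \<epsilon> (E.kr \<epsilon> k i) else 0) (tens f m)))"
    by (intro sum.cong refl) auto
  then show "app (Yop j * Xop u i - Xop u i * Yop j) (tens f m) =
      app (- (Sop u * (\<Sum>k\<in>UNIV - {i}. \<Sum>\<epsilon>\<in>{1, -1}.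
        if j = i then E.kr \<epsilon> k i else if j = k then - pm \<epsilon> (E.kr \<epsilon> k i) else 0))) (tens f m)"
    by (simp only: app_rlin_simps Xop_tens op_tens app_sum_right app_sum_left sum_subtractf sum_negf)
qed

lemma Yop_Xop_eq:
  "Yop i * Xop u i - Xop u i * Yop i =
    - (Sop u * (\<Sum>k\<in>UNIV - {i}. \<Sum>\<epsilon>\<in>{1, -1}. E.kr \<epsilon> k i))"
  using Yop_Xop[of i u i] by simp

lemma Yop_Xop_neq:
  assumes "i \<noteq> j"
  shows "Yop j * Xop u i - Xop u i * Yop j = Sop u * (E.kr 1 j i - E.kr (-1) j i)"
proof -
  have "(\<Sum>k\<in>UNIV - {i}. \<Sum>\<epsilon>\<in>{1, -1}.
        if j = i then E.kr \<epsilon> k i else if j = k then - pm \<epsilon> (E.kr \<epsilon> k i) else 0) =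
      (\<Sum>k\<in>UNIV - {i}. if k = j then - (E.kr 1 j i - E.kr (-1) j i) else 0)"
    using assms by (intro sum.cong) auto
  also have "\<dots> = - (E.kr 1 j i - E.kr (-1) j i)"
    using assms by simp
  finally show ?thesis
    unfolding Yop_Xop by (simp add: right_diff_distrib)
qed

text \<open>The reflection fixes the index i, and \<open>Xop u i\<close> commutes with each of the
  two Clifford factors, whose indices differ from i.\<close>

lemma Xop_kr_other:
  assumes "i \<noteq> k" "i \<noteq> j" "k \<noteq> j" "\<epsilon> \<in> {1, -1}"
  shows "Xop u i * E.kr \<epsilon> k j = E.kr \<epsilon> k j * Xop u i"
proof -
  have W: "Wop (wrefl \<epsilon> k j) * Xop u i = Xop u i * Wop (wrefl \<epsilon> k j)"
    using assms by (simp add: Wop_Xop perm_wrefl sgn_at_wrefl transpose_apply_other)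
  have C: "pm \<epsilon> (Cop k * Cop j) * Xop u i = Xop u i * pm \<epsilon> (Cop k * Cop j)"
  proof -
    have "Cop k * (Xop u i * Cop j) = Xop u i * (Cop k * Cop j)"
      unfolding mult.assoc[symmetric] Xop_Cop_other[OF assms(1), symmetric] ..
    then show ?thesis
      using assms by (simp add: pm_def mult.assoc Xop_Cop_other[symmetric])
  qed
  then show ?thesis
    by (simp add: E.kr_def mult.assoc W) (simp add: algebra_simps flip: mult.assoc)
qed

text \<open>The Jacobi identity that makes \<open>[x\<^sub>i, x\<^sub>j]\<close> commute with \<open>y\<^sub>i\<close>.\<close>

lemma Xop_kr:
  assumes "i \<noteq> j" "\<epsilon> \<in> {1, -1}"
  shows "pm \<epsilon> (Xop u i * E.kr \<epsilon> i j - E.kr \<epsilon> i j * Xop u i) =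
    E.kr \<epsilon> j i * Xop u j - Xop u j * E.kr \<epsilon> j i"
proof -
  \<comment> \<open>The commutator with the X-operators collected on the left. Exchanging i and j in
    this expression is multiplication by -\<epsilon>, because \<open>c_i c_j\<close> changes sign
    and \<epsilon> squares to 1; this is the claim.\<close>
  have *: "Xop u i * E.kr \<epsilon> i j - E.kr \<epsilon> i j * Xop u i =
      (Xop u i - pm \<epsilon> (Xop u j) + (pm \<epsilon> (Xop u i) + Xop u j) * (Cop i * Cop j)) * Wop (wrefl \<epsilon> i j)"
    if "i \<noteq> j" for i j
  proof -
    have "Cop i * (Cop j * Xop u j) = - (Xop u j * (Cop i * Cop j))"
    proof -
      have "Cop j * Xop u j = - (Xop u j * Cop j)" by (simp add: Xop_Cop)
      then show ?thesis
        using Xop_Cop_other[of j i u] that by (simp flip: mult.assoc)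
    qed
    moreover have "Wop (wrefl \<epsilon> i j) * Xop u i = pm \<epsilon> (Xop u j) * Wop (wrefl \<epsilon> i j)"
      using that assms(2) by (simp add: Wop_Xop perm_wrefl sgn_at_wrefl)
    ultimately have "E.kr \<epsilon> i j * Xop u i =
        (pm \<epsilon> (Xop u j) - Xop u j * (Cop i * Cop j)) * Wop (wrefl \<epsilon> i j)"
      using assms(2) unfolding E.kr_def mult.assoc
      by (auto simp: algebra_simps simp flip: mult.assoc)
    then show ?thesis
      using assms(2) by (auto simp: E.kr_def algebra_simps)
  qed
  have "pm \<epsilon> (Xop u i * E.kr \<epsilon> i j - E.kr \<epsilon> i j * Xop u i) =
      - (Xop u j * E.kr \<epsilon> j i - E.kr \<epsilon> j i * Xop u j)"
    unfolding *[OF assms(1)] *[OF assms(1)[symmetric]] E.c_anti[OF assms(1)] wrefl_commute[of _ j i]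
    using assms(2) by (auto simp: algebra_simps)
  then show ?thesis by simp
qed

lemma Yop_Xop_Xop:
  fixes i j k :: "'n::finite"
  shows "Yop k * (Xop u i * Xop u j - Xop u j * Xop u i) = (Xop u i * Xop u j - Xop u j * Xop u i) * Yop k"
proof -
  define D where "D k i = Yop k * Xop u i - Xop u i * Yop k" for k i :: 'n
  \<comment> \<open>The Jacobi identity for \<open>y_k\<close>, \<open>x_i\<close>,
    \<open>x_j\<close>, with \<open>D k i\<close> standing for the commutator of \<open>y_k\<close>
    and \<open>x_i\<close>.\<close>
  have expand: "Yop k * (Xop u i * Xop u j - Xop u j * Xop u i) -
      (Xop u i * Xop u j - Xop u j * Xop u i) * Yop k =
      (Xop u i * D k j - D k j * Xop u i) - (Xop u j * D k i - D k i * Xop u j)" for k i j :: 'n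
    unfolding D_def by (simp add: algebra_simps)
  have U: "Sop u * (a * b) = a * (Sop u * b)" for a b :: "'n kend"
    by (simp add: Sop_central[of u a] flip: mult.assoc)
  \<comment> \<open>If k differs from i and j, \<open>D k j\<close> involves only reflections in the
    indices k and j, which \<open>x_i\<close> does not see.\<close>
  have other: "Xop u i * D k j = D k j * Xop u i" if "k \<noteq> j" "k \<noteq> i" "i \<noteq> j" for i j k :: 'n
  proof -
    have "Xop u i * (E.kr 1 k j - E.kr (-1) k j) = (E.kr 1 k j - E.kr (-1) k j) * Xop u i"
      using that by (simp add: algebra_simps Xop_kr_other)
    then show ?thesis
      using that unfolding D_def by (simp add: Yop_Xop_neq mult.assoc U[symmetric])
  qed
  \<comment> \<open>For k = i the sum in \<open>D i i\<close> runs over all reflections involving i,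
    but only the terms with index j fail to commute with \<open>x_j\<close>. Their contribution is
    compared with \<open>D i j\<close> by \<open>Xop_kr\<close> for both signs.\<close>
  have same: "Xop u i * D i j - D i j * Xop u i = Xop u j * D i i - D i i * Xop u j" if "i \<noteq> j" for i j :: 'n
  proof -
    let ?K = "\<lambda>k. \<Sum>\<epsilon>\<in>{1, -1}. E.kr \<epsilon> k i"
    have "Xop u j * (\<Sum>k\<in>UNIV - {i}. ?K k) - (\<Sum>k\<in>UNIV - {i}. ?K k) * Xop u j =
        (\<Sum>k\<in>UNIV - {i}. Xop u j * ?K k - ?K k * Xop u j)"
      by (simp only: sum_distrib_left sum_distrib_right sum_subtractf)
    also have "\<dots> = (\<Sum>k\<in>UNIV - {i}. if k = j then Xop u j * ?K j - ?K j * Xop u j else 0)"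
      using that by (intro sum.cong) (auto simp: Xop_kr_other algebra_simps)
    also have "\<dots> = Xop u j * ?K j - ?K j * Xop u j"
      using that by simp
    also have "\<dots> = - (Xop u i * (E.kr 1 i j - E.kr (-1) i j) - (E.kr 1 i j - E.kr (-1) i j) * Xop u i)"
      using Xop_kr[OF that, of 1 u] Xop_kr[OF that, of "-1" u] by (simp add: algebra_simps)
    finally have "Xop u j * (\<Sum>k\<in>UNIV - {i}. ?K k) - (\<Sum>k\<in>UNIV - {i}. ?K k) * Xop u j =
        - (Xop u i * (E.kr 1 i j - E.kr (-1) i j) - (E.kr 1 i j - E.kr (-1) i j) * Xop u i)" .
    then have "Sop u * (Xop u i * (E.kr 1 i j - E.kr (-1) i j) - (E.kr 1 i j - E.kr (-1) i j) * Xop u i) =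
        - (Sop u * (Xop u j * (\<Sum>k\<in>UNIV - {i}. ?K k) - (\<Sum>k\<in>UNIV - {i}. ?K k) * Xop u j))"
      by (simp only: mult_minus_right minus_minus)
    then show ?thesis
      using that unfolding D_def Yop_Xop_eq
      by (simp only: Yop_Xop_neq[OF that[symmetric]] right_diff_distrib left_diff_distrib U[symmetric]
          mult.assoc mult_minus_left mult_minus_right) simp
  qed
  consider "i = j" | "i \<noteq> j" "k \<noteq> i" "k \<noteq> j" | "i \<noteq> j" "k = i" | "i \<noteq> j" "k = j" by blast
  then have "(Xop u i * D k j - D k j * Xop u i) - (Xop u j * D k i - D k i * Xop u j) = 0"
  proof cases
    case 3
    then show ?thesis using same[of i j] by simp
  next
    case 4
    then show ?thesis using same[of j i] by simp
  qed (simp_all add: other)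
  then show ?thesis
    using expand[of k i j] by simp
qed

lemma Xop_one: "app (Xop u i) (tens 1 m) = 0"
proof -
  have "ddiff \<epsilon> k i 1 = 0" if "k \<noteq> i" "\<epsilon> \<in> {1, -1}" for \<epsilon> k
    using ddiff_const[OF that, of 1] by simp
  then show ?thesis by (simp add: Xop_tens)
qed

text \<open>The commutator commutes with all \<open>y\<^sub>k\<close> and kills the constants.\<close>

lemma Xop_commute: "Xop u i * Xop u j = Xop u j * Xop u i"
proof -
  define Z where "Z = Xop u i * Xop u j - Xop u j * Xop u i"
  have "app Z (tens g m) = 0 \<Longrightarrow> app Z (tens (f * g) m) = 0" for f g m
  proof (induction f arbitrary: g rule: cpoly_induct)
    case (const z)
    have "app Z (tens (pconst z * g) m) = app (Z * Sop z) (tens g m)"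
      by (simp add: op_tens)
    also have "\<dots> = app (Sop z) (app Z (tens g m))"
      by (simp flip: Sop_central)
    finally show ?case by (simp add: const)
  next
    case (var k)
    have "app Z (tens (pvar k * g) m) = app (Z * Yop k) (tens g m)"
      by (simp add: op_tens)
    also have "\<dots> = app (Yop k) (app Z (tens g m))"
      unfolding Z_def by (simp flip: Yop_Xop_Xop)
    finally show ?case by (simp add: var)
  qed (simp_all add: distrib_right tens_add_left mult.assoc)
  from this[of 1] have "app Z (tens f m) = 0" for f m
    by (simp add: Z_def Xop_one)
  then have "Z = 0"
    by (intro rlin_eqI) simp
  then show ?thesis by (simp add: Z_def)
qed

section \<open>The representation of the whole algebra\<close>

definition H_gen_op :: "complex \<Rightarrow> 'n::finite H_gen \<Rightarrow> 'n kend" where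
  "H_gen_op u h = (case h of Hx i \<Rightarrow> Xop u i | Hy i \<Rightarrow> Yop i | Hc i \<Rightarrow> Cop i | Hw w \<Rightarrow> Wop w)"

lemma H_gen_op_simps [simp]:
  "H_gen_op u (Hx i) = Xop u i" "H_gen_op u (Hy i) = Yop i"
  "H_gen_op u (Hc i) = Cop i" "H_gen_op u (Hw w) = Wop w"
  by (simp_all add: H_gen_op_def)

definition Theta :: "complex \<Rightarrow> 'n::finite H_gen free_alg \<Rightarrow> 'n kend" where
  "Theta u = free_eval Sop (H_gen_op u)"

interpretation Theta: free_evaluation Sop "H_gen_op u"
  rewrites "free_eval Sop (H_gen_op u) = Theta u" for u
  by (intro free_evaluation.intro Sop_scalars, unfold_locales)
    (simp_all add: Sop_central Theta_def)

lemma Theta_signed: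
  "Theta u (signed w (\<lambda>i. gen (G i)) i) = pm (sgn_at w i) (H_gen_op u (G (perm w i)))"
  using sgn_at_cases[of w i] by (auto simp: signed_def)

lemma Theta_relators:
  fixes r :: "'n::finite H_gen free_alg"
  assumes "r \<in> H_relators u"
  shows "Theta u r = 0"
proof -
  have conj: "Wop w * T * Wop (inverse w) = S" if "Wop w * T = S * Wop w" for w and S T :: "'n kend"
    using that by (simp add: mult.assoc E.g_mult weyl_D_inverse E.g_one)
  have anti: "Cop i * Cop j + Cop j * Cop i = 0" if "i \<noteq> j" for i j :: 'n
    using E.c_anti[OF that] by simp
  have CW: "Theta u r = 0" if "r \<in> clifford_weyl_relators (\<lambda>i. gen (Hc i)) (\<lambda>w. gen (Hw w))"
    for r :: "'n H_gen free_alg"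
    using that anti unfolding clifford_weyl_relators_def
    by (auto simp: E.c_sq E.g_one E.g_mult Theta_signed conj[OF E.g_c])
  have neq: "Theta u ((gen (Hy j) * gen (Hx i) - gen (Hx i) * gen (Hy j)) -
      scal u * ((1 + gen (Hc j) * gen (Hc i)) * gen (Hw (refl_s i j)) -
        (1 - gen (Hc j) * gen (Hc i)) * gen (Hw (refl_sbar i j)))) = 0" if "i \<noteq> j" for i j :: 'n
    using Yop_Xop_neq[OF that, of u] by (simp add: E.kr_def wrefl_commute[of _ j i]) (simp add: wrefl_def)
  have eq: "Theta u ((gen (Hy i) * gen (Hx i) - gen (Hx i) * gen (Hy i)) -
      (- scal u * (\<Sum>k\<in>UNIV - {i}. (1 + gen (Hc k) * gen (Hc i)) * gen (Hw (refl_s k i)) +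
        (1 - gen (Hc k) * gen (Hc i)) * gen (Hw (refl_sbar k i))))) = 0" for i :: 'n
    using Yop_Xop_eq[of i u] by (simp add: E.kr_def) (simp add: wrefl_def)
  show ?thesis
    using assms CW neq eq unfolding H_relators_def Let_def
    by (elim UnE) (auto simp: Xop_commute Yop_commute Yop_Cop Xop_Cop Xop_Cop_other Theta_signed
      conj[OF Wop_Xop] conj[OF Wop_Yop])
qed

lemma Theta_cong: "in_H u p = in_H u q \<Longrightarrow> Theta u p = Theta u q"
  using Theta.free_eval_relations[of "H_relators u" u "p - q"] Theta_relators
  by (auto simp: in_H_def presented_class_eq_iff)

section \<open>The subalgebra generated by \<open>K\<close> and the \<open>x\<^sub>i\<close>\<close>

lemma H_alg_eq: "H_alg u = presented_alg (relators u)"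
  by (simp add: H_alg_def relators_H_gen_def)

lemma in_H_eq: "in_H u p = proj u (family (\<lambda>_. p))"
  by (simp add: in_H_def proj_family relators_H_gen_def)

lemma K_alg_eq: "K_alg = presented_alg (relators v)"
  by (simp add: K_alg_def relators_K_gen_def)

lemma in_K_eq: "in_K p = proj v (family (\<lambda>_. p))"
  by (simp add: in_K_def proj_family relators_K_gen_def)

lemma ring_H_alg: "ring (H_alg u)"
  by (simp add: H_alg_def ring_presented_alg)

lemma proj_in_H [simp]: "proj u a \<in> carrier (H_alg u)"
  by (simp add: H_alg_eq)

lemma proj_H:
  "proj u (a + b) = proj u a \<oplus>\<^bsub>H_alg u\<^esub> proj u b"
  "proj u (a * b) = proj u a \<otimes>\<^bsub>H_alg u\<^esub> proj u b"
  "proj u (- a) = \<ominus>\<^bsub>H_alg u\<^esub> proj u a"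
  "proj u 1 = \<one>\<^bsub>H_alg u\<^esub>" "proj u 0 = \<zero>\<^bsub>H_alg u\<^esub>"
  by (simp_all add: H_alg_eq proj_add proj_mult proj_minus proj_one proj_zero)

lemma H_alg_exhaust:
  assumes "h \<in> carrier (H_alg u)"
  obtains p where "h = in_H u p"
  using assms by (auto simp: H_alg_def in_H_def carrier_presented_alg)

lemma Hx_sub_generators:
  "in_H u ` (range scal \<union> range (\<lambda>i. gen (Hc i)) \<union> range (\<lambda>w. gen (Hw w)) \<union> range (\<lambda>i. gen (Hx i)))
    \<subseteq> carrier (H_alg u)"
  by (auto simp: in_H_eq)

lemma subring_Hx_sub: "subring (Hx_sub u) (H_alg u)"
  unfolding Hx_sub_def by (rule ring.generate_ring_is_subring[OF ring_H_alg Hx_sub_generators])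

lemma Hx_sub_carrier: "h \<in> Hx_sub u \<Longrightarrow> h \<in> carrier (H_alg u)"
  using subringE(1)[OF subring_Hx_sub] by auto

lemma Hx_sub_incl:
  "in_H u (scal z) \<in> Hx_sub u" "in_H u (gen (Hc i)) \<in> Hx_sub u"
  "in_H u (gen (Hw w)) \<in> Hx_sub u" "in_H u (gen (Hx i)) \<in> Hx_sub u"
  unfolding Hx_sub_def by (rule generate_ring.incl; blast)+

text \<open>The unit and negation cases of the generated subring are absorbed by the scalars: the
  unit is the scalar 1, and negation is multiplication by the scalar -1.\<close>

lemma Hx_sub_induct [consumes 1, case_names scal c w x add mult]:
  fixes P :: "'n::finite H_gen free_alg set \<Rightarrow> bool"
  assumes "h \<in> Hx_sub u" "\<And>z. P (in_H u (scal z))" "\<And>i. P (in_H u (gen (Hc i)))"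
    "\<And>w. P (in_H u (gen (Hw w)))" "\<And>i. P (in_H u (gen (Hx i)))"
    "\<And>h h'. h \<in> Hx_sub u \<Longrightarrow> h' \<in> Hx_sub u \<Longrightarrow> P h \<Longrightarrow> P h' \<Longrightarrow> P (h \<oplus>\<^bsub>H_alg u\<^esub> h')"
    "\<And>h h'. h \<in> Hx_sub u \<Longrightarrow> h' \<in> Hx_sub u \<Longrightarrow> P h \<Longrightarrow> P h' \<Longrightarrow> P (h \<otimes>\<^bsub>H_alg u\<^esub> h')"
  shows "P h"
  using assms(1) unfolding Hx_sub_def
proof (induction rule: generate_ring.induct)
  case one
  have "in_H u (scal 1) = (\<one>\<^bsub>H_alg u\<^esub> :: 'n H_gen free_alg set)"
    by (simp add: in_H_eq scalars.sc_one[OF scalars_scal] family_one proj_H)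
  then show ?case using assms(2)[of 1] by simp
next
  case (a_inv h)
  then have h: "h \<in> Hx_sub u" by (simp add: Hx_sub_def)
  then obtain p where p: "h = in_H u p" by (meson H_alg_exhaust Hx_sub_carrier)
  have "scal (-1) = (-1 :: 'n H_gen free_alg)"
    using scal_of_int[of "-1"] by simp
  then have "\<ominus>\<^bsub>H_alg u\<^esub> h = in_H u (scal (-1)) \<otimes>\<^bsub>H_alg u\<^esub> h"
    unfolding p in_H_eq proj_H(2,3)[symmetric] by (simp flip: family_simps)
  then show ?case using assms(7)[OF Hx_sub_incl(1) h assms(2) a_inv.IH] by simp
qed (use assms(3-7) in \<open>auto simp: Hx_sub_def intro: assms(2)\<close>)

text \<open>By \<open>Theta_cong\<close> the chosen representative is immaterial; on a set that is
  not a class the value is arbitrary.\<close>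

definition theta :: "complex \<Rightarrow> 'n::finite H_gen free_alg set \<Rightarrow> 'n kend" where
  "theta u h = Theta u (SOME p. in_H u p = h)"

lemma theta_in_H [simp]: "theta u (in_H u p) = Theta u p"
  unfolding theta_def by (rule Theta_cong) (rule someI, rule refl)

lemma theta_hom:
  assumes "h \<in> carrier (H_alg u)" "h' \<in> carrier (H_alg u)"
  shows "theta u (h \<oplus>\<^bsub>H_alg u\<^esub> h') = theta u h + theta u h'"
    and "theta u (h \<otimes>\<^bsub>H_alg u\<^esub> h') = theta u h * theta u h'"
proof -
  obtain p q where "h = in_H u p" "h' = in_H u q"
    using assms by (meson H_alg_exhaust)
  moreover have "in_H u (p + q) = in_H u p \<oplus>\<^bsub>H_alg u\<^esub> in_H u q"
    "in_H u (p * q) = in_H u p \<otimes>\<^bsub>H_alg u\<^esub> in_H u q" for p q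
    by (simp_all add: in_H_eq family_simps proj_H)
  ultimately show "theta u (h \<oplus>\<^bsub>H_alg u\<^esub> h') = theta u h + theta u h'"
    and "theta u (h \<otimes>\<^bsub>H_alg u\<^esub> h') = theta u h * theta u h'"
    by (metis theta_in_H Theta.free_eval_add, metis theta_in_H Theta.free_eval_mult)
qed

lemma theta_proj: "theta u (proj u (family p)) = Theta u (p u)"
  using theta_in_H[of u "p u"] by (simp add: in_H_eq proj_family)

lemma theta_proj_simps:
  "theta u (proj u (a + b)) = theta u (proj u a) + theta u (proj u b)"
  "theta u (proj u (a * b)) = theta u (proj u a) * theta u (proj u b)"
  "theta u (proj u (- a)) = - theta u (proj u a)"
  "theta u (proj u 1) = 1"
  "theta u (proj u (pgen x)) = H_gen_op u x"
  "theta u (proj u (pscal z)) = Sop z"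
  "theta u (proj u param) = Sop u"
  by (cases a rule: family_exhaust; cases b rule: family_exhaust;
      simp add: pgen_def pscal_def param_def theta_proj flip: family_simps)+

text \<open>
  Meaningful only if \<open>h\<close> maps \<open>1 \<otimes> 1\<close> to \<open>1 \<otimes> k\<close> with \<open>k \<in> K\<close>; then \<open>h\<close> acts on \<open>1 \<otimes> M\<close> as \<open>k\<close>.
\<close>

definition kappa :: "complex \<Rightarrow> 'n::finite H_gen free_alg set \<Rightarrow> 'n kalg" where
  "kappa u h = Poly_Mapping.lookup (app (theta u h) (tens 1 1)) 0"

lemma tens_one: "tens 1 k = Poly_Mapping.single 0 k"
proof -
  have "kembed (1 :: 'a cpoly) = Poly_Mapping.single 0 1"
    using kembed_pconst[of 1] by simp
  then show ?thesis by (simp add: tens_def mult_single)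
qed

lemma kappaI: "app (theta u h) (tens 1 1) = tens 1 k \<Longrightarrow> kappa u h = k"
  by (simp add: kappa_def tens_one)

lemma app_tens_right: "app T (tens f (k * l)) = app T (tens f k) * Poly_Mapping.single 0 l"
  by (simp add: app_scalar_right flip: tens_scalar_right)

text \<open>Right linearity reduces the claim to k = 1. There, induction over the generators shows
  that the value stays in 1 \<otimes> K, and \<open>kappaI\<close> names it.\<close>

lemma theta_Hx_sub:
  "h \<in> Hx_sub u \<Longrightarrow> app (theta u h) (tens 1 k) = tens 1 (kappa u h * k)"
proof -
  have pconst: "tens (pconst z) k = tens 1 (pscal z * k)" for z and k :: "'a kalg"
    using tens_pconst[of z 1 k] by simp
  assume "h \<in> Hx_sub u"
  then have "\<exists>l. app (theta u h) (tens 1 1) = tens 1 l"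
  proof (induction rule: Hx_sub_induct)
    case (x i)
    have "tens 1 0 = (0 :: 'a kpoly)" by (simp add: tens_one)
    then show ?case by (simp add: Xop_one) metis
  next
    case (add h h')
    then show ?case by (auto simp: theta_hom Hx_sub_carrier simp flip: tens_add_right)
  next
    case (mult h h')
    then obtain a b where a: "app (theta u h) (tens 1 1) = tens 1 a"
      and b: "app (theta u h') (tens 1 1) = tens 1 b" by auto
    have "app (theta u h) (tens 1 (1 * b)) = tens 1 (a * b)"
      unfolding app_tens_right a tens_scalar_right ..
    then show ?case using mult b by (auto simp: theta_hom Hx_sub_carrier)
  qed (auto simp: op_tens pconst)
  then obtain l where l: "app (theta u h) (tens 1 1) = tens 1 l" ..
  have "app (theta u h) (tens 1 (1 * k)) = tens 1 (l * k)"
    unfolding app_tens_right l tens_scalar_right ..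
  then show ?thesis by (simp add: kappaI[OF l])
qed

text \<open>With \<open>kappa_generators\<close> this is the ring homomorphism from
  \<open>Hx_sub\<close> to K that fixes the generators of K and kills the x's.\<close>

lemma kappa_hom:
  assumes "h \<in> Hx_sub u" "h' \<in> Hx_sub u"
  shows "kappa u (h \<oplus>\<^bsub>H_alg u\<^esub> h') = kappa u h + kappa u h'"
    and "kappa u (h \<otimes>\<^bsub>H_alg u\<^esub> h') = kappa u h * kappa u h'"
  using assms
  by (auto intro!: kappaI simp: theta_hom Hx_sub_carrier theta_Hx_sub tens_add_right)

lemma kappa_generators:
  "kappa u (in_H u (scal z)) = pscal z" "kappa u (in_H u (gen (Hc i))) = pgen (Kc i)"
  "kappa u (in_H u (gen (Hw w))) = pgen (Kw w)" "kappa u (in_H u (gen (Hx i))) = 0"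
  using tens_pconst[of z 1 1]
  by (auto intro!: kappaI simp: op_tens Xop_one) (simp add: tens_one)

lemma kappa_one: "kappa u \<one>\<^bsub>H_alg u\<^esub> = 1"
  by (rule kappaI) (simp add: theta_proj_simps flip: proj_H)

section \<open>Polynomials in the \<open>y\<^sub>i\<close> times the subalgebra\<close>

text \<open>Replaces the definite description: \<open>y_poly\<close> followed by
  \<open>proj u\<close> has the required properties, and induction over constants, variables, sums
  and products shows that nothing else has.\<close>

lemma y_embed_eq:
  fixes f :: "'n::finite cpoly"
  shows "y_embed u f = proj u (y_poly f)"
proof -
  let ?P = "\<lambda>\<psi>. \<psi> \<in> ring_hom ring_of_type_algebra (H_alg u) \<and>
     (\<forall>z. \<psi> (pconst z) = in_H u (scal z)) \<and> (\<forall>i. \<psi> (pvar i) = in_H u (gen (Hy i)))"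
  have "y_embed u = (\<lambda>f :: 'n cpoly. proj u (y_poly f))"
    unfolding y_embed_def
  proof (rule the_equality)
    show "?P (\<lambda>f. proj u (y_poly f))"
      by (auto simp: ring_hom_def proj_H in_H_eq pscal_def pgen_def)
    fix \<psi> assume \<psi>: "?P \<psi>"
    have "\<psi> f = proj u (y_poly f)" for f
    proof (induction f rule: cpoly_induct)
      case (add f g)
      then show ?case using \<psi> ring_hom_add[of \<psi> ring_of_type_algebra "H_alg u" f g] by (simp add: proj_H)
    next
      case (mult f g)
      then show ?case using \<psi> ring_hom_mult[of \<psi> ring_of_type_algebra "H_alg u" f g] by (simp add: proj_H)
    qed (use \<psi> in \<open>simp_all add: in_H_eq pscal_def pgen_def\<close>)
    then show "\<psi> = (\<lambda>f. proj u (y_poly f))" by auto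
  qed
  then show ?thesis by simp
qed

text \<open>Polynomials in the y's act by multiplication. Applied to 1 \<otimes> 1 this recovers f,
  the source of the injectivity of the identification.\<close>

lemma theta_y_embed: "app (theta u (y_embed u f)) (tens g k) = tens (f * g) k"
  unfolding y_embed_eq
  by (induction f arbitrary: g k rule: cpoly_induct)
    (simp_all add: theta_proj_simps op_tens distrib_right tens_add_left mult.assoc)

text \<open>The spanning half of a decomposition into polynomials in the y's times
  \<open>Hx_sub\<close>. Elements live in the product algebra, while membership of s in the
  subalgebra is tested at the single value u.\<close>

inductive_set yx_span :: "complex \<Rightarrow> 'n::finite H_gen palg set" for u where
  prod: "proj u s \<in> Hx_sub u \<Longrightarrow> y_poly f * s \<in> yx_span u"
| add: "a \<in> yx_span u \<Longrightarrow> b \<in> yx_span u \<Longrightarrow> a + b \<in> yx_span u"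

lemma Hx_sub_proj:
  "proj u s \<in> Hx_sub u \<Longrightarrow> proj u t \<in> Hx_sub u \<Longrightarrow> proj u (s + t) \<in> Hx_sub u"
  "proj u s \<in> Hx_sub u \<Longrightarrow> proj u t \<in> Hx_sub u \<Longrightarrow> proj u (s * t) \<in> Hx_sub u"
  "proj u s \<in> Hx_sub u \<Longrightarrow> proj u (- s) \<in> Hx_sub u"
  "proj u 1 \<in> Hx_sub u" "proj u 0 \<in> Hx_sub u"
  "proj u (pscal z) \<in> Hx_sub u" "proj u (pgen (Hc i)) \<in> Hx_sub u"
  "proj u (pgen (Hw w)) \<in> Hx_sub u" "proj u (pgen (Hx i)) \<in> Hx_sub u"
  "proj u param \<in> Hx_sub u"
  using subringE(2,3,5-7)[OF subring_Hx_sub] Hx_sub_incl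
  by (auto simp: proj_H) (auto simp: in_H_eq pscal_def pgen_def param_def proj_family)

lemma Hx_sub_kr: "proj u (H.kr \<epsilon> k i) \<in> Hx_sub u"
  unfolding H.kr_def pm_def by (auto intro!: Hx_sub_proj simp del: add_uminus_conv_diff)

lemma yx_span_zero: "0 \<in> yx_span u"
  using yx_span.prod[of u 0 0] by (simp add: Hx_sub_proj)

lemma yx_span_sum: "(\<And>i. i \<in> I \<Longrightarrow> f i \<in> yx_span u) \<Longrightarrow> sum f I \<in> yx_span u"
  by (induction I rule: infinite_finite_induct) (auto intro: yx_span_zero yx_span.add)

text \<open>An x moves past the polynomial by \<open>Hx_y_poly\<close>, whose correction terms again
  end in elements of \<open>Hx_sub\<close>; c's and group elements merely pass or twist it.\<close>

lemma yx_span_generator: "t \<in> yx_span u \<Longrightarrow> pgen h * t \<in> yx_span u"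
proof (induction rule: yx_span.induct)
  case (prod s f)
  show ?case
  proof (cases h)
    case (Hx i)
    have "pgen h * (y_poly f * s) = (pgen (Hx i) * y_poly f) * s"
      by (simp add: Hx mult.assoc)
    also have "\<dots> = y_poly f * (pgen (Hx i) * s) +
        (\<Sum>k\<in>UNIV - {i}. \<Sum>\<epsilon>\<in>{1, -1}. y_poly (ddiff \<epsilon> k i f) * (param * H.kr \<epsilon> k i * s))"
      unfolding Hx_y_poly distrib_right sum_distrib_right mult.assoc ..
    also have "\<dots> \<in> yx_span u"
      by (intro yx_span.add yx_span.prod yx_span_sum Hx_sub_proj Hx_sub_kr prod)
    finally show ?thesis .
  next
    case (Hy i)
    have "pgen h * (y_poly f * s) = y_poly (pvar i * f) * s"
      by (simp add: Hy mult.assoc)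
    then show ?thesis using prod by (simp only: yx_span.prod)
  next
    case (Hc i)
    have "pgen h * (y_poly f * s) = y_poly f * (pgen (Hc i) * s)"
      using Hc_y_poly[of i f] by (simp add: Hc flip: mult.assoc)
    then show ?thesis using prod by (simp only: yx_span.prod Hx_sub_proj)
  next
    case (Hw w)
    have "pgen h * (y_poly f * s) = y_poly (poly_act w f) * (pgen (Hw w) * s)"
      using Hw_y_poly[of w f] by (simp add: Hw flip: mult.assoc)
    then show ?thesis using prod by (simp only: yx_span.prod Hx_sub_proj)
  qed
qed (simp add: distrib_left yx_span.add)

lemma yx_span_all: "family (\<lambda>_. p) \<in> yx_span u"
proof -
  have "t \<in> yx_span u \<Longrightarrow> family (\<lambda>_. p) * t \<in> yx_span u" for t
  proof (induction p arbitrary: t rule: free_alg_induct)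
    case (scal z)
    from scal show ?case
      unfolding pscal_def[symmetric]
    proof (induction rule: yx_span.induct)
      case (prod s f)
      have "pscal z * (y_poly f * s) = y_poly (pconst z * f) * s"
        by (simp add: mult.assoc)
      then show ?case using prod by (simp only: yx_span.prod)
    qed (simp add: distrib_left yx_span.add)
  next
    case (gen x)
    then show ?case using yx_span_generator by (simp flip: pgen_def)
  qed (simp_all add: family_simps distrib_right mult.assoc yx_span.add)
  moreover have "1 \<in> yx_span u"
    using yx_span.prod[of u 1 1] by (simp add: Hx_sub_proj)
  ultimately show ?thesis by fastforce
qed

section \<open>The induced module\<close>

lemma with_action_simps [simp]:
  "carrier (with_action A act) = carrier A" "x \<oplus>\<^bsub>with_action A act\<^esub> y = x \<oplus>\<^bsub>A\<^esub> y"
  "\<zero>\<^bsub>with_action A act\<^esub> = \<zero>\<^bsub>A\<^esub>" "a \<odot>\<^bsub>with_action A act\<^esub> x = act a x"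
  by (simp_all add: with_action_def)

lemma abelian_group_with_action: "abelian_group A \<Longrightarrow> abelian_group (with_action A act)"
proof -
  assume "abelian_group A"
  then interpret abelian_group A .
  show ?thesis
    by (rule abelian_groupI) (auto simp: a_ac intro: bexI[of _ "\<ominus>\<^bsub>A\<^esub> x" for x] l_neg)
qed

section \<open>Modules over K and their extension by zero\<close>

locale K_module =
  fixes M :: "('n::finite K_gen free_alg set, 'm) module"
  assumes left_module: "left_module K_alg M"
begin

sublocale left_module K_alg M by (rule left_module)

text \<open>Elements of \<open>kalg\<close> are families indexed by the parameter. The component at
  0 is an arbitrary choice: \<open>K_relators\<close> is the same for all parameters, and the
  elements used here are constant families.\<close>

definition kact :: "'n kalg \<Rightarrow> 'm \<Rightarrow> 'm" where
  "kact a m = proj 0 a \<odot>\<^bsub>M\<^esub> m"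

lemma kact_in_K: "in_K p \<odot>\<^bsub>M\<^esub> m = kact (family (\<lambda>_. p)) m"
  by (simp add: kact_def in_K_eq[of _ 0])

lemma proj_K: "proj 0 (a :: 'n kalg) \<in> carrier K_alg"
  by (simp add: K_alg_eq[of 0])

lemma kact_closed [simp]: "m \<in> carrier M \<Longrightarrow> kact a m \<in> carrier M"
  unfolding kact_def by (intro smult_closed proj_K)

lemma kact_add: "m \<in> carrier M \<Longrightarrow> kact (a + b) m = kact a m \<oplus>\<^bsub>M\<^esub> kact b m"
  using smult_l_distr[OF proj_K proj_K, of m a b] by (simp add: kact_def proj_add K_alg_eq[of 0])

lemma kact_mult: "m \<in> carrier M \<Longrightarrow> kact (a * b) m = kact a (kact b m)"
  using smult_assoc[OF proj_K proj_K, of m a b] by (simp add: kact_def proj_mult K_alg_eq[of 0])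

lemma kact_one: "m \<in> carrier M \<Longrightarrow> kact 1 m = m"
  using smult_one[of m] by (simp add: kact_def proj_one K_alg_eq[of 0])

lemma kact_add_right:
  "m \<in> carrier M \<Longrightarrow> m' \<in> carrier M \<Longrightarrow> kact a (m \<oplus>\<^bsub>M\<^esub> m') = kact a m \<oplus>\<^bsub>M\<^esub> kact a m'"
  using smult_r_distr[OF proj_K] by (simp add: kact_def)

lemma kact_zero: "m \<in> carrier M \<Longrightarrow> kact 0 m = \<zero>\<^bsub>M\<^esub>"
  using kact_add[of m 0 0] by simp

text \<open>Pulling the K-action back along \<open>kappa\<close> gives the extension.\<close>

lemma extends_by_zero_exists: "\<exists>act. extends_by_zero u M act"
proof
  let ?act = "\<lambda>h. kact (kappa u h)"
  have "left_module (H_alg u\<lparr>carrier := Hx_sub u\<rparr>) (with_action M ?act)"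
  proof (intro left_module.intro left_module_axioms.intro)
    show "ring (H_alg u\<lparr>carrier := Hx_sub u\<rparr>)"
      by (rule ring.subring_is_ring[OF ring_H_alg subring_Hx_sub])
    show "abelian_group (with_action M ?act)"
      by (rule abelian_group_with_action) unfold_locales
  qed (auto simp: kappa_hom kappa_one kact_add kact_mult kact_one kact_add_right)
  then show "extends_by_zero u M ?act"
    by (auto simp: extends_by_zero_def kappa_generators kact_zero kact_in_K pscal_def pgen_def)
qed

section \<open>The space \<complex>[y] \<otimes> M and the map to it from \<complex>[y] \<otimes>
  K\<close>

abbreviation VS where "VS \<equiv> ring_of_type_algebra :: complex ring"
abbreviation VA where "VA \<equiv> cpoly_module :: (complex, 'n cpoly) module"
abbreviation Vr where "Vr \<equiv> (\<lambda>f z. f * pconst z) :: 'n cpoly \<Rightarrow> complex \<Rightarrow> 'n cpoly"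

lemma complex_module_simps [simp]:
  "carrier (complex_module M) = carrier M" "x \<oplus>\<^bsub>complex_module M\<^esub> y = x \<oplus>\<^bsub>M\<^esub> y"
  "\<zero>\<^bsub>complex_module M\<^esub> = \<zero>\<^bsub>M\<^esub>" "z \<odot>\<^bsub>complex_module M\<^esub> x = kact (pscal z) x"
  by (simp_all add: complex_module_def kact_in_K pscal_def)

lemma cpoly_module_simps [simp]:
  "carrier VA = UNIV" "f \<oplus>\<^bsub>VA\<^esub> g = f + g" "z \<odot>\<^bsub>VA\<^esub> f = pconst z * f" "\<zero>\<^bsub>VA\<^esub> = 0"
  by (simp_all add: cpoly_module_def)

sublocale V: tensor_data VS VA Vr "complex_module M"
proof (rule tensor_data.intro)
  show "abelian_group VA"
    unfolding cpoly_module_def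
    by (intro abelian_group_with_action abelian_group_of_type_algebra)
  show "abelian_group (complex_module M)"
    unfolding complex_module_def by (rule abelian_group_with_action) unfold_locales
qed auto

lemma V_scale:
  "tensor_pure_map VS VA Vr (complex_module M) VS VA Vr (complex_module M) (\<lambda>(f, m). (pconst z * f, m))"
proof -
  have "frag_of (pconst z * (f * pconst a), m) - frag_of (pconst z * f, kact (pscal a) m) \<in> V.ker"
    if "m \<in> carrier M" for f a m
    using V.pure_balanced[of "pconst z * f" a m] that by (simp add: mult.assoc)
  then show ?thesis
    by (intro tensor_pure_mapI[OF V.tensor_data_axioms V.tensor_data_axioms])
      (simp_all add: distrib_left)
qed

lemma V_smult:
  "z \<odot>\<^bsub>V.T\<^esub> V.cls p = V.cls (frag_extend (\<lambda>(f, m). frag_of (pconst z * f, m)) p)"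
  using tensor_pure_map.tensor_hom_cls[OF V_scale[of z], of p]
  by (simp add: tensor_product_def case_prod_unfold)

text \<open>A representative of the image of q \<otimes> m under the canonical map
  \<open>(\<complex>[y] \<otimes> K) \<otimes>\<^sub>K M \<rightarrow> \<complex>[y] \<otimes>
  M\<close>. Being a representative, it obeys the expected laws only after passing to
  classes.\<close>

definition expand :: "'n kpoly \<Rightarrow> 'm \<Rightarrow> ('n cpoly \<times> 'm \<Rightarrow>\<^sub>0 int)" where
  "expand q m = (\<Sum>e\<in>Poly_Mapping.keys q.
     frag_of (Poly_Mapping.single e 1, kact (Poly_Mapping.lookup q e) m))"

lemma expand_frags [simp]: "m \<in> carrier M \<Longrightarrow> expand q m \<in> V.frags"
  by (simp add: expand_def)

lemma V_zero: "V.cls (frag_of (f, \<zero>\<^bsub>M\<^esub>)) = V.cls 0"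
  using V.pure_zero_right[of f] by (simp add: V.cls_eq_iff)

text \<open>Exponents outside the support contribute monomials tensor 0, which vanish only as
  classes. A common index set is needed because the support of a sum may shrink.\<close>

lemma expand_superset:
  assumes "m \<in> carrier M" "finite A" "Poly_Mapping.keys q \<subseteq> A"
  shows "V.cls (expand q m) =
    V.cls (\<Sum>e\<in>A. frag_of (Poly_Mapping.single e 1, kact (Poly_Mapping.lookup q e) m))"
proof -
  let ?f = "\<lambda>e. frag_of (Poly_Mapping.single e 1, kact (Poly_Mapping.lookup q e) m)"
  have "V.cls (\<Sum>e\<in>A. ?f e) = V.cls (\<Sum>e\<in>A. if e \<in> Poly_Mapping.keys q then ?f e else 0)"
    by (rule V.cls_sum_cong) (simp add: not_in_keys_iff_lookup_eq_zero kact_zero assms V_zero)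
  also have "(\<Sum>e\<in>A. if e \<in> Poly_Mapping.keys q then ?f e else 0) = expand q m"
    using assms by (simp add: expand_def sum.inter_restrict[symmetric] Int_absorb1)
  finally show ?thesis ..
qed

lemma expand_add:
  assumes "m \<in> carrier M"
  shows "V.cls (expand (p + q) m) = V.cls (expand p m + expand q m)"
proof -
  let ?A = "Poly_Mapping.keys p \<union> Poly_Mapping.keys q"
  let ?f = "\<lambda>q e. frag_of (Poly_Mapping.single e 1, kact (Poly_Mapping.lookup q e) m)"
  have "V.cls (expand (p + q) m) = V.cls (\<Sum>e\<in>?A. ?f (p + q) e)"
    using assms keys_add[of p q] by (intro expand_superset) auto
  also have "\<dots> = V.cls (\<Sum>e\<in>?A. ?f p e + ?f q e)"
  proof (rule V.cls_sum_cong)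
    show "V.cls (?f (p + q) e) = V.cls (?f p e + ?f q e)" for e
      using V.pure_add_right[of "Poly_Mapping.single e 1" "kact (Poly_Mapping.lookup p e) m"
          "kact (Poly_Mapping.lookup q e) m"] assms
      by (simp add: V.cls_eq_iff lookup_add kact_add)
  qed
  also have "\<dots> = V.cls (expand p m + expand q m)"
    unfolding sum.distrib
    using assms by (intro V.cls_add_cong expand_superset[symmetric]) auto
  finally show ?thesis .
qed

lemma expand_add_right:
  assumes "m \<in> carrier M" "m' \<in> carrier M"
  shows "V.cls (expand q (m \<oplus>\<^bsub>M\<^esub> m')) = V.cls (expand q m + expand q m')"
proof -
  have "V.cls (frag_of (f, kact a (m \<oplus>\<^bsub>M\<^esub> m'))) = V.cls (frag_of (f, kact a m) + frag_of (f, kact a m'))" for f a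
    using V.pure_add_right[of f "kact a m" "kact a m'"] assms
    by (simp add: V.cls_eq_iff kact_add_right)
  then show ?thesis
    unfolding expand_def sum.distrib[symmetric] by (intro V.cls_sum_cong) auto
qed

lemma lookup_scalar_right:
  "Poly_Mapping.lookup (q * Poly_Mapping.single 0 k) e = Poly_Mapping.lookup (q :: 'n kpoly) e * k"
proof (induction q rule: poly_mapping_add_induct)
  case (single d z)
  show ?case by (simp add: mult_single lookup_single when_def)
qed (simp add: distrib_right lookup_add)

text \<open>Balancedness over K, which makes the inverse of the identification well defined.\<close>

lemma expand_scalar:
  assumes "m \<in> carrier M"
  shows "V.cls (expand (q * Poly_Mapping.single 0 k) m) = V.cls (expand q (kact k m))"
proof -
  have "Poly_Mapping.keys (q * Poly_Mapping.single 0 k) \<subseteq> Poly_Mapping.keys q"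
    by (auto simp: in_keys_iff lookup_scalar_right)
  then have "V.cls (expand (q * Poly_Mapping.single 0 k) m) = V.cls (\<Sum>e\<in>Poly_Mapping.keys q.
      frag_of (Poly_Mapping.single e 1, kact (Poly_Mapping.lookup (q * Poly_Mapping.single 0 k) e) m))"
    using assms by (intro expand_superset) auto
  then show ?thesis using assms by (simp add: lookup_scalar_right kact_mult expand_def)
qed

lemma expand_tens:
  assumes "m \<in> carrier M"
  shows "V.cls (expand (tens f 1) m) = V.cls (frag_of (f, m))"
proof (induction f rule: poly_mapping_add_induct)
  case (single e z)
  have "tens (Poly_Mapping.single e z) 1 = Poly_Mapping.single e (pscal z)"
    by (simp add: tens_def kembed_single mult_single)
  then have "V.cls (expand (tens (Poly_Mapping.single e z) 1) m) =
      V.cls (frag_of (Poly_Mapping.single e 1, kact (pscal z) m))"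
    using expand_superset[OF assms, of "{e}" "Poly_Mapping.single e (pscal z)"] by simp
  also have "\<dots> = V.cls (frag_of (Poly_Mapping.single e 1 * pconst z, m))"
    using V.pure_balanced[of "Poly_Mapping.single e 1" z m] assms
    by - (rule sym, simp add: V.cls_eq_iff)
  finally show ?case by (simp add: pconst_def mult_single)
next
  case (add f g)
  have "V.cls (expand (tens (f + g) 1) m) = V.cls (frag_of (f, m) + frag_of (g, m))"
    unfolding tens_add_left expand_add[OF assms] by (rule V.cls_add_cong[OF add])
  also have "\<dots> = V.cls (frag_of (f + g, m))"
    by (rule sym) (use V.pure_add_left[of f g m] assms in \<open>simp add: V.cls_eq_iff\<close>)
  finally show ?case .
qed

end

section \<open>The induced module and its identification with \<complex>[y] \<otimes> M\<close>

locale induced = K_module M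
  for M :: "('n::finite K_gen free_alg set, 'm) module" +
  fixes u :: complex and act :: "'n H_gen free_alg set \<Rightarrow> 'm \<Rightarrow> 'm"
  assumes extends: "extends_by_zero u M act"
begin

abbreviation IS where "IS \<equiv> H_alg u\<lparr>carrier := Hx_sub u\<rparr>"
abbreviation IA where "IA \<equiv> with_action (H_alg u) (monoid.mult (H_alg u))"
abbreviation Ir where "Ir \<equiv> monoid.mult (H_alg u)"
abbreviation IM where "IM \<equiv> with_action M act"

interpretation act: left_module IS IM
  using extends by (simp add: extends_by_zero_def)

interpretation H_ring: ring "H_alg u"
  by (rule ring_H_alg)

text \<open>Two actions of \<open>Hx_sub\<close> that agree on its generators agree, so the
  extension by zero is unique on the subalgebra and equals the one built from
  \<open>kappa\<close>.\<close>

lemma act_eq_kact: "h \<in> Hx_sub u \<Longrightarrow> m \<in> carrier M \<Longrightarrow> act h m = kact (kappa u h) m"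
proof (induction arbitrary: m rule: Hx_sub_induct)
  case (add h h')
  then show ?case
    using act.smult_l_distr[of h h' m] by (simp add: kappa_hom kact_add)
next
  case (mult h h')
  then show ?case
    using act.smult_assoc[of h h' m] by (simp add: kappa_hom kact_mult)
qed (use extends in \<open>auto simp: extends_by_zero_def kappa_generators kact_zero kact_in_K pscal_def pgen_def\<close>)

sublocale I: tensor_data IS IA Ir IM
proof (rule tensor_data.intro)
  show "abelian_group IA"
    by (rule abelian_group_with_action) (rule H_ring.abelian_group_axioms)
  show "abelian_group IM"
    by (rule act.abelian_group_axioms)
  show "Ir a s \<in> carrier IA" if "a \<in> carrier IA" "s \<in> carrier IS" for a s
    using that by (simp add: Hx_sub_carrier)
  show "s \<odot>\<^bsub>IM\<^esub> m \<in> carrier IM" if "s \<in> carrier IS" "m \<in> carrier IM" for s m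
    using act.smult_closed that by simp
qed

lemma Ind_eq: "Ind u M act = I.T"
  by (simp add: Ind_def induced_module_def)

lemma I_balanced:
  assumes "a \<in> carrier (H_alg u)" "s \<in> Hx_sub u" "m \<in> carrier M"
  shows "I.cls (frag_of (a \<otimes>\<^bsub>H_alg u\<^esub> s, m)) = I.cls (frag_of (a, act s m))"
  using I.pure_balanced[of a s m] assms by (simp add: I.cls_eq_iff)

lemma I_add:
  assumes "m \<in> carrier M"
  shows "I.cls (frag_of (proj u (a + b), m)) = I.cls (frag_of (proj u a, m) + frag_of (proj u b, m))"
  using I.pure_add_left[of "proj u a" "proj u b" m] assms by (simp add: I.cls_eq_iff proj_H)

lemma I_zero:
  assumes "m \<in> carrier M"
  shows "I.cls (frag_of (proj u 0, m)) = I.cls 0"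
  using I.pure_zero_left[of m] assms by (simp add: I.cls_eq_iff proj_H)

lemma I_sum:
  assumes "m \<in> carrier M"
  shows "I.cls (frag_of (proj u (sum g J), m)) = I.cls (\<Sum>j\<in>J. frag_of (proj u (g j), m))"
proof (induction J rule: infinite_finite_induct)
  case (insert j J)
  then show ?case
    using assms by (simp add: I_add) (rule I.cls_add_cong; simp)
qed (simp_all add: I_zero assms)

lemma ident_map:
  "tensor_pure_map VS VA Vr (complex_module M) IS IA Ir IM (\<lambda>(f, m). (y_embed u f, m))"
proof -
  have "frag_of (y_embed u (f * pconst z), m) - frag_of (y_embed u f, kact (pscal z) m) \<in> I.ker"
    if m: "m \<in> carrier M" for f z m
  proof -
    have "y_embed u (f * pconst z) = y_embed u f \<otimes>\<^bsub>H_alg u\<^esub> in_H u (scal z)"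
      by (simp add: y_embed_eq proj_H in_H_eq pscal_def)
    moreover have "kact (pscal z) m = act (in_H u (scal z)) m"
      using act_eq_kact[OF Hx_sub_incl(1) m] by (simp add: kappa_generators)
    ultimately show ?thesis
      using I_balanced[of "y_embed u f" "in_H u (scal z)" m] m
      by (simp add: I.cls_eq_iff Hx_sub_incl y_embed_eq)
  qed
  then show ?thesis
    by (intro tensor_pure_mapI[OF V.tensor_data_axioms I.tensor_data_axioms])
      (simp_all add: y_embed_eq proj_H)
qed

sublocale ident: tensor_pure_map VS VA Vr "complex_module M" IS IA Ir IM "\<lambda>(f, m). (y_embed u f, m)"
  by (rule ident_map)

abbreviation iext where "iext \<equiv> frag_extend (\<lambda>c. frag_of (case c of (f, m) \<Rightarrow> (y_embed u f, m)))"

lemma identification_cls: "identification u M act (V.cls p) = I.cls (iext p)"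
  using ident.tensor_hom_cls[of p] by (simp add: identification_def)

lemma poly_tensor_eq: "poly_tensor M = V.T"
  by (simp add: poly_tensor_def)

lemma left_mult_map:
  assumes "h \<in> carrier (H_alg u)"
  shows "tensor_pure_map IS IA Ir IM IS IA Ir IM (\<lambda>(a, m). (h \<otimes>\<^bsub>H_alg u\<^esub> a, m))"
proof -
  have "frag_of (h \<otimes>\<^bsub>H_alg u\<^esub> (a \<otimes>\<^bsub>H_alg u\<^esub> s), m) - frag_of (h \<otimes>\<^bsub>H_alg u\<^esub> a, act s m) \<in> I.ker"
    if "a \<in> carrier (H_alg u)" "s \<in> Hx_sub u" "m \<in> carrier M" for a s m
    using I_balanced[of "h \<otimes>\<^bsub>H_alg u\<^esub> a" s m] that assms
    by (simp add: I.cls_eq_iff H_ring.m_assoc Hx_sub_carrier)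
  then show ?thesis
    by (intro tensor_pure_mapI[OF I.tensor_data_axioms I.tensor_data_axioms])
      (simp_all add: assms H_ring.r_distr)
qed

lemma Ind_smult:
  assumes "h \<in> carrier (H_alg u)"
  shows "h \<odot>\<^bsub>Ind u M act\<^esub> I.cls p =
    I.cls (frag_extend (\<lambda>(a, m). frag_of (h \<otimes>\<^bsub>H_alg u\<^esub> a, m)) p)"
  using tensor_pure_map.tensor_hom_cls[OF left_mult_map[OF assms], of p]
  by (simp add: Ind_eq tensor_product_def case_prod_unfold)

text \<open>
  The map \<open>h \<otimes> m \<mapsto> h \<circ> (1 \<otimes> m)\<close> from the induced module to \<open>\<complex>[y] \<otimes> M\<close>; it inverts the identification.
\<close>

lemma expand_map:
  "tensor_map IS IA Ir IM VS VA Vr (complex_module M) (\<lambda>(h, m). expand (app (theta u h) (tens 1 1)) m)"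
proof (intro tensor_map.intro tensor_map_axioms.intro I.tensor_data_axioms V.tensor_data_axioms)
  fix h h' s :: "'n H_gen free_alg set" and m m' :: 'm
  assume h: "h \<in> carrier IA" and m: "m \<in> carrier IM"
  show "(case (h, m) of (h, m) \<Rightarrow> expand (app (theta u h) (tens 1 1)) m) \<in> V.frags"
    using m by simp
  show "(case (h \<oplus>\<^bsub>IA\<^esub> h', m) of (h, m) \<Rightarrow> expand (app (theta u h) (tens 1 1)) m) -
    ((case (h, m) of (h, m) \<Rightarrow> expand (app (theta u h) (tens 1 1)) m) +
     (case (h', m) of (h, m) \<Rightarrow> expand (app (theta u h) (tens 1 1)) m)) \<in> V.ker"
    if "h' \<in> carrier IA"
    using h m that expand_add by (simp add: theta_hom flip: V.cls_eq_iff)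
  show "(case (h, m \<oplus>\<^bsub>IM\<^esub> m') of (h, m) \<Rightarrow> expand (app (theta u h) (tens 1 1)) m) -
    ((case (h, m) of (h, m) \<Rightarrow> expand (app (theta u h) (tens 1 1)) m) +
     (case (h, m') of (h, m) \<Rightarrow> expand (app (theta u h) (tens 1 1)) m)) \<in> V.ker"
    if "m' \<in> carrier IM"
    using h m that expand_add_right by (simp flip: V.cls_eq_iff)
  show "(case (h \<otimes>\<^bsub>H_alg u\<^esub> s, m) of (h, m) \<Rightarrow> expand (app (theta u h) (tens 1 1)) m) -
    (case (h, s \<odot>\<^bsub>IM\<^esub> m) of (h, m) \<Rightarrow> expand (app (theta u h) (tens 1 1)) m) \<in> V.ker"
    if "s \<in> carrier IS"
  proof -
    have s: "s \<in> Hx_sub u" using that by simp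
    \<comment> \<open>The balancing condition: s sends 1 \<otimes> 1 to 1 \<otimes>
      \<open>kappa u s\<close>, right linearity of the operator of h pulls this factor out, and
      \<open>expand_scalar\<close> lets it act on m.\<close>
    have "app (theta u (h \<otimes>\<^bsub>H_alg u\<^esub> s)) (tens 1 1) = app (theta u h) (tens 1 (1 * kappa u s))"
      using h s by (simp add: theta_hom Hx_sub_carrier theta_Hx_sub)
    also have "\<dots> = app (theta u h) (tens 1 1) * Poly_Mapping.single 0 (kappa u s)"
      by (rule app_tens_right)
    finally show ?thesis
      using m s by (simp add: expand_scalar act_eq_kact flip: V.cls_eq_iff)
  qed
qed

text \<open>On f \<otimes> m the composite applies f to 1 \<otimes> 1 and inserts m, which by
  \<open>theta_y_embed\<close> returns f \<otimes> m. A left inverse yields injectivity.\<close>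

lemma expand_iext:
  assumes "p \<in> V.frags"
  shows "V.cls (frag_extend (\<lambda>(h, m). expand (app (theta u h) (tens 1 1)) m) (iext p)) = V.cls p"
  using assms
proof (induction rule: V.frags_induct)
  case (of f m)
  then show ?case by (simp add: theta_y_embed expand_tens)
next
  case (diff p q)
  show ?case unfolding frag_extend_diff by (rule V.cls_diff_cong[OF diff(3,4)])
qed simp

lemma inj_identification: "inj_on (identification u M act) (carrier V.T)"
proof (rule inj_onI)
  fix x y
  assume "x \<in> carrier V.T" "y \<in> carrier V.T" and eq: "identification u M act x = identification u M act y"
  then obtain p q where p: "p \<in> V.frags" "x = V.cls p" and q: "q \<in> V.frags" "y = V.cls q"
    by (auto simp: V.carrier_T)
  have "I.cls (iext p) = I.cls (iext q)"
    using eq by (simp add: p q identification_cls)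
  from tensor_map.extend_cong[OF expand_map this] show "x = y"
    by (simp add: p q expand_iext)
qed

text \<open>In a product of a polynomial and an element of \<open>Hx_sub\<close>, the second factor
  moves across the tensor sign and acts on m, leaving an image under the identification.\<close>

lemma I_yx_span:
  assumes "t \<in> yx_span u" "m \<in> carrier M"
  shows "\<exists>q\<in>V.frags. I.cls (frag_of (proj u t, m)) = I.cls (iext q)"
  using assms(1)
proof (induction rule: yx_span.induct)
  case (prod s f)
  have "I.cls (frag_of (proj u (y_poly f * s), m)) = I.cls (iext (frag_of (f, act (proj u s) m)))"
    using I_balanced[of "proj u (y_poly f)" "proj u s" m] prod assms(2)
    by (simp add: proj_H y_embed_eq)
  moreover have "frag_of (f, act (proj u s) m) \<in> V.frags"
    using prod assms(2) by (simp add: act_eq_kact)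
  ultimately show ?case by blast
next
  case (add a b)
  then obtain p q where pq: "p \<in> V.frags" "q \<in> V.frags"
    and "I.cls (frag_of (proj u a, m)) = I.cls (iext p)"
    and "I.cls (frag_of (proj u b, m)) = I.cls (iext q)" by auto
  then have "I.cls (frag_of (proj u (a + b), m)) = I.cls (iext (p + q))"
    unfolding I_add[OF assms(2)] frag_extend_add by (intro I.cls_add_cong)
  with pq show ?case by (intro bexI[of _ "p + q"] V.frags_add)
qed

lemma surj_identification:
  assumes "p \<in> I.frags"
  shows "\<exists>q\<in>V.frags. I.cls p = I.cls (iext q)"
  using assms
proof (induction rule: I.frags_induct)
  case zero
  show ?case by (rule bexI[of _ 0]) simp_all
next
  case (of a m)
  then obtain p where "a = in_H u p" using H_alg_exhaust by auto
  then show ?case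
    using I_yx_span[OF yx_span_all[of p u], of m] of by (simp add: in_H_eq)
next
  case (diff p q)
  then obtain p' q' where pq: "p' \<in> V.frags" "q' \<in> V.frags"
    and "I.cls p = I.cls (iext p')" "I.cls q = I.cls (iext q')" by auto
  then have "I.cls (p - q) = I.cls (iext (p' - q'))"
    unfolding frag_extend_diff by (intro I.cls_diff_cong)
  with pq show ?case by (intro bexI[of _ "p' - q'"] V.frags_diff)
qed

lemma bij_identification:
  "bij_betw (identification u M act) (carrier (poly_tensor M)) (carrier (Ind u M act))"
proof -
  have "identification u M act ` carrier V.T = carrier I.T"
  proof (intro equalityI subsetI)
    fix x assume "x \<in> identification u M act ` carrier V.T"
    then show "x \<in> carrier I.T"
      by (auto simp: V.carrier_T identification_cls ident.extend_frags)
  next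
    fix x assume "x \<in> carrier I.T"
    then obtain p where p: "p \<in> I.frags" "x = I.cls p" by (auto simp: I.carrier_T)
    then obtain q where "q \<in> V.frags" "x = identification u M act (V.cls q)"
      using surj_identification[of p] by (auto simp: identification_cls)
    then show "x \<in> identification u M act ` carrier V.T" by auto
  qed
  then show ?thesis
    using inj_identification by (simp add: bij_betw_def poly_tensor_eq Ind_eq)
qed

lemma theta_kr: "theta u (proj u (H.kr \<epsilon> k i)) = E.kr \<epsilon> k i"
  by (simp add: H.kr_def E.kr_def pm_def theta_proj_simps del: add_uminus_conv_diff)

lemma act_kr:
  assumes "m \<in> carrier M" "\<epsilon> \<in> {1, -1}"
  shows "act (proj u (param * H.kr \<epsilon> k i)) m = kact (pscal u) (kact (K.kr \<epsilon> k i) m)"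
proof -
  have "kappa u (proj u (param * H.kr \<epsilon> k i)) = pscal u * K.kr \<epsilon> k i"
    using tens_pconst[of u 1]
    by (intro kappaI) (simp add: theta_proj_simps theta_kr kr_tens[OF assms(2)] Sop_tens)
  then show ?thesis
    using assms by (simp add: act_eq_kact Hx_sub_proj Hx_sub_kr kact_mult)
qed

section \<open>The action of the x's after transport of structure\<close>

lemma Hx_action:
  assumes m: "m \<in> carrier M"
  shows "poly_module_act u M act (in_H u (gen (Hx i))) (ptens M f m) =
    V.cls (\<Sum>k\<in>UNIV - {i}. \<Sum>\<epsilon>\<in>{1, -1}. frag_of (pconst u * ddiff \<epsilon> k i f, kact (K.kr \<epsilon> k i) m))"
    (is "_ = V.cls ?F")
proof -
  have F: "?F \<in> V.frags"
    using m by (intro V.frags_sum) simp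
  let ?x = "proj u (pgen (Hx i))"
  have ptens: "ptens M f m = V.cls (frag_of (f, m))"
    by (simp add: ptens_def V.pure_eq)
  \<comment> \<open>The leading term of \<open>Hx_y_poly\<close> has the x on the right; across the
    tensor sign it acts on m by zero.\<close>
  have "act ?x m = \<zero>\<^bsub>M\<^esub>"
    using extends m by (simp add: extends_by_zero_def in_H_eq pgen_def)
  then have zero: "I.cls (frag_of (proj u (y_poly f * pgen (Hx i)), m)) = I.cls 0"
    using I_balanced[of "proj u (y_poly f)" ?x m] I.pure_zero_right[of "proj u (y_poly f)"] m
    by (simp add: proj_H Hx_sub_proj I.cls_eq_iff[of _ 0])
  have "in_H u (gen (Hx i)) \<odot>\<^bsub>Ind u M act\<^esub> identification u M act (ptens M f m) =
      I.cls (frag_of (proj u (pgen (Hx i) * y_poly f), m))"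
    by (simp add: ptens identification_cls in_H_eq Ind_smult y_embed_eq pgen_def proj_H)
  also have "\<dots> = I.cls (0 + (\<Sum>k\<in>UNIV - {i}. \<Sum>\<epsilon>\<in>{1, -1}.
      iext (frag_of (pconst u * ddiff \<epsilon> k i f, kact (K.kr \<epsilon> k i) m))))"
    unfolding Hx_y_poly I_add[OF m]
  proof (rule I.cls_add_cong[OF zero])
    \<comment> \<open>The correction factor lies in \<open>Hx_sub\<close>, so it too moves across
      and acts on m as u times the reflection term of K.\<close>
    have "I.cls (frag_of (proj u (y_poly (ddiff \<epsilon> k i f) * (param * H.kr \<epsilon> k i)), m)) =
        I.cls (iext (frag_of (pconst u * ddiff \<epsilon> k i f, kact (K.kr \<epsilon> k i) m)))"
      if "\<epsilon> \<in> {1, -1}" for k \<epsilon>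
    proof -
      have "I.cls (frag_of (proj u (y_poly (ddiff \<epsilon> k i f) * (param * H.kr \<epsilon> k i)), m)) =
          I.cls (iext (frag_of (ddiff \<epsilon> k i f, kact (pscal u) (kact (K.kr \<epsilon> k i) m))))"
        unfolding proj_H(2)[of u "y_poly (ddiff \<epsilon> k i f)"]
          I_balanced[OF proj_in_H Hx_sub_proj(2)[OF Hx_sub_proj(10) Hx_sub_kr] m] act_kr[OF m that]
        by (simp add: y_embed_eq)
      \<comment> \<open>The scalar u returns to the polynomial factor by the balancing over
        \<complex> on the side of \<complex>[y] \<otimes> M.\<close>
      also have "\<dots> = I.cls (iext (frag_of (ddiff \<epsilon> k i f * pconst u, kact (K.kr \<epsilon> k i) m)))"
        using V.pure_balanced[of "ddiff \<epsilon> k i f" u "kact (K.kr \<epsilon> k i) m"] m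
        by - (rule ident.extend_cong, rule sym, simp add: V.cls_eq_iff)
      finally show ?thesis by (simp only: mult.commute)
    qed
    then show "I.cls (frag_of (proj u (\<Sum>k\<in>UNIV - {i}. \<Sum>\<epsilon>\<in>{1, -1}.
        y_poly (ddiff \<epsilon> k i f) * (param * H.kr \<epsilon> k i)), m)) =
      I.cls (\<Sum>k\<in>UNIV - {i}. \<Sum>\<epsilon>\<in>{1, -1}. iext (frag_of (pconst u * ddiff \<epsilon> k i f, kact (K.kr \<epsilon> k i) m)))"
      unfolding I_sum[OF m]
      by (intro I.cls_sum_cong trans[OF I_sum[OF m]]) simp_all
  qed
  also have "\<dots> = identification u M act (V.cls ?F)"
    by (simp add: identification_cls frag_extend_sum frag_extend_add o_def)
  finally have "poly_module_act u M act (in_H u (gen (Hx i))) (ptens M f m) =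
      inv_into (carrier V.T) (identification u M act) (identification u M act (V.cls ?F))"
    by (simp add: poly_module_act_def poly_tensor_eq)
  also have "\<dots> = V.cls ?F"
    using inj_identification F by (intro inv_into_f_f) simp_all
  finally show ?thesis .
qed

lemma scaled_sum:
  fixes i :: 'n
  assumes "\<And>k. m k \<in> carrier M"
  shows "u \<odot>\<^bsub>poly_tensor M\<^esub> (\<Oplus>\<^bsub>poly_tensor M\<^esub> k\<in>UNIV - {i}. ptens M (f k) (m k)) =
    V.cls (\<Sum>k\<in>UNIV - {i}. frag_of (pconst u * f k, m k))"
proof -
  have "(\<Oplus>\<^bsub>V.T\<^esub> k\<in>UNIV - {i}. ptens M (f k) (m k)) = V.cls (\<Sum>k\<in>UNIV - {i}. frag_of (f k, m k))"
    using V.finsum_T[OF finite[of "UNIV - {i}"], of "\<lambda>k. frag_of (f k, m k)"] assms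
    by (simp add: ptens_def V.pure_eq)
  then show ?thesis
    by (simp add: poly_tensor_eq V_smult frag_extend_sum o_def)
qed

end

theorem theorem4p17:
  fixes u :: complex and M :: "('n::finite K_gen free_alg set, 'm) module"
  assumes "CARD('n) \<ge> 4"
    and "left_module K_alg M"
  shows "(\<exists>act. extends_by_zero u M act) \<and>
    (\<forall>act. extends_by_zero u M act \<longrightarrow>
      bij_betw (identification u M act) (carrier (poly_tensor M)) (carrier (Ind u M act)) \<and>
      (\<forall>(i :: 'n) (f :: 'n cpoly). \<forall>m\<in>carrier M.
        poly_module_act u M act (in_H u (gen (Hx i))) (ptens M f m) =
          u \<odot>\<^bsub>poly_tensor M\<^esub>
            (\<Oplus>\<^bsub>poly_tensor M\<^esub> k\<in>UNIV - {i}.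
              ptens M (exact_quot (f - poly_act (refl_s k i) f) (pvar i - pvar k))
                (in_K ((1 + gen (Kc k) * gen (Kc i)) * gen (Kw (refl_s k i))) \<odot>\<^bsub>M\<^esub> m))
          \<oplus>\<^bsub>poly_tensor M\<^esub>
          u \<odot>\<^bsub>poly_tensor M\<^esub>
            (\<Oplus>\<^bsub>poly_tensor M\<^esub> k\<in>UNIV - {i}.
              ptens M (exact_quot (f - poly_act (refl_sbar k i) f) (pvar i + pvar k))
                (in_K ((1 - gen (Kc k) * gen (Kc i)) * gen (Kw (refl_sbar k i))) \<odot>\<^bsub>M\<^esub> m))))"
proof -
  interpret K_module M
    by (rule K_module.intro) (rule assms(2))
  show ?thesis
  proof (intro conjI allI impI ballI)
    show "\<exists>act. extends_by_zero u M act"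
      by (rule extends_by_zero_exists)
    fix act assume "extends_by_zero u M act"
    then interpret induced M u act
      by (intro induced.intro K_module_axioms induced_axioms.intro)
    show "bij_betw (identification u M act) (carrier (poly_tensor M)) (carrier (Ind u M act))"
      by (rule bij_identification)
    fix i :: 'n and f :: "'n cpoly" and m assume m: "m \<in> carrier M"
    \<comment> \<open>Back from the sign-indexed notation: \<epsilon> = 1 gives the first sum of the
      formula and \<epsilon> = -1 the second.\<close>
    have dd: "ddiff 1 k i f = exact_quot (f - poly_act (refl_s k i) f) (pvar i - pvar k)"
      "ddiff (-1) k i f = exact_quot (f - poly_act (refl_sbar k i) f) (pvar i + pvar k)" for k
      by (simp_all add: ddiff_def proot_def wrefl_def)
    have kr: "kact (K.kr 1 k i) m =
        in_K ((1 + gen (Kc k) * gen (Kc i)) * gen (Kw (refl_s k i))) \<odot>\<^bsub>M\<^esub> m"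
      "kact (K.kr (-1) k i) m =
        in_K ((1 - gen (Kc k) * gen (Kc i)) * gen (Kw (refl_sbar k i))) \<odot>\<^bsub>M\<^esub> m" for k
      by (simp_all add: kact_in_K K.kr_def wrefl_def family_simps flip: pgen_def)
    have act: "poly_module_act u M act (in_H u (gen (Hx i))) (ptens M f m) =
        V.cls (\<Sum>k\<in>UNIV - {i}. frag_of (pconst u * ddiff 1 k i f, kact (K.kr 1 k i) m))
        \<oplus>\<^bsub>poly_tensor M\<^esub>
        V.cls (\<Sum>k\<in>UNIV - {i}. frag_of (pconst u * ddiff (-1) k i f, kact (K.kr (-1) k i) m))"
      using m by (simp add: Hx_action sum.distrib poly_tensor_eq)
    have sum: "V.cls (\<Sum>k\<in>UNIV - {i}. frag_of (pconst u * ddiff \<epsilon> k i f, kact (K.kr \<epsilon> k i) m)) =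
        u \<odot>\<^bsub>poly_tensor M\<^esub>
          (\<Oplus>\<^bsub>poly_tensor M\<^esub> k\<in>UNIV - {i}. ptens M (ddiff \<epsilon> k i f) (kact (K.kr \<epsilon> k i) m))" for \<epsilon>
      using m by (intro scaled_sum[symmetric]) simp
    show "poly_module_act u M act (in_H u (gen (Hx i))) (ptens M f m) =
          u \<odot>\<^bsub>poly_tensor M\<^esub>
            (\<Oplus>\<^bsub>poly_tensor M\<^esub> k\<in>UNIV - {i}.
              ptens M (exact_quot (f - poly_act (refl_s k i) f) (pvar i - pvar k))
                (in_K ((1 + gen (Kc k) * gen (Kc i)) * gen (Kw (refl_s k i))) \<odot>\<^bsub>M\<^esub> m))
          \<oplus>\<^bsub>poly_tensor M\<^esub>
          u \<odot>\<^bsub>poly_tensor M\<^esub>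
            (\<Oplus>\<^bsub>poly_tensor M\<^esub> k\<in>UNIV - {i}.
              ptens M (exact_quot (f - poly_act (refl_sbar k i) f) (pvar i + pvar k))
                (in_K ((1 - gen (Kc k) * gen (Kc i)) * gen (Kw (refl_sbar k i))) \<odot>\<^bsub>M\<^esub> m))"
      by (simp only: act sum flip: dd kr)
  qed
qed

end
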